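(* Consider a port-Hamiltonian descriptor system $(E,J,R,Q,B)$ with $A=(J-R)Q$, $C=B^\top Q$, $(E,A)$ regular, $(E,A,B)$ strongly stabilizable and $(E,A,C)$ strongly detectable, and let $r=\mathrm{rank}(E)$. (i) There exist $S,T\in\mathrm{GL}(n)$ such that the transformed pH system $(\widetilde E,\widetilde J,\widetilde R,\widetilde Q,\widetilde B)$ is semi-explicit and all stabilizing solutions $\widetilde{\mathcal P}_{\mathrm c},\widetilde{\mathcal P}_{\mathrm f}$ of (GC), (GF) associated with the transformed system satisfy $\widetilde{\mathcal P}_{\mathrm f}\widetilde E^\top=\mathrm{diag}(\Sigma,\Sigma_2,0,0,0)$, $\widetilde E^\top\widetilde{\mathcal P}_{\mathrm c}=\mathrm{diag}(\Sigma,0,\Sigma_3,0,0)$ (same block partition in both, the last diagonal block being of size $n-r$), where $\Sigma=\mathrm{diag}(\sigma_1,\dots,\sigma_k)$ with $\sigma_1\ge\sigma_2\ge\dots\ge\sigma_k>0$, and $\Sigma_2,\Sigma_3$ are positive definite diagonal matrices (possibly of size zero). (ii) If $Q$ is invertible, then $\widetilde Q$ from (i) has the block structure $\widetilde Q=\begin{bmatrix}\widetilde Q_{11}&0\\ \widetilde Q_{21}&\widetilde Q_{22}\end{bmatrix}$ with $\widetilde Q_{11}\in\mathbb{R}^{r\times r}$ diagonal.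
   Context: A pH descriptor system: $E,J,R,Q\in\mathbb{R}^{n\times n}$, $B\in\mathbb{R}^{n\times m}$, $E^\top Q=Q^\top E\succeq0$, $J^\top=-J$, $R=R^\top\succeq0$, $A:=(J-R)Q$, $C:=B^\top Q$. Semi-explicit: $E=\mathrm{diag}(I_r,0)$. For $S,T$ invertible, the transformed pH system is $\widetilde E=SET^{-1}$, $\widetilde J=SJS^\top$, $\widetilde R=SRS^\top$, $\widetilde Q=S^{-\top}QT^{-1}$, $\widetilde B=SB$, with $\widetilde A=SAT^{-1}$, $\widetilde C=\widetilde B^\top\widetilde Q=CT^{-1}$. Regular pencil: $\det(sE-A)\ne0$ for some $s$; impulse-free: nilpotent part of Weierstraß form vanishes. $(E,A,B)$ strongly stabilizable: $\mathrm{rank}[E\ \ AS\ \ B]=n$ ($\mathrm{im}\,S=\ker E$) and $\mathrm{rank}[\lambda E-A\ \ B]=n$ for all $\mathrm{Re}\,\lambda\ge0$; $(E,A,C)$ strongly detectable: $(E^\top,A^\top,C^\top)$ strongly stabilizable. GAREs: (GC) $A^\top\mathcal P_{\mathrm c}+\mathcal P_{\mathrm c}^\top A-\mathcal P_{\mathrm c}^\top BB^\top\mathcal P_{\mathrm c}+C^\top C=0$, $E^\top\mathcal P_{\mathrm c}=\mathcal P_{\mathrm c}^\top E$; (GF) $A\mathcal P_{\mathrm f}^\top+\mathcal P_{\mathrm f}A^\top-\mathcal P_{\mathrm f}C^\top C\mathcal P_{\mathrm f}^\top+BB^\top+2R=0$, $E\mathcal P_{\mathrm f}^\top=\mathcal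 P_{\mathrm f}E^\top$. Stabilizing: $(E,A-BB^\top\mathcal P_{\mathrm c})$, resp. $(E,A-\mathcal P_{\mathrm f}C^\top C)$, regular, impulse-free, all finite eigenvalues in the open left half-plane. *)

theory Defs
  imports Complex_Main "Jordan_Normal_Form.DL_Rank" "Jordan_Normal_Form.Matrix_Kernel"
begin

definition mrank :: "'a::field mat \<Rightarrow> nat" where
  "mrank A = vec_space.rank (dim_row A) A"

definition hcat :: "'a mat \<Rightarrow> 'a mat \<Rightarrow> 'a mat" where
  "hcat A B = mat (dim_row A) (dim_col A + dim_col B)
     (\<lambda>(i,j). if j < dim_col A then A $$ (i,j) else B $$ (i, j - dim_col A))"

definition mat_image :: "'a::comm_ring_1 mat \<Rightarrow> 'a vec set" where
  "mat_image A = {A *\<^sub>v x | x. x \<in> carrier_vec (dim_col A)}"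

definition cmat :: "real mat \<Rightarrow> complex mat" where
  "cmat A = map_mat complex_of_real A"

definition psd_mat :: "nat \<Rightarrow> real mat \<Rightarrow> bool" where
  "psd_mat n A \<longleftrightarrow> A \<in> carrier_mat n n \<and> A\<^sup>T = A \<and>
     (\<forall>x \<in> carrier_vec n. x \<bullet> (A *\<^sub>v x) \<ge> 0)"

definition diag_of :: "nat \<Rightarrow> (nat \<Rightarrow> 'a::zero) \<Rightarrow> 'a mat" where
  "diag_of n d = mat n n (\<lambda>(i,j). if i = j then d i else 0)"

definition pH_system :: "nat \<Rightarrow> nat \<Rightarrow> real mat \<Rightarrow> real mat \<Rightarrow> real mat \<Rightarrow> real mat \<Rightarrow> real mat \<Rightarrow> bool" where
  "pH_system n m E J R Q B \<longleftrightarrow>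
     E \<in> carrier_mat n n \<and> J \<in> carrier_mat n n \<and> R \<in> carrier_mat n n \<and>
     Q \<in> carrier_mat n n \<and> B \<in> carrier_mat n m \<and>
     E\<^sup>T * Q = Q\<^sup>T * E \<and> psd_mat n (E\<^sup>T * Q) \<and>
     J\<^sup>T = - J \<and> psd_mat n R"

definition regular_pencil :: "real mat \<Rightarrow> real mat \<Rightarrow> bool" where
  "regular_pencil E A \<longleftrightarrow> (\<exists>s::complex. det (s \<cdot>\<^sub>m cmat E - cmat A) \<noteq> 0)"

text \<open>Impulse-free: a (real) Weierstrass form U E V = diag(I_q, N), U A V = diag(F, I)
  exists whose nilpotent part N vanishes.\<close>
definition impulse_free :: "nat \<Rightarrow> real mat \<Rightarrow> real mat \<Rightarrow> bool" where
  "impulse_free n E A \<longleftrightarrow>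
     (\<exists>U V F q. U \<in> carrier_mat n n \<and> V \<in> carrier_mat n n \<and>
        invertible_mat U \<and> invertible_mat V \<and> q \<le> n \<and> F \<in> carrier_mat q q \<and>
        U * E * V = four_block_mat (1\<^sub>m q) (0\<^sub>m q (n - q)) (0\<^sub>m (n - q) q) (0\<^sub>m (n - q) (n - q)) \<and>
        U * A * V = four_block_mat F (0\<^sub>m q (n - q)) (0\<^sub>m (n - q) q) (1\<^sub>m (n - q)))"

definition finite_eigenvalue :: "real mat \<Rightarrow> real mat \<Rightarrow> complex \<Rightarrow> bool" where
  "finite_eigenvalue E A z \<longleftrightarrow> det (z \<cdot>\<^sub>m cmat E - cmat A) = 0"

definition stable_pencil :: "nat \<Rightarrow> real mat \<Rightarrow> real mat \<Rightarrow> bool" where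
  "stable_pencil n E A \<longleftrightarrow> regular_pencil E A \<and> impulse_free n E A \<and>
     (\<forall>z. finite_eigenvalue E A z \<longrightarrow> Re z < 0)"

definition strongly_stabilizable :: "nat \<Rightarrow> real mat \<Rightarrow> real mat \<Rightarrow> real mat \<Rightarrow> bool" where
  "strongly_stabilizable n E A B \<longleftrightarrow>
     (\<exists>Z p. Z \<in> carrier_mat n p \<and> mat_image Z = mat_kernel E \<and>
        mrank (hcat (hcat E (A * Z)) B) = n) \<and>
     (\<forall>z::complex. Re z \<ge> 0 \<longrightarrow> mrank (hcat (z \<cdot>\<^sub>m cmat E - cmat A) (cmat B)) = n)"

definition strongly_detectable :: "nat \<Rightarrow> real mat \<Rightarrow> real mat \<Rightarrow> real mat \<Rightarrow> bool" where
  "strongly_detectable n E A C \<longleftrightarrow> strongly_stabilizable n E\<^sup>T A\<^sup>T C\<^sup>T"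

definition stab_sol_GC :: "nat \<Rightarrow> real mat \<Rightarrow> real mat \<Rightarrow> real mat \<Rightarrow> real mat \<Rightarrow> real mat \<Rightarrow> bool" where
  "stab_sol_GC n E A B C P \<longleftrightarrow> P \<in> carrier_mat n n \<and>
     A\<^sup>T * P + P\<^sup>T * A - P\<^sup>T * B * B\<^sup>T * P + C\<^sup>T * C = 0\<^sub>m n n \<and>
     E\<^sup>T * P = P\<^sup>T * E \<and>
     stable_pencil n E (A - B * B\<^sup>T * P)"

definition stab_sol_GF :: "nat \<Rightarrow> real mat \<Rightarrow> real mat \<Rightarrow> real mat \<Rightarrow> real mat \<Rightarrow> real mat \<Rightarrow> real mat \<Rightarrow> bool" where
  "stab_sol_GF n E A B C R P \<longleftrightarrow> P \<in> carrier_mat n n \<and>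
     A * P\<^sup>T + P * A\<^sup>T - P * C\<^sup>T * C * P\<^sup>T + B * B\<^sup>T + 2 \<cdot>\<^sub>m R = 0\<^sub>m n n \<and>
     E * P\<^sup>T = P * E\<^sup>T \<and>
     stable_pencil n E (A - P * C\<^sup>T * C)"

end

(*
The equations (GC) and (GF) are instances of one Riccati equation. A Lyapunov argument on the
Weierstrass form of the closed loop shows that a stabilizing solution P makes P E\<^sup>T the largest
among all solutions, so P_f E\<^sup>T and E\<^sup>T P_c are unique, and they are positive semidefinite.
In semi-explicit coordinates only their leading r x r blocks X, Y are nonzero. A transformation
S = T = diag(S1, I) keeps E and acts by X -> S1 X S1\<^sup>T, Y -> S1\<^sup>-\<^sup>T Y S1\<^sup>-\<^sup>1, so it remains to
diagonalize a pair of positive semidefinite matrices contragrediently, then sort and rescale.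
If Q is invertible, the pH structure makes Q\<^sup>-\<^sup>T a solution of (GF), which is stabilizing by
detectability; by uniqueness the leading block of Q is the inverse of the diagonal block of P_f E\<^sup>T.
If the equations have no stabilizing solutions, it suffices to diagonalize the block of Q.
*)

theory Submission
  imports Defs "Jordan_Normal_Form.Spectral_Radius" "Jordan_Normal_Form.Schur_Decomposition"
begin

section \<open>Matrix algebra and positive semidefinite matrices\<close>

text \<open>The order of the quantifiers shapes the proof: \<open>S\<close> and \<open>T\<close> are
  fixed before any solution is given and must serve every pair of solutions. For this it is enough
  that the products with \<open>E\<^sup>T\<close> are determined by the data; the solutions
  themselves need not be. No solution has to exist, yet (ii) must hold for the same \<open>S\<close>
  and \<open>T\<close>, so the pair of matrices to be diagonalized is chosen by a case distinction.
  Both matrices of that pair may be singular. Therefore the diagonalization splits off one pair of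
  dual vectors at a time, \<open>p \<bullet> v = 1\<close> with
  \<open>X *\<^sub>v p = a \<cdot>\<^sub>v v\<close> and
  \<open>Y *\<^sub>v v = b \<cdot>\<^sub>v p\<close>, and continues on the complement. Each
  \<open>a * b\<close> is an eigenvalue of \<open>X * Y\<close>, hence unaffected by rescaling; its
  square root is the balanced value. Forms are real but eigenvalues complex, so eigenvectors of
  pencils are carried as pairs of real vectors in the energy arguments. Strong detectability is
  turned from a rank condition into a kernel condition, because the energy argument ends with
  vectors on which the output vanishes.\<close>

text \<open>The library states these laws for explicit carriers; with side conditions on the
  dimensions only they become usable as rewrite rules.\<close>

lemma dim_assoc_mult_mat:
  "dim_col A = dim_row B \<Longrightarrow> dim_col B = dim_row C \<Longrightarrow> A * B * C = A * (B * C :: 'a::semiring_0 mat)"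
  by (rule assoc_mult_mat[of _ "dim_row A" "dim_col A" _ "dim_col B" _ "dim_col C"]) auto

lemma dim_transpose_mult:
  "dim_col A = dim_row B \<Longrightarrow> (A * B)\<^sup>T = B\<^sup>T * (A :: 'a::comm_semiring_0 mat)\<^sup>T"
  by (rule transpose_mult[of _ "dim_row A" "dim_col A" _ "dim_col B"]) auto

lemma dim_add_mult_distrib_mat:
  "dim_row A = dim_row B \<Longrightarrow> dim_col A = dim_col B \<Longrightarrow> dim_col B = dim_row C \<Longrightarrow>
   (A + B) * C = A * C + B * (C :: 'a::semiring_0 mat)"
  by (rule add_mult_distrib_mat[of _ "dim_row A" "dim_col A" _ _ "dim_col C"]) auto

lemma dim_mult_add_distrib_mat:
  "dim_row B = dim_row C \<Longrightarrow> dim_col B = dim_col C \<Longrightarrow> dim_col A = dim_row C \<Longrightarrow>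
   A * (B + C) = A * B + A * (C :: 'a::semiring_0 mat)"
  by (rule mult_add_distrib_mat[of _ "dim_row A" "dim_col A" _ "dim_col C"]) auto

lemma dim_minus_mult_distrib_mat:
  "dim_row A = dim_row B \<Longrightarrow> dim_col A = dim_col B \<Longrightarrow> dim_col B = dim_row C \<Longrightarrow>
   (A - B) * C = A * C - B * (C :: 'a::ring mat)"
  by (rule minus_mult_distrib_mat[of _ "dim_row A" "dim_col A" _ _ "dim_col C"]) auto

lemma dim_mult_minus_distrib_mat:
  "dim_row B = dim_row C \<Longrightarrow> dim_col B = dim_col C \<Longrightarrow> dim_col A = dim_row C \<Longrightarrow>
   A * (B - C) = A * B - A * (C :: 'a::ring mat)"
  by (rule mult_minus_distrib_mat[of _ "dim_row A" "dim_col A" _ "dim_col C"]) auto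

lemma dim_transpose_add:
  "dim_row A = dim_row B \<Longrightarrow> dim_col A = dim_col B \<Longrightarrow> (A + B)\<^sup>T = A\<^sup>T + (B :: 'a::semigroup_add mat)\<^sup>T"
  by auto

lemma dim_transpose_minus:
  "dim_row A = dim_row B \<Longrightarrow> dim_col A = dim_col B \<Longrightarrow> (A - B)\<^sup>T = A\<^sup>T - (B :: 'a::ab_group_add mat)\<^sup>T"
  by auto

lemma dim_assoc_mult_mat_vec:
  "dim_col A = dim_row B \<Longrightarrow> dim_col B = dim_vec v \<Longrightarrow> A * B *\<^sub>v v = A *\<^sub>v (B *\<^sub>v (v :: 'a::semiring_0 vec))"
  by (rule assoc_mult_mat_vec[of _ "dim_row A" "dim_col A" _ "dim_col B"]) auto

lemma dim_add_mult_mat_vec: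
  "dim_row A = dim_row B \<Longrightarrow> dim_col A = dim_col B \<Longrightarrow> dim_col B = dim_vec v \<Longrightarrow>
   (A + B) *\<^sub>v v = A *\<^sub>v v + B *\<^sub>v (v :: 'a::semiring_0 vec)"
  by (rule add_mult_distrib_mat_vec[of _ "dim_row A" "dim_col A"]) auto

lemma dim_minus_mult_mat_vec:
  "dim_row A = dim_row B \<Longrightarrow> dim_col A = dim_col B \<Longrightarrow> dim_col B = dim_vec v \<Longrightarrow>
   (A - B) *\<^sub>v v = A *\<^sub>v v - B *\<^sub>v (v :: 'a::ring vec)"
  by (rule minus_mult_distrib_mat_vec[of _ "dim_row A" "dim_col A"]) auto

lemma dim_mult_mat_vec_add:
  "dim_col A = dim_vec v \<Longrightarrow> dim_vec v = dim_vec w \<Longrightarrow>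
   A *\<^sub>v (v + w) = A *\<^sub>v v + A *\<^sub>v (w :: 'a::semiring_0 vec)"
  by (rule mult_add_distrib_mat_vec[of _ "dim_row A" "dim_col A"]) (auto intro!: carrier_vecI)

lemma dim_mult_mat_vec_minus:
  "dim_col A = dim_vec v \<Longrightarrow> dim_vec v = dim_vec w \<Longrightarrow>
   A *\<^sub>v (v - w) = A *\<^sub>v v - A *\<^sub>v (w :: 'a::ring vec)"
  by (rule mult_minus_distrib_mat_vec[of _ "dim_row A" "dim_col A"]) (auto intro!: carrier_vecI)

lemma dim_mult_mat_vec_smult:
  "dim_col A = dim_vec v \<Longrightarrow> A *\<^sub>v (k \<cdot>\<^sub>v v) = k \<cdot>\<^sub>v (A *\<^sub>v (v :: 'a::comm_semiring_0 vec))"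
  by (auto simp: scalar_prod_def sum_distrib_left mult.left_commute intro!: eq_vecI)

lemma dim_smult_mat_mult_vec:
  "dim_col A = dim_vec v \<Longrightarrow> (k \<cdot>\<^sub>m A) *\<^sub>v v = k \<cdot>\<^sub>v (A *\<^sub>v (v :: 'a::comm_semiring_0 vec))"
  by (auto simp: scalar_prod_def sum_distrib_left mult.assoc intro!: eq_vecI)

lemma dim_add_scalar_prod:
  "dim_vec u = dim_vec v \<Longrightarrow> dim_vec v = dim_vec w \<Longrightarrow> (u + v) \<bullet> w = u \<bullet> w + v \<bullet> (w :: 'a::semiring_0 vec)"
  by (rule add_scalar_prod_distrib[of _ "dim_vec u"]) (auto intro!: carrier_vecI)

lemma dim_scalar_prod_add:
  "dim_vec u = dim_vec v \<Longrightarrow> dim_vec v = dim_vec w \<Longrightarrow> u \<bullet> (v + w) = u \<bullet> v + u \<bullet> (w :: 'a::semiring_0 vec)"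
  by (rule scalar_prod_add_distrib[of _ "dim_vec u"]) (auto intro!: carrier_vecI)

lemma dim_minus_scalar_prod:
  "dim_vec u = dim_vec v \<Longrightarrow> dim_vec v = dim_vec w \<Longrightarrow> (u - v) \<bullet> w = u \<bullet> w - v \<bullet> (w :: 'a::ring vec)"
  by (rule minus_scalar_prod_distrib[of _ "dim_vec u"]) (auto intro!: carrier_vecI)

lemma dim_scalar_prod_minus:
  "dim_vec u = dim_vec v \<Longrightarrow> dim_vec v = dim_vec w \<Longrightarrow> u \<bullet> (v - w) = u \<bullet> v - u \<bullet> (w :: 'a::ring vec)"
  by (rule scalar_prod_minus_distrib[of _ "dim_vec u"]) (auto intro!: carrier_vecI)

lemma dim_transpose_smult: "(c \<cdot>\<^sub>m A)\<^sup>T = c \<cdot>\<^sub>m A\<^sup>T"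
  by auto

lemma dim_one_mult_mat: "dim_row A = n \<Longrightarrow> 1\<^sub>m n * A = (A :: 'a::semiring_1 mat)"
  by (rule left_mult_one_mat[of _ _ "dim_col A"]) (rule carrier_matI, simp_all)

lemma dim_mult_one_mat: "dim_col A = n \<Longrightarrow> A * 1\<^sub>m n = (A :: 'a::semiring_1 mat)"
  by (rule right_mult_one_mat[of _ "dim_row A"]) (rule carrier_matI, simp_all)

lemma dim_one_mult_mat_vec: "dim_vec v = n \<Longrightarrow> 1\<^sub>m n *\<^sub>v v = (v :: 'a::semiring_1 vec)"
  by (rule one_mult_mat_vec) (rule carrier_vecI)

lemma dim_mult_mat_vec_zero:
  "dim_col A = n \<Longrightarrow> A *\<^sub>v 0\<^sub>v n = 0\<^sub>v (dim_row (A :: 'a::semiring_0 mat))"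
  by (auto intro!: eq_vecI)

text \<open>Rewriting yields sums of right-nested products with transposes only on atoms, and the
  dimension conditions are discharged by local simp facts. Inverse pairs then meet inside nested
  products, which is why cancellation rules below have the shape
  \<open>A * (Ai * X) = X\<close>.\<close>

lemmas dim_mat_ring = dim_one_mult_mat dim_mult_one_mat dim_assoc_mult_mat dim_transpose_mult dim_add_mult_distrib_mat
  dim_mult_add_distrib_mat dim_minus_mult_distrib_mat dim_mult_minus_distrib_mat
  dim_transpose_add dim_transpose_minus dim_transpose_smult

lemmas dim_mat_vec = dim_one_mult_mat_vec dim_mult_mat_vec_zero dim_assoc_mult_mat_vec dim_add_mult_mat_vec dim_minus_mult_mat_vec
  dim_mult_mat_vec_add dim_mult_mat_vec_minus dim_mult_mat_vec_smult dim_smult_mat_mult_vec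

lemmas dim_scalar_prod = dim_add_scalar_prod dim_scalar_prod_add dim_minus_scalar_prod
  dim_scalar_prod_minus

lemma scalar_mat_transpose:
  fixes A :: "'a::comm_semiring_0 mat"
  assumes A: "A \<in> carrier_mat nr nc" and x: "x \<in> carrier_vec nr" and y: "y \<in> carrier_vec nc"
  shows "x \<bullet> (A *\<^sub>v y) = (A\<^sup>T *\<^sub>v x) \<bullet> y"
  using transpose_vec_mult_scalar[OF A y x] by simp

lemma scalar_sym_mat:
  fixes Z :: "real mat"
  assumes Z: "Z \<in> carrier_mat n n" "Z\<^sup>T = Z" and x: "x \<in> carrier_vec n" and y: "y \<in> carrier_vec n"
  shows "x \<bullet> (Z *\<^sub>v y) = y \<bullet> (Z *\<^sub>v x)"
  using scalar_mat_transpose[OF Z(1) x y] Z(2) comm_scalar_prod[OF mult_mat_vec_carrier[OF Z(1) x] y]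
  by simp

lemma scalar_self_zero:
  fixes x :: "real vec"
  assumes "x \<in> carrier_vec n" "x \<bullet> x \<le> 0"
  shows "x = 0\<^sub>v n"
proof -
  have "(\<Sum>i\<in>{0..<n}. x $ i * x $ i) \<le> 0" using assms by (auto simp: scalar_prod_def)
  moreover have "\<And>i. i \<in> {0..<n} \<Longrightarrow> 0 \<le> x $ i * x $ i" by simp
  ultimately have "\<And>i. i \<in> {0..<n} \<Longrightarrow> x $ i * x $ i = 0"
    by (intro sum_nonneg_0[of "{0..<n}" "\<lambda>i. x $ i * x $ i"] antisym sum_nonneg) auto
  thus ?thesis using assms by (intro eq_vecI) auto
qed

lemma scalar_self_nonneg: "0 \<le> (x :: real vec) \<bullet> x"
  by (auto simp: scalar_prod_def intro!: sum_nonneg)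

section \<open>Positive semidefinite matrices\<close>

lemma psd_matD:
  assumes "psd_mat n A"
  shows "A \<in> carrier_mat n n" "A\<^sup>T = A" "x \<in> carrier_vec n \<Longrightarrow> 0 \<le> x \<bullet> (A *\<^sub>v x)"
  using assms by (auto simp: psd_mat_def)

text \<open>A quadratic form that is nonnegative on the line
  \<open>x + t \<cdot>\<^sub>v (A *\<^sub>v x)\<close> and zero at \<open>t = 0\<close> has no
  linear term there; this term is twice the squared length of \<open>A *\<^sub>v x\<close>.\<close>

lemma psd_null:
  assumes A: "psd_mat n A" and x: "x \<in> carrier_vec n" and z: "x \<bullet> (A *\<^sub>v x) = 0"
  shows "A *\<^sub>v x = 0\<^sub>v n"
proof -
  note [simp] = psd_matD(1)[OF A] x
  define y where "y = A *\<^sub>v x"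
  note [simp] = mult_mat_vec_carrier[of _ n n]
  have y[simp]: "y \<in> carrier_vec n" by (simp add: y_def)
  define p where "p = y \<bullet> y"
  define q where "q = y \<bullet> (A *\<^sub>v y)"
  have q0: "q \<ge> 0" unfolding q_def using psd_matD(3)[OF A] by simp
  have yAx: "y \<bullet> (A *\<^sub>v x) = p" by (simp add: p_def y_def)
  have xAy: "x \<bullet> (A *\<^sub>v y) = p" using scalar_sym_mat[OF psd_matD(1,2)[OF A], of x y] yAx by simp
  \<comment> \<open>At this \<open>t\<close> the form equals \<open>- t * t * (q + 2)\<close>. The
    summand 1 keeps the denominator positive when \<open>q = 0\<close>.\<close>
  define t where "t = - p / (q + 1)"
  have "0 \<le> (x + t \<cdot>\<^sub>v y) \<bullet> (A *\<^sub>v (x + t \<cdot>\<^sub>v y))" by (rule psd_matD(3)[OF A]) simp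
  also have "A *\<^sub>v (x + t \<cdot>\<^sub>v y) = A *\<^sub>v x + t \<cdot>\<^sub>v (A *\<^sub>v y)"
    by (simp add: mult_add_distrib_mat_vec[of _ n n] mult_mat_vec[of _ n n])
  also have "(x + t \<cdot>\<^sub>v y) \<bullet> (A *\<^sub>v x + t \<cdot>\<^sub>v (A *\<^sub>v y)) = 2 * t * p + t * t * q"
    by (simp add: add_scalar_prod_distrib[of _ n] scalar_prod_add_distrib[of _ n]
        smult_scalar_prod_distrib[of _ n] scalar_prod_smult_distrib[of _ n] z yAx xAy q_def[symmetric] algebra_simps)
  finally have 1: "0 \<le> 2 * t * p + t * t * q" .
  have p: "p = - t * (q + 1)" using q0 by (simp add: t_def)
  have "t * t * (q + 2) \<le> 0" using 1 unfolding p by (simp add: algebra_simps)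
  hence "t * t \<le> 0" using q0 by (simp add: mult_le_0_iff[of "t * t"])
  hence "t = 0" by (auto simp: mult_le_0_iff)
  hence "p = 0" using p by simp
  thus ?thesis using scalar_self_zero[OF y] by (simp add: p_def y_def)
qed

lemma psd_congruence:
  assumes M: "psd_mat n M" and S: "S \<in> carrier_mat k n"
  shows "psd_mat k (S * M * S\<^sup>T)"
proof -
  note [simp] = carrier_matD[OF psd_matD(1)[OF M]] carrier_matD[OF S]
  have "(S * M * S\<^sup>T)\<^sup>T = S * M * S\<^sup>T"
    using psd_matD(2)[OF M] by (simp add: dim_mat_ring)
  moreover have "x \<bullet> (S * M * S\<^sup>T *\<^sub>v x) \<ge> 0" if x: "x \<in> carrier_vec k" for x
  proof -
    note [simp] = carrier_vecD[OF x]
    have "x \<bullet> (S * M * S\<^sup>T *\<^sub>v x) = x \<bullet> (S *\<^sub>v (M *\<^sub>v (S\<^sup>T *\<^sub>v x)))"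
      by (simp add: dim_mat_vec)
    also have "\<dots> = (S\<^sup>T *\<^sub>v x) \<bullet> (M *\<^sub>v (S\<^sup>T *\<^sub>v x))"
      by (rule scalar_mat_transpose[OF S x]) (auto intro!: carrier_vecI)
    also have "\<dots> \<ge> 0" by (rule psd_matD(3)[OF M]) (auto intro!: carrier_vecI)
    finally show ?thesis .
  qed
  moreover have "S * M * S\<^sup>T \<in> carrier_mat k k" by (rule carrier_matI) simp_all
  ultimately show ?thesis unfolding psd_mat_def by blast
qed

lemma psd_one: "psd_mat n (1\<^sub>m n)"
  by (auto simp: psd_mat_def scalar_self_nonneg)

lemma psd_gram:
  assumes "C \<in> carrier_mat n p" shows "psd_mat n (C * C\<^sup>T)"
  using psd_congruence[OF psd_one assms] assms by simp

lemma psd_add: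
  assumes A: "psd_mat n A" and B: "psd_mat n B" shows "psd_mat n (A + B)"
  using psd_matD[OF A] psd_matD[OF B]
  by (auto simp: psd_mat_def transpose_add[of _ n n] add_mult_distrib_mat_vec[of _ n n] scalar_prod_add_distrib[of _ n])

lemma psd_smult:
  assumes A: "psd_mat n A" and "c \<ge> 0" shows "psd_mat n (c \<cdot>\<^sub>m A)"
proof -
  have "(c \<cdot>\<^sub>m A) *\<^sub>v x = c \<cdot>\<^sub>v (A *\<^sub>v x)" if "x \<in> carrier_vec n" for x
    using psd_matD(1)[OF A] that by (simp add: dim_mat_vec)
  thus ?thesis using psd_matD[OF A] assms(2) by (auto simp: psd_mat_def dim_transpose_smult)
qed

text \<open>Every unit vector is a null vector of the form, so \<open>psd_null\<close> makes each
  column vanish.\<close>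

lemma psd_antisym:
  assumes A: "psd_mat n A" and B: "psd_mat n (- A)" 
  shows "A = 0\<^sub>m n n"
proof (rule eq_matI)
  note [simp] = psd_matD(1)[OF A] carrier_matD[OF psd_matD(1)[OF A]]
  fix i j assume i: "i < dim_row (0\<^sub>m n n :: real mat)" and j: "j < dim_col (0\<^sub>m n n :: real mat)"
  have "unit_vec n j \<bullet> (A *\<^sub>v unit_vec n j) = 0"
    using psd_matD(3)[OF A, of "unit_vec n j"] psd_matD(3)[OF B, of "unit_vec n j"] j
    by (simp add: uminus_mult_mat_vec del: index_unit_vec)
  from psd_null[OF A _ this] have "(A *\<^sub>v unit_vec n j) $ i = 0" using i by simp
  thus "A $$ (i,j) = (0\<^sub>m n n :: real mat) $$ (i,j)" using i j by simp
qed (use psd_matD(1)[OF A] in auto)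

section \<open>The Lyapunov equation\<close>

lemma cmat_dim [simp]: "dim_row (cmat A) = dim_row A" "dim_col (cmat A) = dim_col A"
  by (simp_all add: cmat_def)

lemma cmat_carrier [simp]: "cmat A \<in> carrier_mat nr nc \<longleftrightarrow> A \<in> carrier_mat nr nc"
  by (simp add: cmat_def)

lemma cmat_index [simp]:
  "i < dim_row A \<Longrightarrow> j < dim_col A \<Longrightarrow> cmat A $$ (i,j) = of_real (A $$ (i,j))"
  by (simp add: cmat_def)

lemma cmat_mult: "dim_col A = dim_row B \<Longrightarrow> cmat (A * B) = cmat A * cmat B"
  unfolding cmat_def by (rule of_real_hom.mat_hom_mult[of _ "dim_row A" "dim_col A" _ "dim_col B"]) auto

lemma cmat_add: "dim_row A = dim_row B \<Longrightarrow> dim_col A = dim_col B \<Longrightarrow> cmat (A + B) = cmat A + cmat B"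
  by (auto simp: cmat_def)

lemma cmat_minus: "dim_row A = dim_row B \<Longrightarrow> dim_col A = dim_col B \<Longrightarrow> cmat (A - B) = cmat A - cmat B"
  by (auto simp: cmat_def)

lemma cmat_one: "cmat (1\<^sub>m n) = 1\<^sub>m n"
  by (auto simp: cmat_def)

lemma cmat_transpose: "cmat (A\<^sup>T) = (cmat A)\<^sup>T"
  by (auto simp: cmat_def)

lemma cmat_smult: "cmat (c \<cdot>\<^sub>m A) = of_real c \<cdot>\<^sub>m cmat A"
  by (auto simp: cmat_def)

lemma det_cmat: "det (cmat A) = of_real (det A)"
  by (simp add: cmat_def of_real_hom.hom_det)

lemma inverse_mat_obtain:
  fixes A :: "'a::field mat"
  assumes A: "A \<in> carrier_mat n n" and d: "det A \<noteq> 0"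
  obtains Ai where "Ai \<in> carrier_mat n n" "A * Ai = 1\<^sub>m n" "Ai * A = 1\<^sub>m n"
  using det_non_zero_imp_unit[OF A d, of "()"] by (auto simp: Units_def ring_mat_simps)

lemma mat_inverse_vec:
  assumes "A \<in> carrier_mat n n" "Ai \<in> carrier_mat n n" "A * Ai = 1\<^sub>m n" "x \<in> carrier_vec n"
  shows "A *\<^sub>v (Ai *\<^sub>v x) = (x :: 'a::comm_ring_1 vec)"
  using assms assoc_mult_mat_vec[of A n n Ai n x] by simp

lemma quad_form_bound:
  fixes Z :: "real mat"
  assumes Z: "Z \<in> carrier_mat n n" and y: "y \<in> carrier_vec n" and c: "\<And>i. i < n \<Longrightarrow> \<bar>y $ i\<bar> \<le> c" "0 \<le> c"
  shows "\<bar>y \<bullet> (Z *\<^sub>v y)\<bar> \<le> c * c * (\<Sum>i<n. \<Sum>j<n. \<bar>Z $$ (i,j)\<bar>)"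
proof -
  have "y \<bullet> (Z *\<^sub>v y) = (\<Sum>i<n. \<Sum>j<n. y $ i * (Z $$ (i,j) * y $ j))"
    using Z y by (auto simp: scalar_prod_def sum_distrib_left atLeast0LessThan intro!: sum.cong)
  also have "\<bar>\<dots>\<bar> \<le> (\<Sum>i<n. \<Sum>j<n. \<bar>y $ i * (Z $$ (i,j) * y $ j)\<bar>)"
    by (rule order_trans[OF sum_abs sum_mono[OF sum_abs]])
  also have "\<dots> \<le> (\<Sum>i<n. \<Sum>j<n. c * c * \<bar>Z $$ (i,j)\<bar>)"
  proof (intro sum_mono)
    fix i j assume i: "i \<in> {..<n}" and j: "j \<in> {..<n}"
    have "\<bar>y $ i * (Z $$ (i,j) * y $ j)\<bar> = (\<bar>y $ i\<bar> * \<bar>y $ j\<bar>) * \<bar>Z $$ (i,j)\<bar>"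
      by (simp add: abs_mult mult.assoc mult.left_commute mult.commute)
    also have "\<dots> \<le> (c * c) * \<bar>Z $$ (i,j)\<bar>"
      using c i j by (intro mult_right_mono mult_mono) auto
    finally show "\<bar>y $ i * (Z $$ (i,j) * y $ j)\<bar> \<le> c * c * \<bar>Z $$ (i,j)\<bar>" .
  qed
  also have "\<dots> = c * c * (\<Sum>i<n. \<Sum>j<n. \<bar>Z $$ (i,j)\<bar>)"
    by (simp add: sum_distrib_left)
  finally show ?thesis .
qed

text \<open>\<open>norm_bound\<close> bounds the entries of the complex powers. Their entries are
  those of the real powers, and summing over a row bounds each coordinate of the orbit independently
  of \<open>k\<close>.\<close>

lemma power_bounded_orbit:
  fixes K :: "real mat"
  assumes K: "K \<in> carrier_mat n n" and nb: "\<And>k. norm_bound (cmat K ^\<^sub>m k) c"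
    and x: "x \<in> carrier_vec n"
  obtains b where "0 \<le> b" "\<And>k i. i < n \<Longrightarrow> \<bar>(K ^\<^sub>m k *\<^sub>v x) $ i\<bar> \<le> b"
proof -
  define b where "b = (\<Sum>j<n. \<bar>c\<bar> * \<bar>x $ j\<bar>)"
  have pk: "K ^\<^sub>m k \<in> carrier_mat n n" for k using K by (rule pow_carrier_mat)
  have "\<bar>(K ^\<^sub>m k *\<^sub>v x) $ i\<bar> \<le> b" if i: "i < n" for k i
  proof -
    have e: "\<bar>(K ^\<^sub>m k) $$ (i,j)\<bar> \<le> \<bar>c\<bar>" if j: "j < n" for j
    proof -
      have "cmat K ^\<^sub>m k = cmat (K ^\<^sub>m k)" unfolding cmat_def by (rule of_real_hom.mat_hom_pow[OF K, symmetric])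
      hence "norm_bound (cmat (K ^\<^sub>m k)) c" using nb[of k] by simp
      hence "cmod (cmat (K ^\<^sub>m k) $$ (i,j)) \<le> c"
        using i j carrier_matD[OF pk[of k]] unfolding norm_bound_def by (simp add: cmat_def)
      thus ?thesis using i j carrier_matD[OF pk[of k]] by (simp add: cmat_def)
    qed
    have "(K ^\<^sub>m k *\<^sub>v x) $ i = (\<Sum>j<n. (K ^\<^sub>m k) $$ (i,j) * x $ j)"
      using i carrier_vecD[OF x] carrier_matD[OF pk[of k]] by (simp add: scalar_prod_def atLeast0LessThan)
    also have "\<bar>\<dots>\<bar> \<le> (\<Sum>j<n. \<bar>(K ^\<^sub>m k) $$ (i,j) * x $ j\<bar>)" by (rule sum_abs)
    also have "\<dots> \<le> b" unfolding b_def using e by (intro sum_mono) (auto simp: abs_mult intro: mult_right_mono)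
    finally show ?thesis .
  qed
  moreover have "0 \<le> b" unfolding b_def by (intro sum_nonneg) auto
  ultimately show ?thesis using that by blast
qed

text \<open>The Cayley transform exchanges the left half-plane and the unit disc, because
  \<open>Re z\<close> times the squared modulus of \<open>1 + \<mu>\<close> is the squared modulus
  of \<open>\<mu>\<close> minus 1. The relation is multiplied out, and \<open>\<mu> = -1\<close>
  would make it read \<open>0 = -2\<close>.\<close>

lemma cayley_norm_less_1:
  fixes \<mu> z :: complex
  assumes "(1 + \<mu>) * z = \<mu> - 1" "Re z < 0"
  shows "cmod \<mu> < 1"
proof -
  have ne: "1 + \<mu> \<noteq> 0"
  proof
    assume "1 + \<mu> = 0"
    with assms(1) have "\<mu> = 1" by simp
    with \<open>1 + \<mu> = 0\<close> show False by simp
  qed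
  have "z * (cmod (1 + \<mu>))\<^sup>2 = (\<mu> - 1) * cnj (1 + \<mu>)"
    unfolding assms(1)[symmetric] complex_norm_square by (simp add: ac_simps)
  hence "Re z * (cmod (1 + \<mu>))\<^sup>2 = (cmod \<mu>)\<^sup>2 - 1"
    by (simp add: complex_eq_iff cmod_power2[of \<mu>]) (simp add: power2_eq_square algebra_simps)
  moreover have "Re z * (cmod (1 + \<mu>))\<^sup>2 < 0" using assms(2) ne by (simp add: mult_less_0_iff)
  ultimately have "(cmod \<mu>)\<^sup>2 < 1" by simp
  thus ?thesis by (simp add: power_less_one_iff abs_square_less_1)
qed

text \<open>The Cayley transform \<open>K = (1 + H) (1 - H)\<^sup>-\<^sup>1\<close> turns the Lyapunov inequality into
  \<open>q (K x) \<le> q x\<close> for the form \<open>q\<close> of \<open>Z\<close>. If \<open>q x < 0\<close>, then \<open>q\<close> would be unbounded below on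
  the orbit of \<open>x\<close> under \<open>s K\<close>, although this matrix is power bounded for some \<open>s > 1\<close>.\<close>

lemma lyapunov_psd:
  fixes H Z M :: "real mat"
  assumes H: "H \<in> carrier_mat n n" and Z: "Z \<in> carrier_mat n n" "Z\<^sup>T = Z"
    and st: "\<And>z. eigenvalue (cmat H) z \<Longrightarrow> Re z < 0"
    and eq: "H\<^sup>T * Z + Z * H = - M" and M: "psd_mat n M"
  shows "psd_mat n Z"
proof (rule ccontr)
  assume "\<not> psd_mat n Z"
  then obtain x where x: "x \<in> carrier_vec n" and xZ: "x \<bullet> (Z *\<^sub>v x) < 0"
    using Z by (force simp: psd_mat_def)
  note [simp] = carrier_matD[OF H] carrier_matD[OF Z(1)] carrier_matD[OF psd_matD(1)[OF M]]
  \<comment> \<open>The spectral radius is a maximum over the spectrum, which is empty in dimension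
    0.\<close>
  have "n > 0"
    using x xZ Z by (cases n) (auto simp: scalar_prod_def)
  define cH where "cH = cmat H"
  have cH: "cH \<in> carrier_mat n n" using H by (simp add: cH_def)
  note [simp] = carrier_matD[OF cH]
  have "det (1\<^sub>m n - cH) \<noteq> 0"
  proof
    assume "det (1\<^sub>m n - cH) = 0"
    then obtain v where v: "v \<in> carrier_vec n" "v \<noteq> 0\<^sub>v n" "(1\<^sub>m n - cH) *\<^sub>v v = 0\<^sub>v n"
      using det_0_iff_vec_prod_zero_field[of "1\<^sub>m n - cH" n] minus_carrier_mat[OF cH, of "1\<^sub>m n"] by blast
    have "v - cH *\<^sub>v v = 0\<^sub>v n" using v(1,3) carrier_vecD[OF v(1)] by (simp add: dim_mat_vec)
    have "cH *\<^sub>v v = v"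
    proof (rule eq_vecI)
      fix i assume "i < dim_vec v"
      with v(1) have "i < n" by simp
      with arg_cong[OF \<open>v - cH *\<^sub>v v = 0\<^sub>v n\<close>, of "\<lambda>w. w $ i"] show "(cH *\<^sub>v v) $ i = v $ i"
        by (simp del: index_mult_mat_vec)
    qed (use v(1) in simp)
    hence "eigenvalue cH 1" unfolding eigenvalue_def eigenvector_def
      using v by (intro exI[of _ v]) simp
    from st[OF this[unfolded cH_def]] show False by simp
  qed
  moreover have "1\<^sub>m n - cH = cmat (1\<^sub>m n - H)"
    by (simp add: cH_def cmat_minus cmat_one)
  ultimately have "det (1\<^sub>m n - H) \<noteq> 0"
    by (simp add: det_cmat)
  from inverse_mat_obtain[OF minus_carrier_mat[OF H] this] obtain Ki where
    Ki: "Ki \<in> carrier_mat n n" "(1\<^sub>m n - H) * Ki = 1\<^sub>m n" "Ki * (1\<^sub>m n - H) = 1\<^sub>m n"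
    by blast
  note [simp] = carrier_matD[OF Ki(1)]
  define K where "K = (1\<^sub>m n + H) * Ki"
  have K: "K \<in> carrier_mat n n" unfolding K_def by (rule carrier_matI) simp_all
  note [simp] = carrier_matD[OF K]
  define q where "q x = x \<bullet> (Z *\<^sub>v x)" for x
  \<comment> \<open>For \<open>u = Ki *\<^sub>v y\<close> one has \<open>y = u - H u\<close> and
    \<open>K y = u + H u\<close>. The terms quadratic in \<open>u\<close> and in \<open>H u\<close>
    cancel in the difference of the forms, and the mixed ones give \<open>- 2\<close> times the form
    of \<open>M\<close> at \<open>u\<close>.\<close>
  have decr: "q (K *\<^sub>v y) \<le> q y" if y: "y \<in> carrier_vec n" for y
  proof -
    define u where "u = Ki *\<^sub>v y"
    define w where "w = H *\<^sub>v u"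
    have u: "u \<in> carrier_vec n" unfolding u_def by (rule carrier_vecI) simp
    have w: "w \<in> carrier_vec n" unfolding w_def by (rule carrier_vecI) simp
    note [simp] = carrier_vecD[OF u] carrier_vecD[OF w] carrier_vecD[OF y]
    have y_eq: "y = u - w"
      using mat_inverse_vec[OF minus_carrier_mat[OF H] Ki(1,2) y] u
      by (simp add: dim_mat_vec u_def[symmetric] w_def)
    have Ky: "K *\<^sub>v y = u + w"
      using u by (simp add: K_def dim_mat_vec u_def[symmetric] w_def)
    have "q (K *\<^sub>v y) - q y = 2 * (u \<bullet> (Z *\<^sub>v w) + w \<bullet> (Z *\<^sub>v u))"
      unfolding q_def Ky unfolding y_eq by (simp add: dim_mat_vec dim_scalar_prod)
    also have "w \<bullet> (Z *\<^sub>v u) = u \<bullet> (H\<^sup>T * Z *\<^sub>v u)"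
      using scalar_mat_transpose[of "H\<^sup>T" n n u "Z *\<^sub>v u"] H u Z(1)
      by (simp add: w_def dim_mat_vec)
    also have "u \<bullet> (Z *\<^sub>v w) + u \<bullet> (H\<^sup>T * Z *\<^sub>v u) = u \<bullet> ((H\<^sup>T * Z + Z * H) *\<^sub>v u)"
      by (simp add: w_def dim_mat_vec dim_scalar_prod)
    also have "\<dots> = - (u \<bullet> (M *\<^sub>v u))"
      unfolding eq by (simp add: uminus_mult_mat_vec)
    finally show ?thesis using psd_matD(3)[OF M u] by simp
  qed
  define cK where "cK = cmat K"
  have cK: "cK \<in> carrier_mat n n" using K by (simp add: cK_def)
  note [simp] = carrier_matD[OF cK]
  define cKi where "cKi = cmat Ki"
  have cKi: "cKi \<in> carrier_mat n n" using Ki by (simp add: cKi_def)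
  note [simp] = carrier_matD[OF cKi]
  have cK_eq: "cK = (1\<^sub>m n + cH) * cKi"
    unfolding cK_def K_def cKi_def cH_def by (simp add: cmat_mult cmat_add cmat_one)
  have cKi_inv: "(1\<^sub>m n - cH) * cKi = 1\<^sub>m n"
    using arg_cong[OF Ki(2), of cmat]
    by (simp add: cmat_mult cmat_minus cmat_one cH_def cKi_def)
  \<comment> \<open>If \<open>v = (1 - H) u\<close> is an eigenvector of \<open>K\<close>, then
    \<open>(1 + H) u = \<mu> (1 - H) u\<close>; solving for \<open>H u\<close> makes
    \<open>u\<close> an eigenvector of \<open>H\<close> for
    \<open>(\<mu> - 1) / (1 + \<mu>)\<close>.\<close>
  have eigK: "cmod \<mu> < 1" if "eigenvalue cK \<mu>" for \<mu>
  proof -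
    from that obtain v where v: "v \<in> carrier_vec n" "v \<noteq> 0\<^sub>v n" "cK *\<^sub>v v = \<mu> \<cdot>\<^sub>v v"
      by (auto simp: eigenvalue_def eigenvector_def)
    define u where "u = cKi *\<^sub>v v"
    define w where "w = cH *\<^sub>v u"
    have u: "u \<in> carrier_vec n" unfolding u_def by (rule carrier_vecI) simp
    have w: "w \<in> carrier_vec n" unfolding w_def by (rule carrier_vecI) simp
    note [simp] = carrier_vecD[OF u] carrier_vecD[OF w] carrier_vecD[OF v(1)]
    have v_eq: "v = u - w"
      using mat_inverse_vec[OF minus_carrier_mat[OF cH] cKi cKi_inv v(1)] u
      by (simp add: dim_mat_vec u_def[symmetric] w_def)
    have "cK *\<^sub>v v = u + w"
      using u by (simp add: cK_eq dim_mat_vec u_def[symmetric] w_def)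
    with v(3) have uw: "u + w = \<mu> \<cdot>\<^sub>v (u - w)" using v_eq by simp
    have e: "u $ i + w $ i = \<mu> * (u $ i - w $ i)" if "i < n" for i
      using arg_cong[OF uw, of "\<lambda>t. t $ i"] that by simp
    have u0: "u \<noteq> 0\<^sub>v n"
    proof
      assume "u = 0\<^sub>v n"
      hence "w = 0\<^sub>v n" by (simp add: w_def dim_mult_mat_vec_zero)
      with \<open>u = 0\<^sub>v n\<close> v_eq v(2) show False by auto
    qed
    then obtain i where i: "i < n" "u $ i \<noteq> 0" using u
      by (metis carrier_vecD eq_vecI index_zero_vec)
    have mu1: "1 + \<mu> \<noteq> 0"
    proof
      assume "1 + \<mu> = 0"
      hence "\<mu> = -1" by (simp add: add_eq_0_iff)
      with e[OF i(1)] i(2) show False by simp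
    qed
    define z where "z = (\<mu> - 1) / (1 + \<mu>)"
    have "w = z \<cdot>\<^sub>v u"
    proof (rule eq_vecI)
      fix j assume "j < dim_vec (z \<cdot>\<^sub>v u)"
      hence j: "j < n" by simp
      from e[OF j] have "(1 + \<mu>) * w $ j = (\<mu> - 1) * u $ j" by (simp add: algebra_simps)
      thus "w $ j = (z \<cdot>\<^sub>v u) $ j" using mu1 j by (simp add: z_def field_simps)
    qed auto
    hence "eigenvalue cH z" using u u0
      by (auto simp: eigenvalue_def eigenvector_def w_def)
    hence "Re z < 0" using st by (simp add: cH_def)
    thus ?thesis using mu1 by (intro cayley_norm_less_1[of \<mu> z]) (simp_all add: z_def)
  qed
  define \<rho> where "\<rho> = spectral_radius cK"
  have \<rho>: "\<rho> < 1" "0 \<le> \<rho>"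
    using spectral_radius_mem_max(1)[OF cK \<open>n > 0\<close>] eigK by (auto simp: \<rho>_def spectrum_def)
  \<comment> \<open>Any factor above 1 with \<open>s * \<rho> < 1\<close> would do; this choice also
    makes sense for \<open>\<rho> = 0\<close>.\<close>
  define s where "s = 2 / (1 + \<rho>)"
  have s: "s > 1" "s * \<rho> < 1" using \<rho> by (auto simp: s_def field_simps)
  define L where "L = s \<cdot>\<^sub>m K"
  have L: "L \<in> carrier_mat n n" using K by (simp add: L_def)
  have cL: "cmat L \<in> carrier_mat n n" using L by simp
  have cL_eq: "cmat L = of_real s \<cdot>\<^sub>m cK" by (simp add: cmat_smult cK_def L_def)
  have "spectral_radius (cmat L) < 1"
  proof -
    from spectral_radius_mem_max(1)[OF cL \<open>n > 0\<close>] obtain \<mu> where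
      \<mu>: "eigenvalue (cmat L) \<mu>" "spectral_radius (cmat L) = cmod \<mu>" by (auto simp: spectrum_def)
    from \<mu>(1) obtain v where v: "v \<in> carrier_vec n" "v \<noteq> 0\<^sub>v n" "cmat L *\<^sub>v v = \<mu> \<cdot>\<^sub>v v"
      using cL by (auto simp: eigenvalue_def eigenvector_def)
    have "of_real s \<cdot>\<^sub>v (cK *\<^sub>v v) = \<mu> \<cdot>\<^sub>v v"
      using v carrier_vecD[OF v(1)] by (simp add: cL_eq dim_mat_vec)
    hence "(1 / of_real s) \<cdot>\<^sub>v (of_real s \<cdot>\<^sub>v (cK *\<^sub>v v)) = (1 / of_real s) \<cdot>\<^sub>v (\<mu> \<cdot>\<^sub>v v)" by simp
    hence "cK *\<^sub>v v = (\<mu> / of_real s) \<cdot>\<^sub>v v" using s by (simp add: smult_smult_assoc)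
    hence "eigenvalue cK (\<mu> / of_real s)" using v by (auto simp: eigenvalue_def eigenvector_def)
    hence "cmod (\<mu> / of_real s) \<le> \<rho>"
      using spectral_radius_mem_max(2)[OF cK \<open>n > 0\<close>] unfolding \<rho>_def spectrum_def by blast
    hence "cmod \<mu> \<le> s * \<rho>" using s by (simp add: norm_divide field_simps)
    thus ?thesis using \<mu>(2) s by simp
  qed
  from spectral_radius_jnf_norm_bound_less_1_upper_triangular[OF cL this]
  obtain c where nb: "\<And>k. norm_bound (cmat L ^\<^sub>m k) c" by auto
  from power_bounded_orbit[OF L nb x] obtain b where
    b: "0 \<le> b" "\<And>k i. i < n \<Longrightarrow> \<bar>(L ^\<^sub>m k *\<^sub>v x) $ i\<bar> \<le> b" by blast
  have pk: "L ^\<^sub>m k *\<^sub>v x \<in> carrier_vec n" for k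
    using mult_mat_vec_carrier[OF pow_carrier_mat[OF L] x] .
  have growth: "q (L ^\<^sub>m k *\<^sub>v y) \<le> (s * s) ^ k * q y" if "y \<in> carrier_vec n" for k y
    using that
  proof (induction k arbitrary: y)
    case 0 thus ?case using L by simp
  next
    case (Suc k)
    note y = Suc.prems
    have Ly: "L *\<^sub>v y = s \<cdot>\<^sub>v (K *\<^sub>v y)" using carrier_vecD[OF y] by (simp add: L_def dim_mat_vec)
    have "L ^\<^sub>m Suc k *\<^sub>v y = L ^\<^sub>m k *\<^sub>v (L *\<^sub>v y)"
      using assoc_mult_mat_vec[OF pow_carrier_mat[OF L] L y] by simp
    hence "q (L ^\<^sub>m Suc k *\<^sub>v y) \<le> (s * s) ^ k * q (L *\<^sub>v y)"
      using Suc.IH[OF mult_mat_vec_carrier[OF L y]] by simp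
    also have "q (L *\<^sub>v y) = (s * s) * q (K *\<^sub>v y)"
      by (simp add: Ly q_def dim_mat_vec)
    also have "(s * s) ^ k * ((s * s) * q (K *\<^sub>v y)) \<le> (s * s) ^ k * ((s * s) * q y)"
      using decr[OF y] s by (intro mult_left_mono) auto
    finally show ?case by (simp add: ac_simps)
  qed
  define C where "C = b * b * (\<Sum>i<n. \<Sum>j<n. \<bar>Z $$ (i,j)\<bar>)"
  have low: "- C \<le> q (L ^\<^sub>m k *\<^sub>v x)" for k
    using quad_form_bound[OF Z(1) pk b(2,1), of k] by (simp add: q_def C_def)
  have "s * s > 1" using s(1) by (simp add: less_1_mult)
  from real_arch_pow[OF this, of "(C + 1) / (- q x)"] obtain k where
    "(C + 1) / (- q x) < (s * s) ^ k" by auto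
  hence "C + 1 < (s * s) ^ k * (- q x)" using xZ by (simp add: q_def field_simps)
  with growth[OF x, of k] low[of k] show False by simp
qed

section \<open>Lyapunov and Riccati equations for descriptor systems\<close>

text \<open>For \<open>q \<le> n\<close> this is the isometric embedding of the first
  \<open>q\<close> coordinates. Writing \<open>diag(F, 0)\<close> as
  \<open>incl n q * F * (incl n q)\<^sup>T\<close> turns block computations into products that
  \<open>dim_mat_ring\<close> can normalize.\<close>

definition incl :: "nat \<Rightarrow> nat \<Rightarrow> 'a::{zero,one} mat" where
  "incl n q = mat n q (\<lambda>(i,j). if i = j then 1 else 0)"

lemma incl_dim [simp]: "dim_row (incl n q) = n" "dim_col (incl n q) = q"
  by (simp_all add: incl_def)

lemma incl_carrier: "incl n q \<in> carrier_mat n q"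
  by (simp add: incl_def)

lemma incl_transpose_mult_index:
  fixes X :: "'a::comm_semiring_1 mat"
  assumes "i < q" "j < dim_col X" "dim_row X = n" "q \<le> n"
  shows "((incl n q)\<^sup>T * X) $$ (i,j) = X $$ (i,j)"
proof -
  have "((incl n q)\<^sup>T * X) $$ (i,j) = (\<Sum>k\<in>{0..<n}. (if k = i then 1 else 0) * X $$ (k,j))"
    using assms by (simp add: incl_def scalar_prod_def)
  also have "\<dots> = (\<Sum>k\<in>{0..<n}. if k = i then X $$ (k,j) else 0)" by (intro sum.cong) auto
  also have "\<dots> = X $$ (i,j)" using assms by simp
  finally show ?thesis .
qed

lemma incl_transpose_incl:
  assumes "q \<le> n" shows "(incl n q)\<^sup>T * incl n q = (1\<^sub>m q :: 'a::comm_semiring_1 mat)"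
  using assms by (intro eq_matI) (simp_all add: incl_transpose_mult_index del: index_mult_mat(1), simp add: incl_def)

lemma incl_mult_index:
  fixes F :: "'a::comm_semiring_1 mat"
  assumes "i < n" "j < dim_col F" "dim_row F = q"
  shows "(incl n q * F) $$ (i,j) = (if i < q then F $$ (i,j) else 0)"
proof -
  have "(incl n q * F) $$ (i,j) = (\<Sum>k\<in>{0..<q}. (if i = k then 1 else 0) * F $$ (k,j))"
    using assms by (simp add: incl_def scalar_prod_def)
  also have "\<dots> = (\<Sum>k\<in>{0..<q}. if k = i then F $$ (k,j) else 0)" by (intro sum.cong) auto
  also have "\<dots> = (if i < q then F $$ (i,j) else 0)" using assms by simp
  finally show ?thesis .
qed

lemma mult_incl_transpose_index:
  assumes "i < dim_row F" "j < n" "dim_col F = q"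
  shows "(F * (incl n q)\<^sup>T) $$ (i,j) = (if j < q then F $$ (i,j) else (0 :: 'a::comm_semiring_1))"
proof -
  have "(F * (incl n q)\<^sup>T) $$ (i,j) = (incl n q * F\<^sup>T) $$ (j,i)"
    using arg_cong[OF dim_transpose_mult[of "incl n q" "F\<^sup>T"], of "\<lambda>M. M $$ (i,j)"] assms
    by (simp del: index_mult_mat(1))
  thus ?thesis using assms by (simp add: incl_mult_index del: index_mult_mat(1))
qed

lemma incl_conj_four_block:
  assumes "F \<in> carrier_mat q q" "q \<le> n"
  shows "incl n q * F * (incl n q)\<^sup>T =
    (four_block_mat F (0\<^sub>m q (n - q)) (0\<^sub>m (n - q) q) (0\<^sub>m (n - q) (n - q)) :: 'a::comm_semiring_1 mat)"
  using assms
  by (intro eq_matI) (auto simp: mult_incl_transpose_index incl_mult_index simp del: index_mult_mat(1))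

lemma incl_transpose_mult_four_block:
  fixes F :: "'a::comm_semiring_1 mat"
  assumes "F \<in> carrier_mat q q" "G \<in> carrier_mat (n - q) (n - q)" "q \<le> n"
  shows "(incl n q)\<^sup>T * four_block_mat F (0\<^sub>m q (n - q)) (0\<^sub>m (n - q) q) G =
    F * (incl n q)\<^sup>T" (is "?P\<^sup>T * ?X = ?R")
  using assms
  by (intro eq_matI) (simp_all add: incl_transpose_mult_index mult_incl_transpose_index del: index_mult_mat(1))

lemma invertible_mat_obtain:
  assumes "invertible_mat U" "U \<in> carrier_mat n n"
  obtains Ui where "Ui \<in> carrier_mat n n" "U * Ui = 1\<^sub>m n" "Ui * U = 1\<^sub>m n"
proof -
  from assms obtain Ui where Ui: "U * Ui = 1\<^sub>m n" "Ui * U = 1\<^sub>m (dim_row Ui)"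
    unfolding invertible_mat_def inverts_mat_def by auto
  have "dim_row Ui = n" using arg_cong[OF Ui(2), of dim_col] assms(2) by simp
  moreover have "dim_col Ui = n" using arg_cong[OF Ui(1), of dim_col] by simp
  ultimately show ?thesis using Ui by (intro that[of Ui]) auto
qed

lemma mat_inverse_cancel:
  fixes A :: "'a::comm_ring_1 mat"
  assumes "A \<in> carrier_mat n n" "Ai \<in> carrier_mat n n" "A * Ai = 1\<^sub>m n" "dim_row X = n"
  shows "A * (Ai * X) = X"
proof -
  have "A * (Ai * X) = A * Ai * X"
    using carrier_matD[OF assms(1)] carrier_matD[OF assms(2)] assms(4) by (simp add: dim_assoc_mult_mat)
  thus ?thesis unfolding assms(3) using assms(4) by (simp add: dim_one_mult_mat)
qed

text \<open>In Weierstrass coordinates \<open>E\<close> becomes \<open>P * P\<^sup>T\<close>, and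
  the symmetry condition reduces \<open>E * D\<^sup>T\<close> to one symmetric \<open>q\<close> by
  \<open>q\<close> block \<open>Z\<close>. The first \<open>q\<close> rows and columns of the
  equation form an ordinary Lyapunov equation for \<open>Z\<close> and the finite part
  \<open>F\<close>, so \<open>lyapunov_psd\<close> applies.\<close>

lemma descriptor_lyapunov_psd:
  assumes E: "E \<in> carrier_mat n n" and A: "A \<in> carrier_mat n n" and D: "D \<in> carrier_mat n n"
    and st: "stable_pencil n E A" and M: "psd_mat n M"
    and eq: "A * D\<^sup>T + D * A\<^sup>T = - M" and sym: "E * D\<^sup>T = D * E\<^sup>T"
  shows "psd_mat n (D * E\<^sup>T)"
proof -
  note [simp] = carrier_matD[OF E] carrier_matD[OF A] carrier_matD[OF D] carrier_matD[OF psd_matD(1)[OF M]]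
  from st obtain U V F q where U: "U \<in> carrier_mat n n" "invertible_mat U" and
    V: "V \<in> carrier_mat n n" "invertible_mat V" and q: "q \<le> n" and F: "F \<in> carrier_mat q q" and
    UEV: "U * E * V = four_block_mat (1\<^sub>m q) (0\<^sub>m q (n - q)) (0\<^sub>m (n - q) q) (0\<^sub>m (n - q) (n - q))" and
    UAV: "U * A * V = four_block_mat F (0\<^sub>m q (n - q)) (0\<^sub>m (n - q) q) (1\<^sub>m (n - q))"
    unfolding stable_pencil_def impulse_free_def by blast
  from invertible_mat_obtain[OF U(2,1)] obtain Ui where
    Ui: "Ui \<in> carrier_mat n n" "U * Ui = 1\<^sub>m n" "Ui * U = 1\<^sub>m n" by blast
  from invertible_mat_obtain[OF V(2,1)] obtain Vi where
    Vi: "Vi \<in> carrier_mat n n" "V * Vi = 1\<^sub>m n" "Vi * V = 1\<^sub>m n" by blast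
  define P :: "real mat" where "P = incl n q"
  have P: "P \<in> carrier_mat n q" by (simp add: P_def incl_carrier)
  note [simp] = carrier_matD[OF U(1)] carrier_matD[OF V(1)] carrier_matD[OF Ui(1)] carrier_matD[OF Vi(1)]
    carrier_matD[OF F] carrier_matD[OF P]
  have PP: "P\<^sup>T * P = 1\<^sub>m q" unfolding P_def by (rule incl_transpose_incl[OF q])
  have PPX: "P\<^sup>T * (P * X) = X" if "dim_row X = q" for X
    using that PP by (metis P assoc_mult_mat carrier_matI left_mult_one_mat transpose_carrier_mat)
  have UEV': "U * (E * V) = P * P\<^sup>T"
    using UEV[folded incl_conj_four_block[OF one_carrier_mat q]] unfolding P_def
    by (simp add: dim_mat_ring)
  have UAV': "P\<^sup>T * (U * (A * V)) = F * P\<^sup>T"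
    using incl_transpose_mult_four_block[OF F one_carrier_mat q, folded UAV] unfolding P_def
    by (simp add: dim_assoc_mult_mat)
  \<comment> \<open>This is \<open>D\<^sup>T\<close> in the coordinates of the Weierstrass form:
    \<open>U * E * D\<^sup>T * U\<^sup>T\<close> is the product of \<open>U * E * V\<close> and
    \<open>W\<close>.\<close>
  define W where "W = Vi * (D\<^sup>T * U\<^sup>T)"
  have [simp]: "dim_row W = n" "dim_col W = n" by (simp_all add: W_def)
  define Z where "Z = P\<^sup>T * (W * P)"
  have Z: "Z \<in> carrier_mat q q" unfolding Z_def by (rule carrier_matI) simp_all
  note [simp] = carrier_matD[OF Z]
  have VW: "V * W = D\<^sup>T * U\<^sup>T"
    unfolding W_def by (rule mat_inverse_cancel[OF V(1) Vi(1,2)]) simp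
  have PPW: "P * (P\<^sup>T * W) = U * (E * (D\<^sup>T * U\<^sup>T))"
  proof -
    have "P * (P\<^sup>T * W) = P * P\<^sup>T * W" by (simp add: dim_assoc_mult_mat)
    also have "\<dots> = U * (E * (V * W))" unfolding UEV'[symmetric] by (simp add: dim_assoc_mult_mat)
    finally show ?thesis unfolding VW .
  qed
  have PPWsym: "P * (P\<^sup>T * W) = W\<^sup>T * (P * P\<^sup>T)"
  proof -
    have "(U * (E * (D\<^sup>T * U\<^sup>T)))\<^sup>T = U * (D * E\<^sup>T * U\<^sup>T)" by (simp add: dim_mat_ring)
    also have "\<dots> = U * (E * (D\<^sup>T * U\<^sup>T))" unfolding sym[symmetric] by (simp add: dim_mat_ring)
    finally show ?thesis unfolding PPW[symmetric] by (simp add: dim_mat_ring)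
  qed
  \<comment> \<open>Symmetry of \<open>P * (P\<^sup>T * W)\<close> forces the first \<open>q\<close>
    rows of \<open>W\<close> to vanish outside the first \<open>q\<close> columns.\<close>
  have PW: "P\<^sup>T * W = Z\<^sup>T * P\<^sup>T"
  proof -
    have "P\<^sup>T * W = P\<^sup>T * (P * (P\<^sup>T * W))" by (rule PPX[symmetric]) simp
    also have "\<dots> = P\<^sup>T * (W\<^sup>T * (P * P\<^sup>T))" unfolding PPWsym ..
    finally show ?thesis by (simp add: Z_def dim_mat_ring)
  qed
  have Zsym: "Z\<^sup>T = Z"
  proof -
    have "Z = P\<^sup>T * W * P" by (simp add: Z_def dim_mat_ring)
    also have "\<dots> = Z\<^sup>T * (P\<^sup>T * P)" unfolding PW by (simp add: dim_mat_ring)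
    finally show ?thesis by (simp add: PP dim_mat_ring)
  qed
  have X_eq: "P * (Z * P\<^sup>T) = U * (E * D\<^sup>T) * U\<^sup>T"
    using PPW unfolding PW Zsym by (simp add: dim_mat_ring)
  have FZ: "P\<^sup>T * (U * (A * (D\<^sup>T * (U\<^sup>T * P)))) = F * Z"
  proof -
    have "P\<^sup>T * (U * (A * (D\<^sup>T * (U\<^sup>T * P)))) = P\<^sup>T * (U * (A * ((D\<^sup>T * U\<^sup>T) * P)))"
      by (simp add: dim_mat_ring)
    also have "\<dots> = (P\<^sup>T * (U * (A * V))) * (W * P)" unfolding VW[symmetric] by (simp add: dim_mat_ring)
    finally show ?thesis unfolding UAV' by (simp add: Z_def dim_mat_ring)
  qed
  have FZT: "P\<^sup>T * (U * (D * (A\<^sup>T * (U\<^sup>T * P)))) = Z * F\<^sup>T"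
    using arg_cong[OF FZ, of transpose_mat] by (simp add: dim_mat_ring Zsym)
  define N where "N = (P\<^sup>T * U) * M * (P\<^sup>T * U)\<^sup>T"
  have N: "psd_mat q N" unfolding N_def by (rule psd_congruence[OF M]) (rule carrier_matI, simp_all)
  have "F * Z + Z * F\<^sup>T = P\<^sup>T * (U * ((A * D\<^sup>T + D * A\<^sup>T) * (U\<^sup>T * P)))"
    unfolding FZ[symmetric] FZT[symmetric] by (simp add: dim_mat_ring)
  also have "\<dots> = - N" unfolding eq N_def by (simp add: dim_mat_ring)
  finally have lyap: "(F\<^sup>T)\<^sup>T * Z + Z * F\<^sup>T = - N" by simp
  \<comment> \<open>An eigenvector \<open>v\<close> of the transposed \<open>F\<close> lifts to
    \<open>U\<^sup>T * P *\<^sub>v v\<close>, a null vector of the transposed pencil: the first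
    \<open>q\<close> rows of \<open>U * E * V\<close> and \<open>U * A * V\<close> are
    \<open>P\<^sup>T\<close> and \<open>F * P\<^sup>T\<close>. Thus eigenvalues of \<open>F\<close>
    are finite eigenvalues of the pencil.\<close>
  have stF: "Re z < 0" if ev: "eigenvalue (cmat (F\<^sup>T)) z" for z
  proof -
    from ev obtain v where v: "v \<in> carrier_vec q" "v \<noteq> 0\<^sub>v q" "cmat (F\<^sup>T) *\<^sub>v v = z \<cdot>\<^sub>v v"
      unfolding eigenvalue_def eigenvector_def by auto
    note [simp] = carrier_vecD[OF v(1)]
    define B where "B = (z \<cdot>\<^sub>m cmat E - cmat A)\<^sup>T"
    define x where "x = cmat (U\<^sup>T * P) *\<^sub>v v"
    have cU: "cmat (P\<^sup>T * Ui\<^sup>T) *\<^sub>v x = v"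
    proof -
      have "cmat (P\<^sup>T * Ui\<^sup>T) *\<^sub>v x = cmat (P\<^sup>T * ((Ui\<^sup>T * U\<^sup>T) * P)) *\<^sub>v v"
        by (simp add: x_def cmat_mult dim_mat_vec dim_mat_ring)
      also have "Ui\<^sup>T * U\<^sup>T = 1\<^sub>m n" using arg_cong[OF Ui(2), of transpose_mat] by (simp add: dim_mat_ring)
      finally show ?thesis by (simp add: cmat_one PP dim_mat_ring dim_mat_vec)
    qed
    have "x \<noteq> 0\<^sub>v n"
    proof
      assume "x = 0\<^sub>v n"
      hence "v = 0\<^sub>v q" using cU by (simp add: dim_mult_mat_vec_zero)
      with v(2) show False by simp
    qed
    have "cmat (V\<^sup>T) *\<^sub>v (B *\<^sub>v x) = z \<cdot>\<^sub>v (cmat ((U * (E * V))\<^sup>T * P) *\<^sub>v v) - cmat ((P\<^sup>T * (U * (A * V)))\<^sup>T) *\<^sub>v v"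
      unfolding B_def x_def
      by (simp add: cmat_mult cmat_transpose dim_mat_vec dim_mat_ring)
    also have "\<dots> = z \<cdot>\<^sub>v (cmat P *\<^sub>v v) - cmat P *\<^sub>v (cmat (F\<^sup>T) *\<^sub>v v)"
      unfolding UEV' UAV' using PP v(1) P by (simp add: cmat_mult dim_mat_vec dim_mat_ring)
    also have "\<dots> = 0\<^sub>v n" unfolding v(3) by (simp add: dim_mat_vec) (auto intro!: eq_vecI)
    finally have VB: "cmat (V\<^sup>T) *\<^sub>v (B *\<^sub>v x) = 0\<^sub>v n" .
    have "B *\<^sub>v x = cmat (Vi\<^sup>T * V\<^sup>T) *\<^sub>v (B *\<^sub>v x)"
    proof -
      have "Vi\<^sup>T * V\<^sup>T = 1\<^sub>m n" using arg_cong[OF Vi(2), of transpose_mat] by (simp add: dim_mat_ring)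
      thus ?thesis by (simp add: cmat_one B_def dim_mat_vec)
    qed
    also have "\<dots> = cmat (Vi\<^sup>T) *\<^sub>v (cmat (V\<^sup>T) *\<^sub>v (B *\<^sub>v x))" by (simp add: cmat_mult dim_mat_vec B_def)
    also have "\<dots> = 0\<^sub>v n" unfolding VB by (simp add: dim_mult_mat_vec_zero)
    finally have Bx: "B *\<^sub>v x = 0\<^sub>v n" .
    have "x \<in> carrier_vec n" unfolding x_def by (rule carrier_vecI) simp
    moreover have B: "B \<in> carrier_mat n n" unfolding B_def by (rule carrier_matI) simp_all
    ultimately have "det B = 0"
      using det_0_iff_vec_prod_zero_field[of B n] Bx \<open>x \<noteq> 0\<^sub>v n\<close> by blast
    have "z \<cdot>\<^sub>m cmat E - cmat A \<in> carrier_mat n n" by (rule carrier_matI) simp_all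
    from det_transpose[OF this] have "det (z \<cdot>\<^sub>m cmat E - cmat A) = 0"
      using \<open>det B = 0\<close> unfolding B_def by simp
    thus ?thesis using st unfolding stable_pencil_def finite_eigenvalue_def by blast
  qed
  have "psd_mat q Z"
    by (rule lyapunov_psd[OF _ Z Zsym stF lyap N]) (simp_all add: F)
  from psd_congruence[OF psd_congruence[OF this P] Ui(1)]
  have "psd_mat n (Ui * (P * (Z * P\<^sup>T)) * Ui\<^sup>T)" by (simp add: dim_mat_ring)
  moreover have "Ui * (P * (Z * P\<^sup>T)) * Ui\<^sup>T = E * D\<^sup>T"
  proof -
    have "Ui * (P * (Z * P\<^sup>T)) * Ui\<^sup>T = (Ui * U) * ((E * D\<^sup>T) * (U\<^sup>T * Ui\<^sup>T))"
      unfolding X_eq by (simp add: dim_mat_ring)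
    also have "U\<^sup>T * Ui\<^sup>T = 1\<^sub>m n" using arg_cong[OF Ui(3), of transpose_mat] by (simp add: dim_mat_ring)
    finally show ?thesis by (simp add: Ui(3) dim_mat_ring)
  qed
  ultimately show ?thesis using sym by simp
qed

text \<open>With \<open>D = P1 - P2\<close>, subtracting the equations completes the square:
  \<open>P1 * N * P1\<^sup>T - P2 * N * P2\<^sup>T - P1 * N * D\<^sup>T - D * N * P1\<^sup>T\<close>
  equals \<open>- (D * N * D\<^sup>T)\<close>. The outcome is a Lyapunov equation for the closed
  loop of \<open>P1\<close> alone.\<close>

lemma riccati_closed_loop_difference:
  fixes A N P1 P2 :: "real mat"
  assumes A: "A \<in> carrier_mat n n" and N: "N \<in> carrier_mat n n" "N\<^sup>T = N" and W: "W \<in> carrier_mat n n"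
    and P1: "P1 \<in> carrier_mat n n" and P2: "P2 \<in> carrier_mat n n"
    and eq1: "A * P1\<^sup>T + P1 * A\<^sup>T - P1 * N * P1\<^sup>T + W = 0\<^sub>m n n"
    and eq2: "A * P2\<^sup>T + P2 * A\<^sup>T - P2 * N * P2\<^sup>T + W = 0\<^sub>m n n"
  shows "(A - P1 * N) * (P1 - P2)\<^sup>T + (P1 - P2) * (A - P1 * N)\<^sup>T = - ((P1 - P2) * N * (P1 - P2)\<^sup>T)"
proof -
  note [simp] = carrier_matD[OF A] carrier_matD[OF N(1)] carrier_matD[OF W] carrier_matD[OF P1] carrier_matD[OF P2]
  \<comment> \<open>The comparison is made entry by entry: matrices of all sizes share one type and
    form no additive group, whereas the entries are reals open to linear arithmetic.\<close>
  show ?thesis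
  proof (rule eq_matI)
    fix i j
    assume "i < dim_row (- ((P1 - P2) * N * (P1 - P2)\<^sup>T))" "j < dim_col (- ((P1 - P2) * N * (P1 - P2)\<^sup>T))"
    hence ij: "i < n" "j < n" by simp_all
    show "((A - P1 * N) * (P1 - P2)\<^sup>T + (P1 - P2) * (A - P1 * N)\<^sup>T) $$ (i,j) =
      (- ((P1 - P2) * N * (P1 - P2)\<^sup>T)) $$ (i,j)"
      using arg_cong[OF eq1, of "\<lambda>M. M $$ (i,j)"] arg_cong[OF eq2, of "\<lambda>M. M $$ (i,j)"] ij
      by (simp add: dim_mat_ring N(2) del: index_mult_mat(1))
  qed simp_all
qed

text \<open>Replacing \<open>A\<close> by the closed loop subtracts the quadratic term twice instead
  of once, so it changes sides together with \<open>W\<close>. The right-hand side is then minus a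
  semidefinite matrix whenever \<open>N\<close> and \<open>W\<close> are semidefinite.\<close>

lemma riccati_closed_loop_lyapunov:
  fixes A N P :: "real mat"
  assumes A: "A \<in> carrier_mat n n" and N: "N \<in> carrier_mat n n" "N\<^sup>T = N" and W: "W \<in> carrier_mat n n"
    and P: "P \<in> carrier_mat n n"
    and eq: "A * P\<^sup>T + P * A\<^sup>T - P * N * P\<^sup>T + W = 0\<^sub>m n n"
  shows "(A - P * N) * P\<^sup>T + P * (A - P * N)\<^sup>T = - (P * N * P\<^sup>T + W)"
proof -
  note [simp] = carrier_matD[OF A] carrier_matD[OF N(1)] carrier_matD[OF W] carrier_matD[OF P]
  show ?thesis
  proof (rule eq_matI)
    fix i j
    assume "i < dim_row (- (P * N * P\<^sup>T + W))" "j < dim_col (- (P * N * P\<^sup>T + W))"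
    hence ij: "i < n" "j < n" by simp_all
    show "((A - P * N) * P\<^sup>T + P * (A - P * N)\<^sup>T) $$ (i,j) = (- (P * N * P\<^sup>T + W)) $$ (i,j)"
      using arg_cong[OF eq, of "\<lambda>M. M $$ (i,j)"] ij
      by (simp add: dim_mat_ring N(2) del: index_mult_mat(1))
  qed simp_all
qed

lemma riccati_stabilizing_psd:
  assumes E: "E \<in> carrier_mat n n" and A: "A \<in> carrier_mat n n" and N: "psd_mat n N" and W: "psd_mat n W"
    and P: "P \<in> carrier_mat n n"
    and eq: "A * P\<^sup>T + P * A\<^sup>T - P * N * P\<^sup>T + W = 0\<^sub>m n n" and sym: "E * P\<^sup>T = P * E\<^sup>T"
    and st: "stable_pencil n E (A - P * N)"
  shows "psd_mat n (P * E\<^sup>T)"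
  using riccati_closed_loop_lyapunov[OF A psd_matD(1,2)[OF N] psd_matD(1)[OF W] P eq]
  by (intro descriptor_lyapunov_psd[OF E _ P st _ _ sym])
     (auto intro!: psd_add psd_congruence N W P simp: minus_carrier_mat mult_carrier_mat[OF P psd_matD(1)[OF N]])

text \<open>The difference of the solutions satisfies the Lyapunov equation of the stable closed
  loop of \<open>P1\<close>, with a semidefinite right-hand side because \<open>N\<close> is
  semidefinite. Applied in both directions this yields uniqueness of the product with
  \<open>E\<^sup>T\<close>.\<close>

lemma riccati_stabilizing_maximal:
  assumes E: "E \<in> carrier_mat n n" and A: "A \<in> carrier_mat n n" and N: "psd_mat n N"
    and W: "W \<in> carrier_mat n n"
    and P1: "P1 \<in> carrier_mat n n" and P2: "P2 \<in> carrier_mat n n"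
    and eq1: "A * P1\<^sup>T + P1 * A\<^sup>T - P1 * N * P1\<^sup>T + W = 0\<^sub>m n n" and sym1: "E * P1\<^sup>T = P1 * E\<^sup>T"
    and eq2: "A * P2\<^sup>T + P2 * A\<^sup>T - P2 * N * P2\<^sup>T + W = 0\<^sub>m n n" and sym2: "E * P2\<^sup>T = P2 * E\<^sup>T"
    and st: "stable_pencil n E (A - P1 * N)"
  shows "psd_mat n (P1 * E\<^sup>T - P2 * E\<^sup>T)"
proof -
  note [simp] = carrier_matD[OF E] carrier_matD[OF P1] carrier_matD[OF P2]
  have D: "P1 - P2 \<in> carrier_mat n n" using P2 by (rule minus_carrier_mat)
  have sym: "E * (P1 - P2)\<^sup>T = (P1 - P2) * E\<^sup>T"
    by (simp add: dim_mat_ring sym1 sym2)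
  have "psd_mat n ((P1 - P2) * E\<^sup>T)"
    using riccati_closed_loop_difference[OF A psd_matD(1,2)[OF N] W P1 P2 eq1 eq2]
    by (rule descriptor_lyapunov_psd[OF E minus_carrier_mat[OF mult_carrier_mat[OF P1 psd_matD(1)[OF N]]] D st
          psd_congruence[OF N D] _ sym])
  thus ?thesis by (simp add: dim_mat_ring)
qed

lemma riccati_stabilizing_unique:
  assumes E: "E \<in> carrier_mat n n" and A: "A \<in> carrier_mat n n" and N: "psd_mat n N"
    and W: "W \<in> carrier_mat n n"
    and P1: "P1 \<in> carrier_mat n n" and P2: "P2 \<in> carrier_mat n n"
    and eq1: "A * P1\<^sup>T + P1 * A\<^sup>T - P1 * N * P1\<^sup>T + W = 0\<^sub>m n n" and sym1: "E * P1\<^sup>T = P1 * E\<^sup>T"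
    and eq2: "A * P2\<^sup>T + P2 * A\<^sup>T - P2 * N * P2\<^sup>T + W = 0\<^sub>m n n" and sym2: "E * P2\<^sup>T = P2 * E\<^sup>T"
    and st1: "stable_pencil n E (A - P1 * N)" and st2: "stable_pencil n E (A - P2 * N)"
  shows "P1 * E\<^sup>T = P2 * E\<^sup>T"
proof -
  note [simp] = carrier_matD[OF E] carrier_matD[OF P1] carrier_matD[OF P2]
  have d1: "psd_mat n (P1 * E\<^sup>T - P2 * E\<^sup>T)"
    by (rule riccati_stabilizing_maximal[OF E A N W P1 P2 eq1 sym1 eq2 sym2 st1])
  have "psd_mat n (P2 * E\<^sup>T - P1 * E\<^sup>T)"
    by (rule riccati_stabilizing_maximal[OF E A N W P2 P1 eq2 sym2 eq1 sym1 st2])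
  moreover have "P2 * E\<^sup>T - P1 * E\<^sup>T = - (P1 * E\<^sup>T - P2 * E\<^sup>T)"
    by (rule eq_matI) (simp_all del: index_mult_mat(1))
  ultimately have z: "P1 * E\<^sup>T - P2 * E\<^sup>T = 0\<^sub>m n n" using psd_antisym[OF d1] by simp
  show ?thesis
  proof (rule eq_matI)
    fix i j assume "i < dim_row (P2 * E\<^sup>T)" "j < dim_col (P2 * E\<^sup>T)"
    thus "(P1 * E\<^sup>T) $$ (i,j) = (P2 * E\<^sup>T) $$ (i,j)"
      using arg_cong[OF z, of "\<lambda>M. M $$ (i,j)"] by (simp del: index_mult_mat(1))
  qed simp_all
qed

section \<open>Rank and eigenvectors of pencils\<close>

text \<open>Rank \<open>n\<close> provides \<open>n\<close> independent columns of \<open>M\<close>.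
  They form an invertible square matrix whose transpose annihilates \<open>v\<close>.\<close>

lemma full_row_rank_left_kernel:
  fixes M :: "'a::field mat"
  assumes M: "M \<in> carrier_mat n p" and r: "mrank M = n"
    and v: "v \<in> carrier_vec n" and vM: "\<And>j. j < p \<Longrightarrow> v \<bullet> col M j = 0"
  shows "v = 0\<^sub>v n"
proof -
  interpret vec_space "TYPE('a)" n .
  have rk: "rank M = n" using r M by (simp add: mrank_def)
  obtain S where S: "maximal S (\<lambda>T. T \<subseteq> set (cols M) \<and> lin_indpt T)"
    using maximal_exists[of "\<lambda>T. T \<subseteq> set (cols M) \<and> lin_indpt T" "card (set (cols M))" "{}"]
    by (meson List.finite_set card_mono empty_iff empty_subsetI finite_lin_indpt2 rev_finite_subset)
  hence Sc: "S \<subseteq> set (cols M)" "lin_indpt S" by (auto simp: maximal_def)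
  hence "finite S" using finite_subset by blast
  have cS: "card S = n" using rank_card_indpt[OF M S] rk by simp
  obtain xs where xs: "set xs = S" "distinct xs" using \<open>finite S\<close> finite_distinct_list by blast
  have lxs: "length xs = n" using xs cS by (metis distinct_card)
  define K where "K = mat_of_cols n xs"
  have K: "K \<in> carrier_mat n n" unfolding K_def using lxs by (metis mat_of_cols_carrier(1))
  have xsc: "set xs \<subseteq> carrier_vec n" using Sc xs M cols_dim[of M] by auto
  have cK: "cols K = xs" unfolding K_def using xsc by (rule cols_mat_of_cols)
  have "rank K = n" by (rule lin_indpt_full_rank[OF K]) (simp_all add: cK xs Sc)
  hence "det K \<noteq> 0" using det_rank_iff[OF K] by simp
  hence dK: "det K\<^sup>T \<noteq> 0" by (simp add: det_transpose[OF K])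
  have z: "x \<bullet> v = 0" if "x \<in> S" for x
  proof -
    from that Sc(1) obtain j where j: "j < p" "x = col M j" using M by (auto simp: cols_def)
    have "x \<in> carrier_vec n" using that xsc xs by auto
    thus ?thesis using vM[OF j(1)] j(2) comm_scalar_prod[OF _ v, of x] by simp
  qed
  have "K\<^sup>T *\<^sub>v v = 0\<^sub>v n"
  proof (rule eq_vecI)
    fix i assume "i < dim_vec (0\<^sub>v n :: 'a vec)"
    hence i: "i < n" by simp
    have "col K i = xs ! i" using cK K i by (metis carrier_matD(2) cols_nth)
    moreover have "xs ! i \<in> S" using xs lxs i nth_mem by auto
    ultimately show "(K\<^sup>T *\<^sub>v v) $ i = 0\<^sub>v n $ i" using K i z by simp
  qed (use K in simp)
  with dK v det_0_iff_vec_prod_zero_field[of "K\<^sup>T" n] K show ?thesis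
    by (metis transpose_carrier_mat)
qed

lemma mrank_eq_of_mat_image_eq:
  fixes A B :: "'a::field mat"
  assumes A: "A \<in> carrier_mat n p" and B: "B \<in> carrier_mat n q" and "mat_image A = mat_image B"
  shows "mrank A = mrank B"
proof -
  interpret vec_space "TYPE('a)" n .
  have "col_space A = mat_image A" "col_space B = mat_image B"
    using A B by (auto simp: col_space_eq[OF A] col_space_eq[OF B] mat_image_def)
  hence "span (set (cols A)) = span (set (cols B))" using assms(3) by (simp add: col_space_def)
  thus ?thesis using A B by (simp add: mrank_def rank_def)
qed

text \<open>The rank is the dimension of the span of the set of columns, so repeated columns must be
  excluded before independence is used: equal columns \<open>i\<close> and \<open>j\<close> would
  put a difference of unit vectors into the kernel.\<close>

lemma mrank_injective:
  fixes A :: "'a::field mat"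
  assumes A: "A \<in> carrier_mat n p" and inj: "\<And>v. v \<in> carrier_vec p \<Longrightarrow> A *\<^sub>v v = 0\<^sub>v n \<Longrightarrow> v = 0\<^sub>v p"
  shows "mrank A = p"
proof -
  interpret vec_space "TYPE('a)" n .
  have "distinct (cols A)"
  proof (rule ccontr)
    assume "\<not> distinct (cols A)"
    then obtain i j where ij: "i < p" "j < p" "i \<noteq> j" "col A i = col A j"
      using A by (auto simp: distinct_conv_nth)
    have "A *\<^sub>v (unit_vec p i - unit_vec p j) = A *\<^sub>v unit_vec p i - A *\<^sub>v unit_vec p j"
      using carrier_matD[OF A] by (simp add: dim_mat_vec)
    also have "\<dots> = 0\<^sub>v n"
    proof (rule eq_vecI)
      fix k assume "k < dim_vec (0\<^sub>v n :: 'a vec)"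
      thus "(A *\<^sub>v unit_vec p i - A *\<^sub>v unit_vec p j) $ k = 0\<^sub>v n $ k"
        using arg_cong[OF ij(4), of "\<lambda>v. v $ k"] ij(1,2) carrier_matD[OF A] by simp
    qed (use carrier_matD[OF A] in simp)
    finally have "unit_vec p i - unit_vec p j = (0\<^sub>v p :: 'a vec)" by (intro inj) auto
    from arg_cong[OF this, of "\<lambda>v. v $ i"] show False using ij by simp
  qed
  moreover have "lin_indpt (set (cols A))"
  proof
    assume "lin_dep (set (cols A))"
    from lin_depE[OF A this \<open>distinct (cols A)\<close>] inj show False by blast
  qed
  ultimately show ?thesis using lin_indpt_full_rank[OF A] A by (simp add: mrank_def)
qed

text \<open>\<open>E\<close> factors as \<open>Si * incl n r\<close> times
  \<open>(incl n r)\<^sup>T * T\<close>. The second factor is onto, so \<open>E\<close> has the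
  image of the first one, which is injective.\<close>

lemma mrank_rank_normal_form:
  fixes E S Si T Ti :: "'a::field mat"
  assumes E: "E \<in> carrier_mat n n" and S: "S \<in> carrier_mat n n" and Si: "Si \<in> carrier_mat n n"
    and T: "T \<in> carrier_mat n n" and Ti: "Ti \<in> carrier_mat n n"
    and inv: "S * Si = 1\<^sub>m n" "Si * S = 1\<^sub>m n" "T * Ti = 1\<^sub>m n" "Ti * T = 1\<^sub>m n" and r: "r \<le> n"
    and eq: "S * E * Ti = incl n r * (incl n r)\<^sup>T"
  shows "mrank E = r"
proof -
  note [simp] = carrier_matD[OF E] carrier_matD[OF S] carrier_matD[OF Si] carrier_matD[OF T] carrier_matD[OF Ti]
  let ?P = "incl n r :: 'a mat"
  have PP: "?P\<^sup>T * ?P = 1\<^sub>m r" by (rule incl_transpose_incl[OF r])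
  have E_eq: "E = Si * ?P * (?P\<^sup>T * T)"
  proof -
    have "Si * ?P * (?P\<^sup>T * T) = Si * (?P * ?P\<^sup>T) * T" by (simp add: dim_mat_ring)
    also have "\<dots> = (Si * S) * (E * (Ti * T))" unfolding eq[symmetric] by (simp add: dim_mat_ring)
    finally show ?thesis unfolding inv by (simp add: dim_mat_ring)
  qed
  have SP: "Si * ?P \<in> carrier_mat n r" by (rule carrier_matI) simp_all
  have "mat_image E = mat_image (Si * ?P)"
  proof (intro equalityI subsetI)
    fix y assume "y \<in> mat_image E"
    then obtain x where x: "x \<in> carrier_vec n" "y = E *\<^sub>v x" by (auto simp: mat_image_def)
    have "y = (Si * ?P) *\<^sub>v (?P\<^sup>T * T *\<^sub>v x)"
      using carrier_vecD[OF x(1)] unfolding x(2) by (subst E_eq) (simp add: dim_mat_vec)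
    moreover have "?P\<^sup>T * T *\<^sub>v x \<in> carrier_vec r" by (rule carrier_vecI) simp
    ultimately show "y \<in> mat_image (Si * ?P)" by (auto simp: mat_image_def)
  next
    fix y assume "y \<in> mat_image (Si * ?P)"
    then obtain x where x: "x \<in> carrier_vec r" "y = Si * ?P *\<^sub>v x" by (auto simp: mat_image_def)
    note [simp] = carrier_vecD[OF x(1)]
    have "E *\<^sub>v (Ti * ?P *\<^sub>v x) = Si * ?P *\<^sub>v ((?P\<^sup>T * ((T * Ti) * ?P)) *\<^sub>v x)"
      by (subst E_eq) (simp add: dim_mat_vec dim_mat_ring)
    also have "\<dots> = y" unfolding inv x(2) using PP by (simp add: dim_mat_ring dim_mat_vec)
    finally have "y = E *\<^sub>v (Ti * ?P *\<^sub>v x)" by simp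
    moreover have "Ti * ?P *\<^sub>v x \<in> carrier_vec n" by (rule carrier_vecI) simp
    ultimately show "y \<in> mat_image E" by (auto simp: mat_image_def)
  qed
  from mrank_eq_of_mat_image_eq[OF E SP this] have "mrank E = mrank (Si * ?P)" .
  also have "\<dots> = r"
  proof (rule mrank_injective[OF SP])
    fix v :: "'a vec" assume v: "v \<in> carrier_vec r" "Si * ?P *\<^sub>v v = 0\<^sub>v n"
    note [simp] = carrier_vecD[OF v(1)]
    have "v = (?P\<^sup>T * ((S * Si) * ?P)) *\<^sub>v v" unfolding inv using PP by (simp add: dim_mat_ring dim_mat_vec)
    also have "\<dots> = (?P\<^sup>T * S) *\<^sub>v (Si * ?P *\<^sub>v v)" by (simp add: dim_mat_ring dim_mat_vec)
    also have "\<dots> = 0\<^sub>v r" unfolding v(2) by (simp add: dim_mat_vec)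
    finally show "v = 0\<^sub>v r" .
  qed
  finally show ?thesis .
qed

lemma Re_cmat_mult_vec:
  "dim_vec v = dim_col M \<Longrightarrow> map_vec Re (cmat M *\<^sub>v v) = M *\<^sub>v map_vec Re v"
  by (auto simp: scalar_prod_def cmat_def intro!: eq_vecI)

lemma Im_cmat_mult_vec:
  "dim_vec v = dim_col M \<Longrightarrow> map_vec Im (cmat M *\<^sub>v v) = M *\<^sub>v map_vec Im v"
  by (auto simp: scalar_prod_def cmat_def intro!: eq_vecI)

lemma complex_vec_eqI:
  "map_vec Re v = map_vec Re w \<Longrightarrow> map_vec Im v = map_vec Im w \<Longrightarrow> v = w"
proof (rule eq_vecI)
  assume a: "map_vec Re v = map_vec Re w" "map_vec Im v = map_vec Im w"
  show d: "dim_vec v = dim_vec w" using arg_cong[OF a(1), of dim_vec] by simp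
  fix i assume i: "i < dim_vec w"
  from arg_cong[OF a(1), of "\<lambda>x. x $ i"] arg_cong[OF a(2), of "\<lambda>x. x $ i"] i d
  show "v $ i = w $ i" by (auto intro: complex_eqI)
qed

text \<open>An eigenvector \<open>x + \<i> y\<close> of the pencil \<open>(E, A)\<close> for \<open>a + \<i> b\<close> in terms of its real and
  imaginary parts.\<close>

definition pencil_eigenpair :: "nat \<Rightarrow> real mat \<Rightarrow> real mat \<Rightarrow> real \<Rightarrow> real \<Rightarrow> real vec \<Rightarrow> real vec \<Rightarrow> bool" where
  "pencil_eigenpair n E A a b x y \<longleftrightarrow> x \<in> carrier_vec n \<and> y \<in> carrier_vec n \<and>
     A *\<^sub>v x = a \<cdot>\<^sub>v (E *\<^sub>v x) - b \<cdot>\<^sub>v (E *\<^sub>v y) \<and> A *\<^sub>v y = b \<cdot>\<^sub>v (E *\<^sub>v x) + a \<cdot>\<^sub>v (E *\<^sub>v y)"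

text \<open>Passing to real and imaginary parts lets the energy estimates below work with real
  quadratic forms.\<close>

lemma pencil_singular_obtain_eigenpair:
  assumes E: "E \<in> carrier_mat n n" and A: "A \<in> carrier_mat n n" and d: "det (z \<cdot>\<^sub>m cmat E - cmat A) = 0"
  obtains x y where "pencil_eigenpair n E A (Re z) (Im z) x y" "\<not> (x = 0\<^sub>v n \<and> y = 0\<^sub>v n)"
proof -
  note [simp] = carrier_matD[OF E] carrier_matD[OF A]
  have "z \<cdot>\<^sub>m cmat E - cmat A \<in> carrier_mat n n" by (rule carrier_matI) simp_all
  from d det_0_iff_vec_prod_zero_field[OF this] obtain v where
    v: "v \<in> carrier_vec n" "v \<noteq> 0\<^sub>v n" "(z \<cdot>\<^sub>m cmat E - cmat A) *\<^sub>v v = 0\<^sub>v n" by blast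
  note [simp] = carrier_vecD[OF v(1)]
  have eq: "cmat A *\<^sub>v v = z \<cdot>\<^sub>v (cmat E *\<^sub>v v)"
  proof (rule eq_vecI)
    fix i assume "i < dim_vec (z \<cdot>\<^sub>v (cmat E *\<^sub>v v))"
    hence i: "i < n" by simp
    have "z \<cdot>\<^sub>v (cmat E *\<^sub>v v) - cmat A *\<^sub>v v = 0\<^sub>v n" using v(3) by (simp add: dim_mat_vec)
    from arg_cong[OF this, of "\<lambda>w. w $ i"] i show "(cmat A *\<^sub>v v) $ i = (z \<cdot>\<^sub>v (cmat E *\<^sub>v v)) $ i"
      by (simp del: index_mult_mat_vec)
  qed simp
  let ?x = "map_vec Re v" and ?y = "map_vec Im v"
  have eqi: "(cmat A *\<^sub>v v) $ i = z * (cmat E *\<^sub>v v) $ i" if "i < n" for i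
    using arg_cong[OF eq, of "\<lambda>w. w $ i"] that by (simp del: index_mult_mat_vec)
  have R: "Re ((cmat M *\<^sub>v v) $ i) = (M *\<^sub>v ?x) $ i" "Im ((cmat M *\<^sub>v v) $ i) = (M *\<^sub>v ?y) $ i"
    if "i < n" "dim_row M = n" "dim_col M = n" for i M
    using arg_cong[OF Re_cmat_mult_vec[of v M], of "\<lambda>w. w $ i"] arg_cong[OF Im_cmat_mult_vec[of v M], of "\<lambda>w. w $ i"] that
    by (simp_all del: index_mult_mat_vec)
  have "pencil_eigenpair n E A (Re z) (Im z) ?x ?y"
    unfolding pencil_eigenpair_def
  proof (intro conjI)
    show "A *\<^sub>v ?x = Re z \<cdot>\<^sub>v (E *\<^sub>v ?x) - Im z \<cdot>\<^sub>v (E *\<^sub>v ?y)"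
    proof (rule eq_vecI)
      fix i assume "i < dim_vec (Re z \<cdot>\<^sub>v (E *\<^sub>v ?x) - Im z \<cdot>\<^sub>v (E *\<^sub>v ?y))"
      hence i: "i < n" by simp
      show "(A *\<^sub>v ?x) $ i = (Re z \<cdot>\<^sub>v (E *\<^sub>v ?x) - Im z \<cdot>\<^sub>v (E *\<^sub>v ?y)) $ i"
        using arg_cong[OF eqi[OF i], of Re] R[OF i, of A] R[OF i, of E] i
        by (simp del: index_mult_mat_vec)
    qed simp
    show "A *\<^sub>v ?y = Im z \<cdot>\<^sub>v (E *\<^sub>v ?x) + Re z \<cdot>\<^sub>v (E *\<^sub>v ?y)"
    proof (rule eq_vecI)
      fix i assume "i < dim_vec (Im z \<cdot>\<^sub>v (E *\<^sub>v ?x) + Re z \<cdot>\<^sub>v (E *\<^sub>v ?y))"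
      hence i: "i < n" by simp
      show "(A *\<^sub>v ?y) $ i = (Im z \<cdot>\<^sub>v (E *\<^sub>v ?x) + Re z \<cdot>\<^sub>v (E *\<^sub>v ?y)) $ i"
        using arg_cong[OF eqi[OF i], of Im] R[OF i, of A] R[OF i, of E] i
        by (simp del: index_mult_mat_vec)
    qed simp
  qed (use v(1) in auto)
  moreover have "\<not> (?x = 0\<^sub>v n \<and> ?y = 0\<^sub>v n)"
  proof
    assume "?x = 0\<^sub>v n \<and> ?y = 0\<^sub>v n"
    moreover have "map_vec Re (0\<^sub>v n) = 0\<^sub>v n" "map_vec Im (0\<^sub>v n) = 0\<^sub>v n" by (auto intro!: eq_vecI)
    ultimately have "v = 0\<^sub>v n" by (intro complex_vec_eqI) simp_all
    with v(2) show False by simp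
  qed
  ultimately show ?thesis by (rule that)
qed

section \<open>Detectability and output feedback\<close>

lemma cmat_mult_vec_index:
  assumes "i < dim_row M" "dim_vec v = dim_col M"
  shows "(cmat M *\<^sub>v v) $ i = Complex ((M *\<^sub>v map_vec Re v) $ i) ((M *\<^sub>v map_vec Im v) $ i)"
  using arg_cong[OF Re_cmat_mult_vec[OF assms(2)], of "\<lambda>w. w $ i"]
    arg_cong[OF Im_cmat_mult_vec[OF assms(2)], of "\<lambda>w. w $ i"] assms
  by (intro complex_eqI) (simp_all del: index_mult_mat_vec)

lemma hcat_dim [simp]: "dim_row (hcat A B) = dim_row A" "dim_col (hcat A B) = dim_col A + dim_col B"
  by (simp_all add: hcat_def)

lemma col_hcat:
  assumes "dim_row A = dim_row B" "j < dim_col A + dim_col B"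
  shows "col (hcat A B) j = (if j < dim_col A then col A j else col B (j - dim_col A))"
proof (rule eq_vecI)
  fix i assume "i < dim_vec (if j < dim_col A then col A j else col B (j - dim_col A))"
  hence i: "i < dim_row A" using assms(1) by (simp split: if_splits)
  show "col (hcat A B) j $ i = (if j < dim_col A then col A j else col B (j - dim_col A)) $ i"
  proof (cases "j < dim_col A")
    case True
    thus ?thesis using i by (simp add: hcat_def)
  next
    case False
    moreover have "i < dim_row B" using i assms(1) by simp
    ultimately show ?thesis using i assms(2) by (simp add: hcat_def)
  qed
qed (simp add: assms(1))

lemma scalar_col_transpose:
  fixes v :: "'a::comm_semiring_0 vec"
  assumes "dim_vec v = dim_col X" "j < dim_row X"
  shows "v \<bullet> col X\<^sup>T j = (X *\<^sub>v v) $ j"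
proof -
  have "v \<bullet> row X j = row X j \<bullet> v"
    by (rule comm_scalar_prod[of _ "dim_col X"]; rule carrier_vecI) (simp_all add: assms(1))
  thus ?thesis using assms(2) by simp
qed

text \<open>Kernel form of strong detectability. The first clause is the Hautus test in the closed
  right half-plane, for a complex eigenvector given by its two real parts; the second is
  observability at infinity, with \<open>A *\<^sub>v v\<close> in the image of \<open>E\<close>.
  Unlike the rank conditions, it applies directly to vectors and is easily carried through
  equivalence transformations.\<close>

definition output_kernel_trivial :: "nat \<Rightarrow> real mat \<Rightarrow> real mat \<Rightarrow> real mat \<Rightarrow> bool" where
  "output_kernel_trivial n E A C \<longleftrightarrow>
     (\<forall>a b x y. 0 \<le> a \<longrightarrow> pencil_eigenpair n E A a b x y \<longrightarrow>
        C *\<^sub>v x = 0\<^sub>v (dim_row C) \<longrightarrow> C *\<^sub>v y = 0\<^sub>v (dim_row C) \<longrightarrow> x = 0\<^sub>v n \<and> y = 0\<^sub>v n) \<and>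
     (\<forall>v\<in>carrier_vec n. \<forall>w\<in>carrier_vec n. E *\<^sub>v v = 0\<^sub>v n \<longrightarrow> A *\<^sub>v v = E *\<^sub>v w \<longrightarrow>
        C *\<^sub>v v = 0\<^sub>v (dim_row C) \<longrightarrow> v = 0\<^sub>v n)"

lemma output_kernel_trivialD:
  assumes "output_kernel_trivial n E A C" "dim_row C = m"
  shows "\<And>a b x y. 0 \<le> a \<Longrightarrow> pencil_eigenpair n E A a b x y \<Longrightarrow>
      C *\<^sub>v x = 0\<^sub>v m \<Longrightarrow> C *\<^sub>v y = 0\<^sub>v m \<Longrightarrow> x = 0\<^sub>v n \<and> y = 0\<^sub>v n"
    and "\<And>v w. v \<in> carrier_vec n \<Longrightarrow> w \<in> carrier_vec n \<Longrightarrow> E *\<^sub>v v = 0\<^sub>v n \<Longrightarrow>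
      A *\<^sub>v v = E *\<^sub>v w \<Longrightarrow> C *\<^sub>v v = 0\<^sub>v m \<Longrightarrow> v = 0\<^sub>v n"
  using assms unfolding output_kernel_trivial_def by blast+

lemma dim_zero_mult_mat_vec: "dim_vec v = nc \<Longrightarrow> 0\<^sub>m nr nc *\<^sub>v v = (0\<^sub>v nr :: 'a::semiring_0 vec)"
  by (auto intro!: eq_vecI simp: scalar_prod_def)

lemma dim_zero_mult_mat: "dim_row A = k \<Longrightarrow> 0\<^sub>m nr k * A = (0\<^sub>m nr (dim_col A) :: 'a::semiring_0 mat)"
  by (rule eq_matI) (auto simp: scalar_prod_def)

lemma dim_mult_zero_mat: "dim_col A = k \<Longrightarrow> A * 0\<^sub>m k nc = (0\<^sub>m (dim_row A) nc :: 'a::semiring_0 mat)"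
  by (rule eq_matI) (auto simp: scalar_prod_def)

lemma dim_uminus_mult_mat: "dim_col A = dim_row B \<Longrightarrow> - A * B = - (A * (B :: 'a::ring mat))"
  by (rule eq_matI) (auto simp: scalar_prod_def sum_negf)

text \<open>The rank conditions concern the transposed data, so a vector violating the kernel
  condition is orthogonal to all columns of the block matrix in question; by full row rank it is
  zero.\<close>

lemma strongly_detectable_imp_output_kernel_trivial:
  assumes E: "E \<in> carrier_mat n n" and A: "A \<in> carrier_mat n n" and C: "C \<in> carrier_mat m n"
    and det: "strongly_detectable n E A C"
  shows "output_kernel_trivial n E A C"
proof -
  note [simp] = carrier_matD[OF E] carrier_matD[OF A] carrier_matD[OF C]
  have part1: "x = 0\<^sub>v n \<and> y = 0\<^sub>v n"
    if a: "0 \<le> a" and ev: "pencil_eigenpair n E A a b x y" and Cx: "C *\<^sub>v x = 0\<^sub>v m" and Cy: "C *\<^sub>v y = 0\<^sub>v m"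
    for a b x y
  proof -
    from ev have x: "x \<in> carrier_vec n" and y: "y \<in> carrier_vec n"
      and Ax: "A *\<^sub>v x = a \<cdot>\<^sub>v (E *\<^sub>v x) - b \<cdot>\<^sub>v (E *\<^sub>v y)"
      and Ay: "A *\<^sub>v y = b \<cdot>\<^sub>v (E *\<^sub>v x) + a \<cdot>\<^sub>v (E *\<^sub>v y)" by (auto simp: pencil_eigenpair_def)
    note [simp] = carrier_vecD[OF x] carrier_vecD[OF y]
    define z where "z = Complex a b"
    define v where "v = vec n (\<lambda>i. Complex (x $ i) (y $ i))"
    have v: "v \<in> carrier_vec n" by (simp add: v_def)
    note [simp] = carrier_vecD[OF v]
    have Rv: "map_vec Re v = x" "map_vec Im v = y" by (auto simp: v_def intro!: eq_vecI)
    let ?X = "z \<cdot>\<^sub>m cmat E - cmat A"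
    let ?M = "hcat (z \<cdot>\<^sub>m cmat E\<^sup>T - cmat A\<^sup>T) (cmat C\<^sup>T)"
    have X: "z \<cdot>\<^sub>m cmat E\<^sup>T - cmat A\<^sup>T = ?X\<^sup>T" by (simp add: cmat_transpose dim_mat_ring)
    have "mrank ?M = n"
      using det a unfolding strongly_detectable_def strongly_stabilizable_def by (simp add: z_def)
    moreover have "?M \<in> carrier_mat n (n + m)" by (rule carrier_matI) simp_all
    moreover have "v \<bullet> col ?M j = 0" if j: "j < n + m" for j
    proof (cases "j < n")
      case True
      have "v \<bullet> col ?M j = v \<bullet> col ?X\<^sup>T j" unfolding X using True by (subst col_hcat) simp_all
      also have "\<dots> = (?X *\<^sub>v v) $ j" using True by (intro scalar_col_transpose) simp_all
      also have "\<dots> = z * (cmat E *\<^sub>v v) $ j - (cmat A *\<^sub>v v) $ j"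
        using True by (simp add: dim_mat_vec del: index_mult_mat_vec)
      also have "\<dots> = 0"
        using True by (simp add: cmat_mult_vec_index Rv Ax Ay z_def complex_eq_iff del: index_mult_mat_vec)
      finally show ?thesis .
    next
      case False
      have "v \<bullet> col ?M j = v \<bullet> col (cmat C)\<^sup>T (j - n)"
        using False j by (subst col_hcat) (simp_all add: cmat_transpose)
      also have "\<dots> = (cmat C *\<^sub>v v) $ (j - n)" using False j by (intro scalar_col_transpose) simp_all
      also have "\<dots> = 0"
        using False j by (simp add: cmat_mult_vec_index Rv Cx Cy complex_eq_iff del: index_mult_mat_vec)
      finally show ?thesis .
    qed
    ultimately have "v = 0\<^sub>v n" using full_row_rank_left_kernel[of ?M n "n + m" v] v by blast
    with Rv show ?thesis by (auto intro!: eq_vecI)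
  qed
  have part2: "v = 0\<^sub>v n"
    if v: "v \<in> carrier_vec n" and w: "w \<in> carrier_vec n" and Ev: "E *\<^sub>v v = 0\<^sub>v n" and Av: "A *\<^sub>v v = E *\<^sub>v w"
      and Cv: "C *\<^sub>v v = 0\<^sub>v m" for v w
  proof -
    note [simp] = carrier_vecD[OF v] carrier_vecD[OF w]
    from det obtain Z p where Z: "Z \<in> carrier_mat n p" and im: "mat_image Z = mat_kernel E\<^sup>T"
      and rk: "mrank (hcat (hcat E\<^sup>T (A\<^sup>T * Z)) C\<^sup>T) = n"
      unfolding strongly_detectable_def strongly_stabilizable_def by blast
    note [simp] = carrier_matD[OF Z]
    let ?M = "hcat (hcat E\<^sup>T (A\<^sup>T * Z)) C\<^sup>T"
    have "?M \<in> carrier_mat n (n + p + m)" by (rule carrier_matI) simp_all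
    moreover have "v \<bullet> col ?M j = 0" if j: "j < n + p + m" for j
    proof -
      consider "j < n" | "n \<le> j" "j < n + p" | "n + p \<le> j" by linarith
      thus ?thesis
      proof cases
        case 1
        hence "v \<bullet> col ?M j = v \<bullet> col E\<^sup>T j" by (simp add: col_hcat)
        also have "\<dots> = (E *\<^sub>v v) $ j" using 1 by (intro scalar_col_transpose) simp_all
        finally show ?thesis using 1 by (simp add: Ev)
      next
        case 2
        \<comment> \<open>Columns of \<open>Z\<close> lie in the kernel of \<open>E\<^sup>T\<close>,
          hence are orthogonal to \<open>A *\<^sub>v v = E *\<^sub>v w\<close>.\<close>
        define z where "z = col Z (j - n)"
        have z: "z \<in> carrier_vec n" unfolding z_def by (rule carrier_vecI) simp
        note [simp] = carrier_vecD[OF z]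
        have "z = Z *\<^sub>v unit_vec p (j - n)" using 2 by (auto simp: z_def intro!: eq_vecI)
        hence "z \<in> mat_image Z" by (auto simp: mat_image_def)
        hence Ez: "E\<^sup>T *\<^sub>v z = 0\<^sub>v n" unfolding im by (simp add: mat_kernel_def)
        have "v \<bullet> col ?M j = v \<bullet> (A\<^sup>T *\<^sub>v z)"
          using 2 by (simp add: col_hcat z_def col_mult2[of _ n n _ p] A Z)
        also have "\<dots> = (E *\<^sub>v w) \<bullet> z"
          using scalar_mat_transpose[of "A\<^sup>T" n n v z] v z A Av by simp
        also have "\<dots> = w \<bullet> (E\<^sup>T *\<^sub>v z)"
          using scalar_mat_transpose[of "E\<^sup>T" n n w z] w z E by simp
        finally show ?thesis using w by (simp add: Ez)
      next
        case 3
        hence "v \<bullet> col ?M j = v \<bullet> col C\<^sup>T (j - (n + p))" using j by (simp add: col_hcat)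
        also have "\<dots> = (C *\<^sub>v v) $ (j - (n + p))" using 3 j by (intro scalar_col_transpose) simp_all
        finally show ?thesis using 3 j by (simp add: Cv)
      qed
    qed
    ultimately show ?thesis using full_row_rank_left_kernel[of ?M n "n + p + m" v] rk v by blast
  qed
  show ?thesis unfolding output_kernel_trivial_def carrier_matD[OF C] using part1 part2 by blast
qed

text \<open>\<open>F\<close> is the closed loop under the output feedback that returns minus the
  output. At \<open>u = Q *\<^sub>v x\<close> the skew part \<open>J\<close> contributes nothing,
  and what remains is minus the form of \<open>R\<close> minus the squared length of the output. If
  the sum vanishes, both terms do, and then \<open>F\<close> and \<open>(J - R) * Q\<close> agree at
  \<open>x\<close>.\<close>

lemma pH_dissipation_zero:
  assumes J: "J \<in> carrier_mat n n" "J\<^sup>T = - J" and R: "psd_mat n R" and Q: "Q \<in> carrier_mat n n"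
    and B: "B \<in> carrier_mat n m" and x: "x \<in> carrier_vec n"
  defines "F \<equiv> (J - R - B * B\<^sup>T) * Q"
  shows "(Q *\<^sub>v x) \<bullet> (F *\<^sub>v x) \<le> 0"
    and "(Q *\<^sub>v x) \<bullet> (F *\<^sub>v x) = 0 \<Longrightarrow> (B\<^sup>T * Q) *\<^sub>v x = 0\<^sub>v m \<and> F *\<^sub>v x = ((J - R) * Q) *\<^sub>v x"
proof -
  note [simp] = carrier_matD[OF J(1)] carrier_matD[OF psd_matD(1)[OF R]] carrier_matD[OF Q] carrier_matD[OF B]
    carrier_vecD[OF x]
  define u where "u = Q *\<^sub>v x"
  have u: "u \<in> carrier_vec n" unfolding u_def by (rule carrier_vecI) simp
  note [simp] = carrier_vecD[OF u]
  define y where "y = B\<^sup>T *\<^sub>v u"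
  have y: "y \<in> carrier_vec m" unfolding y_def by (rule carrier_vecI) simp
  note [simp] = carrier_vecD[OF y]
  have Fx: "F *\<^sub>v x = J *\<^sub>v u - R *\<^sub>v u - B *\<^sub>v y"
    by (simp add: F_def u_def y_def dim_mat_vec dim_mat_ring)
  have "u \<bullet> (J *\<^sub>v u) = (- J *\<^sub>v u) \<bullet> u" using scalar_mat_transpose[OF J(1) u u] J(2) by simp
  also have "\<dots> = - (u \<bullet> (J *\<^sub>v u))"
    using comm_scalar_prod[OF mult_mat_vec_carrier[OF J(1) u] u] by (simp add: uminus_mult_mat_vec)
  finally have uJ: "u \<bullet> (J *\<^sub>v u) = 0" by simp
  have uB: "u \<bullet> (B *\<^sub>v y) = y \<bullet> y" using scalar_mat_transpose[OF B u y] by (simp add: y_def)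
  have eq: "u \<bullet> (F *\<^sub>v x) = - (u \<bullet> (R *\<^sub>v u)) - y \<bullet> y"
    unfolding Fx by (simp add: dim_scalar_prod uJ uB)
  have nn: "0 \<le> u \<bullet> (R *\<^sub>v u)" "0 \<le> y \<bullet> y" using psd_matD(3)[OF R u] scalar_self_nonneg[of y] by simp_all
  show "(Q *\<^sub>v x) \<bullet> (F *\<^sub>v x) \<le> 0" unfolding u_def[symmetric] eq using nn by simp
  assume "(Q *\<^sub>v x) \<bullet> (F *\<^sub>v x) = 0"
  hence e: "- (u \<bullet> (R *\<^sub>v u)) - y \<bullet> y = 0" unfolding u_def[symmetric] eq .
  have Ru: "R *\<^sub>v u = 0\<^sub>v n" using e nn by (intro psd_null[OF R u]) simp
  have y0: "y = 0\<^sub>v m" using e nn by (intro scalar_self_zero[OF y]) simp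
  have "F *\<^sub>v x = J *\<^sub>v u - R *\<^sub>v u" unfolding Fx y0 by (auto simp: dim_mat_vec intro!: eq_vecI)
  thus "(B\<^sup>T * Q) *\<^sub>v x = 0\<^sub>v m \<and> F *\<^sub>v x = ((J - R) * Q) *\<^sub>v x"
    using y0 by (simp add: u_def y_def dim_mat_vec dim_mat_ring)
qed

text \<open>Energy argument with the form of \<open>H = E\<^sup>T * Q\<close>. For an eigenpair with
  \<open>a\<close> nonnegative the dissipation is at most zero by
  \<open>pH_dissipation_zero\<close>, but also \<open>a\<close> times an energy, so it vanishes. For
  the part at infinity symmetry of \<open>H\<close> makes it vanish, since
  \<open>E *\<^sub>v v = 0\<^sub>v n\<close>. In both cases the feedback is inactive, and the kernel
  condition of the open loop applies.\<close>

lemma pH_output_feedback_kernel: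
  assumes pH: "pH_system n m E J R Q B" and ok: "output_kernel_trivial n E ((J - R) * Q) (B\<^sup>T * Q)"
  defines "F \<equiv> (J - R - B * B\<^sup>T) * Q"
  shows "\<And>a b x y. 0 \<le> a \<Longrightarrow> pencil_eigenpair n E F a b x y \<Longrightarrow> x = 0\<^sub>v n \<and> y = 0\<^sub>v n"
    and "\<And>v w. v \<in> carrier_vec n \<Longrightarrow> w \<in> carrier_vec n \<Longrightarrow> E *\<^sub>v v = 0\<^sub>v n \<Longrightarrow> F *\<^sub>v v = E *\<^sub>v w \<Longrightarrow> v = 0\<^sub>v n"
proof -
  from pH have E: "E \<in> carrier_mat n n" and J: "J \<in> carrier_mat n n" "J\<^sup>T = - J" and R: "psd_mat n R"
    and Q: "Q \<in> carrier_mat n n" and B: "B \<in> carrier_mat n m" and EQ: "E\<^sup>T * Q = Q\<^sup>T * E" "psd_mat n (E\<^sup>T * Q)"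
    by (auto simp: pH_system_def)
  note [simp] = carrier_matD[OF E] carrier_matD[OF J(1)] carrier_matD[OF psd_matD(1)[OF R]]
    carrier_matD[OF Q] carrier_matD[OF B]
  define H where "H = E\<^sup>T * Q"
  have H: "psd_mat n H" using EQ by (simp add: H_def)
  have QE: "(Q *\<^sub>v x) \<bullet> (E *\<^sub>v y) = x \<bullet> (H *\<^sub>v y)" if x: "x \<in> carrier_vec n" and y: "y \<in> carrier_vec n" for x y
  proof -
    note [simp] = carrier_vecD[OF x] carrier_vecD[OF y]
    have "x \<bullet> (H *\<^sub>v y) = x \<bullet> (Q\<^sup>T *\<^sub>v (E *\<^sub>v y))" by (simp add: H_def EQ(1) dim_mat_vec)
    also have "\<dots> = (Q *\<^sub>v x) \<bullet> (E *\<^sub>v y)"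
      using scalar_mat_transpose[of "Q\<^sup>T" n n x "E *\<^sub>v y"] Q x mult_mat_vec_carrier[OF E y] by simp
    finally show ?thesis ..
  qed
  note diss = pH_dissipation_zero[OF J R Q B, folded F_def]
  show "x = 0\<^sub>v n \<and> y = 0\<^sub>v n" if a: "0 \<le> a" and ev: "pencil_eigenpair n E F a b x y" for a b x y
  proof -
    from ev have x: "x \<in> carrier_vec n" and y: "y \<in> carrier_vec n"
      and Fx: "F *\<^sub>v x = a \<cdot>\<^sub>v (E *\<^sub>v x) - b \<cdot>\<^sub>v (E *\<^sub>v y)"
      and Fy: "F *\<^sub>v y = b \<cdot>\<^sub>v (E *\<^sub>v x) + a \<cdot>\<^sub>v (E *\<^sub>v y)" by (auto simp: pencil_eigenpair_def)
    note [simp] = carrier_vecD[OF x] carrier_vecD[OF y]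
    \<comment> \<open>The terms with \<open>b\<close> cancel by symmetry of
      \<open>H\<close>.\<close>
    have "(Q *\<^sub>v x) \<bullet> (F *\<^sub>v x) + (Q *\<^sub>v y) \<bullet> (F *\<^sub>v y) = a * (x \<bullet> (H *\<^sub>v x) + y \<bullet> (H *\<^sub>v y))"
      unfolding Fx Fy using scalar_sym_mat[OF psd_matD(1,2)[OF H] x y]
      by (simp add: dim_scalar_prod QE x y algebra_simps)
    also have "\<dots> \<ge> 0" using a psd_matD(3)[OF H x] psd_matD(3)[OF H y] by simp
    finally have "(Q *\<^sub>v x) \<bullet> (F *\<^sub>v x) = 0" "(Q *\<^sub>v y) \<bullet> (F *\<^sub>v y) = 0"
      using diss(1)[OF x] diss(1)[OF y] by linarith+
    from diss(2)[OF x this(1)] diss(2)[OF y this(2)]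
    have "pencil_eigenpair n E ((J - R) * Q) a b x y" "(B\<^sup>T * Q) *\<^sub>v x = 0\<^sub>v m" "(B\<^sup>T * Q) *\<^sub>v y = 0\<^sub>v m"
      using ev by (auto simp: pencil_eigenpair_def)
    with a show ?thesis by (intro output_kernel_trivialD(1)[OF ok]) simp_all
  qed
  show "v = 0\<^sub>v n" if v: "v \<in> carrier_vec n" and w: "w \<in> carrier_vec n" and Ev: "E *\<^sub>v v = 0\<^sub>v n"
    and Fv: "F *\<^sub>v v = E *\<^sub>v w" for v w
  proof -
    note [simp] = carrier_vecD[OF v] carrier_vecD[OF w]
    have "(Q *\<^sub>v v) \<bullet> (F *\<^sub>v v) = v \<bullet> (H *\<^sub>v w)" unfolding Fv by (rule QE[OF v w])
    also have "\<dots> = w \<bullet> (H *\<^sub>v v)" by (rule scalar_sym_mat[OF psd_matD(1,2)[OF H] v w])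
    also have "\<dots> = (Q *\<^sub>v w) \<bullet> (E *\<^sub>v v)" by (rule QE[OF w v, symmetric])
    also have "\<dots> = 0" unfolding Ev by (rule scalar_prod_right_zero) (rule carrier_vecI, simp)
    finally have "(Q *\<^sub>v v) \<bullet> (F *\<^sub>v v) = 0" .
    from diss(2)[OF v this] show ?thesis
      by (intro output_kernel_trivialD(2)[OF ok _ v w Ev]) (simp_all add: Fv[symmetric])
  qed
qed

section \<open>Stability of semi-explicit pencils\<close>

lemma det_nonzero_imp_invertible_mat:
  fixes A :: "'a::field mat"
  assumes A: "A \<in> carrier_mat n n" and "det A \<noteq> 0" shows "invertible_mat A"
proof -
  from inverse_mat_obtain[OF assms] obtain Ai where "Ai \<in> carrier_mat n n" "A * Ai = 1\<^sub>m n" "Ai * A = 1\<^sub>m n"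
    by blast
  thus ?thesis using A unfolding invertible_mat_def inverts_mat_def by auto
qed

text \<open>The condition at infinity says that the lower right block of \<open>F\<close> is
  invertible. Eliminating with this pivot leaves its Schur complement as the finite part and gives
  the Weierstrass form explicitly. The condition on eigenpairs excludes the closed right
  half-plane.\<close>

lemma semi_explicit_stable_pencil:
  fixes F :: "real mat"
  assumes F: "F \<in> carrier_mat n n" and r: "r \<le> n"
    and E_def: "E = four_block_mat (1\<^sub>m r) (0\<^sub>m r (n - r)) (0\<^sub>m (n - r) r) (0\<^sub>m (n - r) (n - r))"
    and fin: "\<And>a b x y. 0 \<le> a \<Longrightarrow> pencil_eigenpair n E F a b x y \<Longrightarrow> x = 0\<^sub>v n \<and> y = 0\<^sub>v n"
    and inf: "\<And>v w. v \<in> carrier_vec n \<Longrightarrow> w \<in> carrier_vec n \<Longrightarrow> E *\<^sub>v v = 0\<^sub>v n \<Longrightarrow> F *\<^sub>v v = E *\<^sub>v w \<Longrightarrow> v = 0\<^sub>v n"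
  shows "stable_pencil n E F"
proof -
  let ?k = "n - r"
  have E: "E \<in> carrier_mat n n" using r unfolding E_def by (intro carrier_matI) simp_all
  have stab: "Re z < 0" if "finite_eigenvalue E F z" for z
  proof (rule ccontr)
    assume "\<not> Re z < 0"
    moreover from pencil_singular_obtain_eigenpair[OF E F that[unfolded finite_eigenvalue_def]]
    obtain x y where "pencil_eigenpair n E F (Re z) (Im z) x y" "\<not> (x = 0\<^sub>v n \<and> y = 0\<^sub>v n)" by blast
    ultimately show False using fin[of "Re z" "Im z" x y] by simp
  qed
  \<comment> \<open>The point 1 lies in the closed right half-plane, so it is no finite eigenvalue
    and witnesses regularity.\<close>
  hence reg: "regular_pencil E F" unfolding regular_pencil_def finite_eigenvalue_def
    by (intro exI[of _ 1]) force
  obtain F1 F2 F3 F4 where sp: "split_block F r r = (F1, F2, F3, F4)" by (metis prod_cases4)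
  have dF: "dim_row F = r + ?k" "dim_col F = r + ?k" using F r by simp_all
  note F1 = split_block(1)[OF sp dF] and F2 = split_block(2)[OF sp dF] and F3 = split_block(3)[OF sp dF]
    and F4 = split_block(4)[OF sp dF] and F_eq = split_block(5)[OF sp dF]
  note [simp] = carrier_matD[OF F1] carrier_matD[OF F2] carrier_matD[OF F3] carrier_matD[OF F4]
  have "det F4 \<noteq> 0"
  proof
    assume "det F4 = 0"
    then obtain x where x: "x \<in> carrier_vec ?k" "x \<noteq> 0\<^sub>v ?k" "F4 *\<^sub>v x = 0\<^sub>v ?k"
      using det_0_iff_vec_prod_zero_field[OF F4] by blast
    note [simp] = carrier_vecD[OF x(1)]
    \<comment> \<open>A kernel vector \<open>x\<close> of \<open>F4\<close> produces a forbidden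
      vector: \<open>(0, x)\<close> is annihilated by \<open>E\<close>, and \<open>F\<close> sends
      it to \<open>(F2 x, 0)\<close>, which is in the image of \<open>E\<close>.\<close>
    define v where "v = 0\<^sub>v r @\<^sub>v x"
    define w where "w = (F2 *\<^sub>v x) @\<^sub>v 0\<^sub>v ?k"
    have F2x: "F2 *\<^sub>v x \<in> carrier_vec r" by (rule carrier_vecI) simp
    have v: "v \<in> carrier_vec n" unfolding v_def using r by (intro carrier_vecI) simp
    have w: "w \<in> carrier_vec n" unfolding w_def using r by (intro carrier_vecI) simp
    have "F *\<^sub>v v = (F2 *\<^sub>v x) @\<^sub>v 0\<^sub>v ?k"
      unfolding F_eq v_def
      by (subst four_block_mat_mult_vec[OF F1 F2 F3 F4 zero_carrier_vec x(1)])
         (simp add: dim_mat_vec dim_zero_mult_mat_vec x(3) F2x)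
    moreover have "E *\<^sub>v w = (F2 *\<^sub>v x) @\<^sub>v 0\<^sub>v ?k"
      unfolding E_def w_def
      by (subst four_block_mat_mult_vec[OF one_carrier_mat zero_carrier_mat zero_carrier_mat zero_carrier_mat F2x zero_carrier_vec])
         (simp add: dim_mat_vec dim_zero_mult_mat_vec F2x)
    moreover have "E *\<^sub>v v = 0\<^sub>v n"
    proof -
      have "E *\<^sub>v v = 0\<^sub>v r @\<^sub>v 0\<^sub>v ?k"
        unfolding E_def v_def
        by (subst four_block_mat_mult_vec[OF one_carrier_mat zero_carrier_mat zero_carrier_mat zero_carrier_mat zero_carrier_vec x(1)])
           (simp add: dim_mat_vec dim_zero_mult_mat_vec x(1))
      also have "\<dots> = 0\<^sub>v n" using r by (auto intro!: eq_vecI)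
      finally show ?thesis .
    qed
    ultimately have v0: "v = 0\<^sub>v n" using inf[OF v w] by simp
    have "x = 0\<^sub>v ?k"
    proof (rule eq_vecI)
      fix i assume "i < dim_vec (0\<^sub>v ?k :: real vec)"
      thus "x $ i = 0\<^sub>v ?k $ i" using arg_cong[OF v0, of "\<lambda>v. v $ (r + i)"] r by (simp add: v_def)
    qed simp
    with x(2) show False by simp
  qed
  from inverse_mat_obtain[OF F4 this] obtain G where
    G: "G \<in> carrier_mat ?k ?k" "F4 * G = 1\<^sub>m ?k" "G * F4 = 1\<^sub>m ?k" by blast
  note [simp] = carrier_matD[OF G(1)]
  \<comment> \<open>Row and column elimination with pivot \<open>F4\<close>: \<open>U\<close> clears
    \<open>F2\<close> and normalizes the pivot, then \<open>V\<close> clears what is left of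
    \<open>F3\<close>. Neither changes \<open>E\<close>.\<close>
  define U where "U = four_block_mat (1\<^sub>m r) (- (F2 * G)) (0\<^sub>m ?k r) G"
  define V where "V = four_block_mat (1\<^sub>m r) (0\<^sub>m r ?k) (- (G * F3)) (1\<^sub>m ?k)"
  have FG: "- (F2 * G) \<in> carrier_mat r ?k" and GF: "- (G * F3) \<in> carrier_mat ?k r"
    by (rule carrier_matI, simp_all)+
  have U: "U \<in> carrier_mat n n" and V: "V \<in> carrier_mat n n"
    using r by (auto simp: U_def V_def intro!: carrier_matI)
  have "det G \<noteq> 0"
    using arg_cong[OF G(2), of det] det_mult[OF F4 G(1)] by auto
  hence "det U \<noteq> 0" unfolding U_def
    by (subst det_four_block_mat_lower_left_zero[OF one_carrier_mat FG refl G(1)]) simp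
  hence Ui: "invertible_mat U" by (rule det_nonzero_imp_invertible_mat[OF U])
  have "det V \<noteq> 0" unfolding V_def
    by (subst det_four_block_mat_upper_right_zero[OF one_carrier_mat refl GF one_carrier_mat]) simp
  hence Vi: "invertible_mat V" by (rule det_nonzero_imp_invertible_mat[OF V])
  have UE: "U * E = E" unfolding U_def E_def
    by (subst mult_four_block_mat[OF one_carrier_mat FG zero_carrier_mat G(1) one_carrier_mat zero_carrier_mat zero_carrier_mat zero_carrier_mat])
       (intro cong_four_block_mat; auto simp: scalar_prod_def)
  have EV: "E * V = E" unfolding V_def E_def
    by (subst mult_four_block_mat[OF one_carrier_mat zero_carrier_mat zero_carrier_mat zero_carrier_mat one_carrier_mat zero_carrier_mat GF one_carrier_mat])
       (intro cong_four_block_mat; auto simp: scalar_prod_def)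
  define H where "H = F1 - F2 * (G * F3)"
  have H: "H \<in> carrier_mat r r" unfolding H_def by (rule carrier_matI) simp_all
  have GF3: "G * F3 \<in> carrier_mat ?k r" by (rule carrier_matI) simp_all
  have GGF: "F4 * (G * F3) = F3" by (rule mat_inverse_cancel[OF F4 G(1,2)]) simp
  have "U * F = four_block_mat H (0\<^sub>m r ?k) (G * F3) (1\<^sub>m ?k)"
    unfolding F_eq U_def
  proof (subst mult_four_block_mat[OF one_carrier_mat FG zero_carrier_mat G(1) F1 F2 F3 F4], intro cong_four_block_mat)
    show "1\<^sub>m r * F1 + - (F2 * G) * F3 = H"
      unfolding H_def by (rule eq_matI) (simp_all add: dim_mat_ring dim_uminus_mult_mat del: index_mult_mat(1))
    show "1\<^sub>m r * F2 + - (F2 * G) * F4 = 0\<^sub>m r ?k"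
      by (rule eq_matI) (simp_all add: dim_mat_ring dim_uminus_mult_mat G(3) del: index_mult_mat(1))
    show "0\<^sub>m ?k r * F1 + G * F3 = G * F3"
      by (rule eq_matI) (simp_all add: dim_zero_mult_mat del: index_mult_mat(1))
    show "0\<^sub>m ?k r * F2 + G * F4 = 1\<^sub>m ?k"
      by (rule eq_matI) (simp_all add: dim_zero_mult_mat G(3) del: index_mult_mat(1))
  qed
  hence "U * F * V = four_block_mat H (0\<^sub>m r ?k) (G * F3) (1\<^sub>m ?k) * V" by simp
  also have "\<dots> = four_block_mat H (0\<^sub>m r ?k) (0\<^sub>m ?k r) (1\<^sub>m ?k)"
    unfolding V_def
  proof (subst mult_four_block_mat[OF H zero_carrier_mat GF3 one_carrier_mat one_carrier_mat zero_carrier_mat GF one_carrier_mat],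
      intro cong_four_block_mat)
    note [simp] = carrier_matD[OF H]
    show "H * 1\<^sub>m r + 0\<^sub>m r ?k * - (G * F3) = H"
      by (rule eq_matI) (simp_all add: dim_mat_ring dim_zero_mult_mat del: index_mult_mat(1))
    show "H * 0\<^sub>m r ?k + 0\<^sub>m r ?k * 1\<^sub>m ?k = 0\<^sub>m r ?k"
      by (rule eq_matI) (simp_all add: dim_zero_mult_mat dim_mult_zero_mat del: index_mult_mat(1))
    show "G * F3 * 1\<^sub>m r + 1\<^sub>m ?k * - (G * F3) = 0\<^sub>m ?k r"
      by (rule eq_matI) (simp_all add: dim_mat_ring del: index_mult_mat(1))
    show "G * F3 * 0\<^sub>m r ?k + 1\<^sub>m ?k * 1\<^sub>m ?k = 1\<^sub>m ?k"
      by (rule eq_matI) (simp_all add: dim_mat_ring dim_mult_zero_mat del: index_mult_mat(1))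
  qed
  finally have "U * F * V = four_block_mat H (0\<^sub>m r ?k) (0\<^sub>m ?k r) (1\<^sub>m ?k)" .
  moreover have "U * E * V = E" by (simp add: UE EV)
  ultimately have "impulse_free n E F"
    unfolding impulse_free_def using U V Ui Vi r H E_def by blast
  thus ?thesis unfolding stable_pencil_def using reg stab by blast
qed

section \<open>Rank normal form and simultaneous diagonalization\<close>

definition bordered :: "'a::semiring_1 \<Rightarrow> 'a mat \<Rightarrow> 'a mat" where
  "bordered a M = four_block_mat (a \<cdot>\<^sub>m 1\<^sub>m 1) (0\<^sub>m 1 (dim_col M)) (0\<^sub>m (dim_row M) 1) M"

lemma bordered_dim [simp]:
  "dim_row (bordered a M) = Suc (dim_row M)" "dim_col (bordered a M) = Suc (dim_col M)"
  by (simp_all add: bordered_def)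

lemma bordered_carrier: "M \<in> carrier_mat k l \<Longrightarrow> bordered a M \<in> carrier_mat (Suc k) (Suc l)"
  by (rule carrier_matI) simp_all

lemma bordered_index:
  "i < Suc (dim_row M) \<Longrightarrow> j < Suc (dim_col M) \<Longrightarrow> bordered a M $$ (i,j) =
    (if i = 0 \<and> j = 0 then a else if i = 0 \<or> j = 0 then 0 else M $$ (i - 1, j - 1))"
  by (auto simp: bordered_def)

lemma bordered_mult:
  fixes M N :: "'a::comm_ring_1 mat"
  assumes "dim_col M = dim_row N"
  shows "bordered a M * bordered b N = bordered (a * b) (M * N)"
proof -
  have M: "M \<in> carrier_mat (dim_row M) (dim_row N)" and N: "N \<in> carrier_mat (dim_row N) (dim_col N)"
    using assms by auto
  have a: "a \<cdot>\<^sub>m 1\<^sub>m 1 \<in> carrier_mat 1 1" "b \<cdot>\<^sub>m 1\<^sub>m 1 \<in> carrier_mat 1 1" by auto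
  show ?thesis unfolding bordered_def assms index_mult_mat(2,3)
  proof (subst mult_four_block_mat[OF a(1) zero_carrier_mat zero_carrier_mat M a(2) zero_carrier_mat zero_carrier_mat N],
      intro cong_four_block_mat)
    show "(a \<cdot>\<^sub>m 1\<^sub>m 1) * (b \<cdot>\<^sub>m 1\<^sub>m 1) + 0\<^sub>m 1 (dim_row N) * 0\<^sub>m (dim_row N) 1 = (a * b) \<cdot>\<^sub>m 1\<^sub>m 1"
      by (rule eq_matI) (simp_all add: dim_zero_mult_mat scalar_prod_def)
    show "(a \<cdot>\<^sub>m 1\<^sub>m 1) * 0\<^sub>m 1 (dim_col N) + 0\<^sub>m 1 (dim_row N) * N = 0\<^sub>m 1 (dim_col N)"
      by (simp add: dim_zero_mult_mat dim_mult_zero_mat)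
    show "0\<^sub>m (dim_row M) 1 * (b \<cdot>\<^sub>m 1\<^sub>m 1) + M * 0\<^sub>m (dim_row N) 1 = 0\<^sub>m (dim_row M) 1"
      using assms by (simp add: dim_zero_mult_mat dim_mult_zero_mat)
    show "0\<^sub>m (dim_row M) 1 * 0\<^sub>m 1 (dim_col N) + M * N = M * N"
      by (rule eq_matI) (simp_all add: dim_zero_mult_mat del: index_mult_mat(1))
  qed
qed

lemma bordered_transpose: "(bordered a M)\<^sup>T = bordered a M\<^sup>T"
  by (rule eq_matI) (auto simp: bordered_index)

lemma bordered_one: "bordered 1 (1\<^sub>m k) = 1\<^sub>m (Suc k)"
  by (rule eq_matI) (auto simp: bordered_index)

lemma bordered_diag_of: "bordered a (diag_of k f) = diag_of (Suc k) (case_nat a f)"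
  by (rule eq_matI) (auto simp: bordered_index diag_of_def split: nat.splits)

lemma diag_of_dim [simp]: "dim_row (diag_of n f) = n" "dim_col (diag_of n f) = n"
  by (simp_all add: diag_of_def)

lemma obtain_bordered:
  fixes M :: "'a::comm_ring_1 mat"
  assumes M: "M \<in> carrier_mat (Suc k) (Suc k)"
    and c: "M *\<^sub>v unit_vec (Suc k) 0 = a \<cdot>\<^sub>v unit_vec (Suc k) 0"
    and r: "M\<^sup>T *\<^sub>v unit_vec (Suc k) 0 = a \<cdot>\<^sub>v unit_vec (Suc k) 0"
  obtains M' where "M' \<in> carrier_mat k k" "M = bordered a M'"
proof
  note [simp] = carrier_matD[OF M]
  define M' where "M' = mat k k (\<lambda>(i,j). M $$ (Suc i, Suc j))"
  show "M' \<in> carrier_mat k k" by (simp add: M'_def)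
  have c': "M $$ (i, 0) = (if i = 0 then a else 0)" if "i < Suc k" for i
    using arg_cong[OF c, of "\<lambda>v. v $ i"] that by simp
  have r': "M $$ (0, i) = (if i = 0 then a else 0)" if "i < Suc k" for i
    using arg_cong[OF r, of "\<lambda>v. v $ i"] that by simp
  show "M = bordered a M'"
    by (rule eq_matI) (auto simp: bordered_index M'_def c' r')
qed

lemma psd_bordered:
  assumes p: "psd_mat (Suc k) (bordered a M)" and M: "M \<in> carrier_mat k k"
  shows "psd_mat k M" "0 \<le> a"
proof -
  note [simp] = carrier_matD[OF M]
  have "0 \<le> unit_vec (Suc k) 0 \<bullet> (bordered a M *\<^sub>v unit_vec (Suc k) 0)"
    by (rule psd_matD(3)[OF p]) simp
  also have "\<dots> = (bordered a M *\<^sub>v unit_vec (Suc k) 0) $ 0"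
    by (rule scalar_prod_left_unit) (rule carrier_vecI, simp_all)
  finally show "0 \<le> a" by (simp add: bordered_index)
  have "M\<^sup>T = M"
  proof (rule eq_matI)
    fix i j assume ij: "i < dim_row M" "j < dim_col M"
    thus "M\<^sup>T $$ (i,j) = M $$ (i,j)"
      using arg_cong[OF psd_matD(2)[OF p], of "\<lambda>N. N $$ (Suc i, Suc j)"] by (simp add: bordered_index)
  qed simp_all
  moreover have "0 \<le> x \<bullet> (M *\<^sub>v x)" if x: "x \<in> carrier_vec k" for x
  proof -
    note [simp] = carrier_vecD[OF x]
    let ?y = "0\<^sub>v 1 @\<^sub>v x"
    have Mx: "M *\<^sub>v x \<in> carrier_vec k" by (rule carrier_vecI) simp
    have "?y \<in> carrier_vec (Suc k)" by (rule carrier_vecI) simp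
    from psd_matD(3)[OF p this] have "0 \<le> ?y \<bullet> (bordered a M *\<^sub>v ?y)" .
    also have "bordered a M *\<^sub>v ?y = 0\<^sub>v 1 @\<^sub>v (M *\<^sub>v x)"
      unfolding bordered_def carrier_matD[OF M]
      by (subst four_block_mat_mult_vec[OF smult_carrier_mat[OF one_carrier_mat] zero_carrier_mat zero_carrier_mat M zero_carrier_vec x])
         (simp add: dim_mat_vec dim_zero_mult_mat_vec Mx)
    also have "?y \<bullet> (0\<^sub>v 1 @\<^sub>v (M *\<^sub>v x)) = x \<bullet> (M *\<^sub>v x)"
      by (subst scalar_prod_append[OF zero_carrier_vec x zero_carrier_vec Mx]) simp
    finally show ?thesis .
  qed
  ultimately show "psd_mat k M" using M by (simp add: psd_mat_def)
qed

lemma obtain_matrix_with_first_column: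
  fixes v :: "'a::field vec"
  assumes v: "v \<in> carrier_vec n" "v \<noteq> 0\<^sub>v n" and n: "0 < n"
  obtains T Ti where "T \<in> carrier_mat n n" "Ti \<in> carrier_mat n n" "T * Ti = 1\<^sub>m n" "Ti * T = 1\<^sub>m n"
    "T *\<^sub>v unit_vec n 0 = v"
proof -
  interpret vec_space "TYPE('a)" n .
  note bc = basis_completion[OF v]
  define T where "T = mat_of_cols n (basis_completion v)"
  have T: "T \<in> carrier_mat n n" unfolding T_def using bc(6) by (metis mat_of_cols_carrier(1))
  have cT: "cols T = basis_completion v" unfolding T_def using bc(2) by (rule cols_mat_of_cols)
  have "rank T = n" by (rule lin_indpt_full_rank[OF T]) (use bc in \<open>simp_all add: cT\<close>)
  hence "det T \<noteq> 0" using det_rank_iff[OF T] by simp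
  from inverse_mat_obtain[OF T this] obtain Ti where
    Ti: "Ti \<in> carrier_mat n n" "T * Ti = 1\<^sub>m n" "Ti * T = 1\<^sub>m n" by blast
  have "col T 0 = basis_completion v ! 0" using cT T n by (metis carrier_matD(2) cols_nth)
  also have "\<dots> = v" using bc(6,7) n by (metis hd_conv_nth length_greater_0_conv)
  finally have "col T 0 = v" .
  hence "T *\<^sub>v unit_vec n 0 = v"
    using carrier_matD[OF T] n by (intro eq_vecI) (auto simp: col_def)
  with T Ti show ?thesis by (rule that)
qed

text \<open>Since \<open>p \<bullet> v = 1\<close>, the line of \<open>v\<close> and the kernel of
  \<open>p\<close> are complementary; \<open>v\<close> is completed by a basis of that kernel. In
  such frames a map respecting both decompositions becomes bordered.\<close>

lemma obtain_dual_frame: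
  fixes v p :: "'a::field vec"
  assumes v: "v \<in> carrier_vec (Suc k)" and p: "p \<in> carrier_vec (Suc k)" and pv: "p \<bullet> v = 1"
  obtains T Ti where "T \<in> carrier_mat (Suc k) (Suc k)" "Ti \<in> carrier_mat (Suc k) (Suc k)"
    "T * Ti = 1\<^sub>m (Suc k)" "Ti * T = 1\<^sub>m (Suc k)"
    "T *\<^sub>v unit_vec (Suc k) 0 = v" "Ti\<^sup>T *\<^sub>v unit_vec (Suc k) 0 = p"
proof -
  let ?n = "Suc k" and ?e = "unit_vec (Suc k) 0 :: 'a vec"
  have "v \<noteq> 0\<^sub>v ?n" using pv p by auto
  from obtain_matrix_with_first_column[OF v this] obtain A Ai where
    A: "A \<in> carrier_mat ?n ?n" and Ai: "Ai \<in> carrier_mat ?n ?n" and AAi: "A * Ai = 1\<^sub>m ?n" "Ai * A = 1\<^sub>m ?n"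
    and Ae: "A *\<^sub>v ?e = v" by blast
  note [simp] = carrier_matD[OF A] carrier_matD[OF Ai] carrier_vecD[OF v] carrier_vecD[OF p]
  define q where "q = A\<^sup>T *\<^sub>v p"
  have q: "q \<in> carrier_vec ?n" unfolding q_def by (rule carrier_vecI) simp
  note [simp] = carrier_vecD[OF q]
  have q0: "q $ 0 = 1"
  proof -
    have "q $ 0 = q \<bullet> ?e" using q by simp
    also have "\<dots> = p \<bullet> (A *\<^sub>v ?e)"
      using scalar_mat_transpose[OF A p unit_vec_carrier] by (simp add: q_def)
    finally show ?thesis using pv Ae by simp
  qed
  \<comment> \<open>A shear along the first coordinate with inverse \<open>N (- s)\<close>.
    \<open>N (- 1)\<close> subtracts the component along \<open>v\<close> from the other basis
    vectors, which moves them into the kernel of \<open>p\<close>; it leaves the first column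
    \<open>v\<close> untouched because \<open>q $ 0 = 1\<close>.\<close>
  define N where "N s = mat ?n ?n (\<lambda>(i,j). if i = j then 1 else if i = 0 then s * q $ j else 0 :: 'a)" for s
  have [simp]: "dim_row (N s) = ?n" "dim_col (N s) = ?n" for s by (simp_all add: N_def)
  have NN: "N s * N (- s) = 1\<^sub>m ?n" for s
  proof (rule eq_matI)
    fix i j assume "i < dim_row (1\<^sub>m ?n :: 'a mat)" "j < dim_col (1\<^sub>m ?n :: 'a mat)"
    hence ij: "i < ?n" "j < ?n" by simp_all
    have "(N s * N (- s)) $$ (i,j) = (\<Sum>l\<in>{0..<?n}. N s $$ (i,l) * N (- s) $$ (l,j))"
      using ij by (simp add: scalar_prod_def)
    also have "\<dots> = N s $$ (i,0) * N (- s) $$ (0,j) + (\<Sum>l\<in>{1..<?n}. N s $$ (i,l) * N (- s) $$ (l,j))"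
      by (simp add: sum.atLeast_Suc_lessThan)
    also have "(\<Sum>l\<in>{1..<?n}. N s $$ (i,l) * N (- s) $$ (l,j)) =
      (\<Sum>l\<in>{1..<?n}. if l = j then N s $$ (i,j) else 0)"
      using ij by (intro sum.cong) (auto simp: N_def)
    also have "\<dots> = (if 1 \<le> j then N s $$ (i,j) else 0)" using ij by simp
    also have "N s $$ (i,0) * N (- s) $$ (0,j) + \<dots> = 1\<^sub>m ?n $$ (i,j)"
      using ij by (auto simp: N_def)
    finally show "(N s * N (- s)) $$ (i,j) = 1\<^sub>m ?n $$ (i,j)" .
  qed simp_all
  define T where "T = A * N (- 1)"
  define Ti where "Ti = N 1 * Ai"
  have "T * Ti = A * ((N (- 1) * N 1) * Ai)" by (simp add: T_def Ti_def dim_mat_ring)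
  hence "T * Ti = 1\<^sub>m ?n" by (simp add: NN[of "- 1", simplified] AAi dim_mat_ring)
  moreover have "Ti * T = N 1 * ((Ai * A) * N (- 1))" by (simp add: T_def Ti_def dim_mat_ring)
  hence "Ti * T = 1\<^sub>m ?n" by (simp add: NN[of 1] AAi dim_mat_ring)
  moreover have "N (- 1) *\<^sub>v ?e = ?e" by (rule eq_vecI) (auto simp: N_def)
  hence "T *\<^sub>v ?e = v" by (simp add: T_def dim_mat_vec Ae)
  moreover have "Ti\<^sup>T *\<^sub>v ?e = p"
  proof -
    have "(N 1)\<^sup>T *\<^sub>v ?e = q" by (rule eq_vecI) (auto simp: N_def q0)
    hence "Ti\<^sup>T *\<^sub>v ?e = (Ai\<^sup>T * A\<^sup>T) *\<^sub>v p" by (simp add: Ti_def dim_mat_ring dim_mat_vec q_def)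
    also have "Ai\<^sup>T * A\<^sup>T = 1\<^sub>m ?n" using arg_cong[OF AAi(1), of transpose_mat] by (simp add: dim_mat_ring)
    finally show ?thesis by (simp add: dim_mat_vec)
  qed
  moreover have "T \<in> carrier_mat ?n ?n" unfolding T_def by (rule carrier_matI) simp_all
  moreover have "Ti \<in> carrier_mat ?n ?n" unfolding Ti_def by (rule carrier_matI) simp_all
  ultimately show ?thesis using that by blast
qed

text \<open>Each step removes one pivot: a vector outside the kernel and its image are completed to
  dual frames in which \<open>E\<close> is bordered by 1, and the induction continues with the
  smaller block. If \<open>E\<close> is zero, \<open>r = 0\<close>.\<close>

lemma rank_normal_form:
  fixes E :: "real mat"
  assumes "E \<in> carrier_mat n n"
  shows "\<exists>S Si T Ti r. S \<in> carrier_mat n n \<and> Si \<in> carrier_mat n n \<and> T \<in> carrier_mat n n \<and> Ti \<in> carrier_mat n n \<and>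
    S * Si = 1\<^sub>m n \<and> Si * S = 1\<^sub>m n \<and> T * Ti = 1\<^sub>m n \<and> Ti * T = 1\<^sub>m n \<and> r \<le> n \<and>
    S * E * Ti = diag_of n (\<lambda>i. if i < r then 1 else 0)"
  using assms
proof (induction n arbitrary: E)
  case 0
  thus ?case by (intro exI[of _ "1\<^sub>m 0"] exI[of _ 0]) auto
next
  case (Suc k)
  let ?n = "Suc k" and ?e = "unit_vec (Suc k) 0 :: real vec"
  note E = Suc.prems
  note [simp] = carrier_matD[OF E]
  show ?case
  proof (cases "\<forall>v\<in>carrier_vec ?n. E *\<^sub>v v = 0\<^sub>v ?n")
    case True
    have "E = diag_of ?n (\<lambda>i. if i < 0 then 1 else 0)"
    proof (rule eq_matI)
      fix i j assume "i < dim_row (diag_of ?n (\<lambda>i. if i < 0 then 1 else 0 :: real))"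
        "j < dim_col (diag_of ?n (\<lambda>i. if i < 0 then 1 else 0 :: real))"
      hence ij: "i < ?n" "j < ?n" by simp_all
      have "E *\<^sub>v unit_vec ?n j = 0\<^sub>v ?n" using True by simp
      from arg_cong[OF this, of "\<lambda>v. v $ i"] ij
      show "E $$ (i,j) = diag_of ?n (\<lambda>i. if i < 0 then 1 else 0) $$ (i,j)" by (simp add: diag_of_def)
    qed simp_all
    thus ?thesis by (intro exI[of _ "1\<^sub>m ?n"] exI[of _ 0]) (simp add: dim_mat_ring)
  next
    case False
    then obtain v where v: "v \<in> carrier_vec ?n" "E *\<^sub>v v \<noteq> 0\<^sub>v ?n" by blast
    note [simp] = carrier_vecD[OF v(1)]
    define w where "w = E *\<^sub>v v"
    have w: "w \<in> carrier_vec ?n" unfolding w_def by (rule carrier_vecI) simp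
    note [simp] = carrier_vecD[OF w]
    have ww: "w \<bullet> w \<noteq> 0" using scalar_self_zero[OF w] v(2) by (auto simp: w_def)
    \<comment> \<open>Scaled such that \<open>p \<bullet> w = 1\<close>. Then
      \<open>s = E\<^sup>T *\<^sub>v p\<close> satisfies \<open>s \<bullet> v = 1\<close>, and
      \<open>E\<close> maps the line of \<open>v\<close> to that of \<open>w\<close> and the kernel
      of \<open>s\<close> into that of \<open>p\<close>.\<close>
    define p where "p = (1 / (w \<bullet> w)) \<cdot>\<^sub>v w"
    have p: "p \<in> carrier_vec ?n" unfolding p_def by (rule carrier_vecI) simp
    note [simp] = carrier_vecD[OF p]
    have pw: "p \<bullet> w = 1" using ww by (simp add: p_def)
    define s where "s = E\<^sup>T *\<^sub>v p"
    have s: "s \<in> carrier_vec ?n" unfolding s_def by (rule carrier_vecI) simp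
    have sv: "s \<bullet> v = 1" using scalar_mat_transpose[OF E p v(1)] pw by (simp add: s_def w_def)
    from obtain_dual_frame[OF v(1) s sv] obtain A Ai where
      A: "A \<in> carrier_mat ?n ?n" and Ai: "Ai \<in> carrier_mat ?n ?n" and AAi: "A * Ai = 1\<^sub>m ?n" "Ai * A = 1\<^sub>m ?n"
      and Ae: "A *\<^sub>v ?e = v" "Ai\<^sup>T *\<^sub>v ?e = s" by blast
    from obtain_dual_frame[OF w p pw] obtain V Vi where
      V: "V \<in> carrier_mat ?n ?n" and Vi: "Vi \<in> carrier_mat ?n ?n" and VVi: "V * Vi = 1\<^sub>m ?n" "Vi * V = 1\<^sub>m ?n"
      and Ve: "V *\<^sub>v ?e = w" "Vi\<^sup>T *\<^sub>v ?e = p" by blast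
    note [simp] = carrier_matD[OF A] carrier_matD[OF Ai] carrier_matD[OF V] carrier_matD[OF Vi]
    have "(Vi * E * A) *\<^sub>v ?e = (Vi * V) *\<^sub>v ?e"
      by (simp add: dim_mat_vec Ae Ve w_def[symmetric])
    hence c: "(Vi * E * A) *\<^sub>v ?e = 1 \<cdot>\<^sub>v ?e" by (simp add: VVi dim_mat_vec)
    have "(Vi * E * A)\<^sup>T *\<^sub>v ?e = A\<^sup>T *\<^sub>v (Ai\<^sup>T *\<^sub>v ?e)"
      by (simp add: dim_mat_ring dim_mat_vec Ae Ve s_def[symmetric])
    also have "\<dots> = (Ai * A)\<^sup>T *\<^sub>v ?e" by (simp add: dim_mat_ring dim_mat_vec)
    finally have r: "(Vi * E * A)\<^sup>T *\<^sub>v ?e = 1 \<cdot>\<^sub>v ?e" by (simp add: AAi dim_mat_vec)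
    have "Vi * E * A \<in> carrier_mat ?n ?n" by (rule carrier_matI) simp_all
    from obtain_bordered[OF this c r] obtain E' where E': "E' \<in> carrier_mat k k" "Vi * E * A = bordered 1 E'" by blast
    from Suc.IH[OF E'(1)] obtain S Si T Ti r where
      S: "S \<in> carrier_mat k k" and Si: "Si \<in> carrier_mat k k" and T: "T \<in> carrier_mat k k" and Ti: "Ti \<in> carrier_mat k k"
      and inv: "S * Si = 1\<^sub>m k" "Si * S = 1\<^sub>m k" "T * Ti = 1\<^sub>m k" "Ti * T = 1\<^sub>m k" and r: "r \<le> k"
      and eq: "S * E' * Ti = diag_of k (\<lambda>i. if i < r then 1 else 0)" by blast
    note [simp] = carrier_matD[OF S] carrier_matD[OF Si] carrier_matD[OF T] carrier_matD[OF Ti] carrier_matD[OF E'(1)]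
    define S1 where "S1 = bordered 1 S * Vi"
    define Si1 where "Si1 = V * bordered 1 Si"
    define T1 where "T1 = bordered 1 T * Ai"
    define Ti1 where "Ti1 = A * bordered 1 Ti"
    have "S1 * Si1 = bordered 1 S * ((Vi * V) * bordered 1 Si)" by (simp add: S1_def Si1_def dim_mat_ring)
    hence i1: "S1 * Si1 = 1\<^sub>m ?n" by (simp add: VVi dim_mat_ring bordered_mult inv bordered_one)
    have "Si1 * S1 = V * ((bordered 1 Si * bordered 1 S) * Vi)" by (simp add: S1_def Si1_def dim_mat_ring)
    hence i2: "Si1 * S1 = 1\<^sub>m ?n" by (simp add: VVi dim_mat_ring bordered_mult inv bordered_one)
    have "T1 * Ti1 = bordered 1 T * ((Ai * A) * bordered 1 Ti)" by (simp add: T1_def Ti1_def dim_mat_ring)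
    hence i3: "T1 * Ti1 = 1\<^sub>m ?n" by (simp add: AAi dim_mat_ring bordered_mult inv bordered_one)
    have "Ti1 * T1 = A * ((bordered 1 Ti * bordered 1 T) * Ai)" by (simp add: T1_def Ti1_def dim_mat_ring)
    hence i4: "Ti1 * T1 = 1\<^sub>m ?n" by (simp add: AAi dim_mat_ring bordered_mult inv bordered_one)
    have "S1 * E * Ti1 = bordered 1 S * (Vi * E * A) * bordered 1 Ti" by (simp add: S1_def Ti1_def dim_mat_ring)
    also have "\<dots> = bordered 1 (S * E' * Ti)" unfolding E'(2) by (simp add: bordered_mult)
    also have "\<dots> = diag_of ?n (\<lambda>i. if i < Suc r then 1 else 0)"
      unfolding eq bordered_diag_of by (rule eq_matI) (auto simp: diag_of_def split: nat.splits)
    finally have eq1: "S1 * E * Ti1 = diag_of ?n (\<lambda>i. if i < Suc r then 1 else 0)" .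
    have "S1 \<in> carrier_mat ?n ?n" "Si1 \<in> carrier_mat ?n ?n" "T1 \<in> carrier_mat ?n ?n" "Ti1 \<in> carrier_mat ?n ?n"
      unfolding S1_def Si1_def T1_def Ti1_def by (rule carrier_matI; simp)+
    thus ?thesis using i1 i2 i3 i4 eq1 r by (intro exI[of _ S1] exI[of _ Si1] exI[of _ T1] exI[of _ Ti1] exI[of _ "Suc r"]) simp
  qed
qed

text \<open>A dual pair as in \<open>step\<close> spans a coordinate that splits off from
  \<open>X\<close> and \<open>Y\<close> in one dual frame. The invariant \<open>ok\<close> is a
  parameter since the induction is run twice: with nonsingular \<open>X\<close>, which already
  diagonalizes a single form, and then without restriction, where finding the pair relies on that
  diagonalization.\<close>

lemma contragredient_diagonalization_induct:
  assumes step: "\<And>k X Y. 0 < k \<Longrightarrow> psd_mat k X \<Longrightarrow> psd_mat k Y \<Longrightarrow> ok k X \<Longrightarrow>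
      \<exists>v p a b. v \<in> carrier_vec k \<and> p \<in> carrier_vec k \<and> p \<bullet> v = 1 \<and> X *\<^sub>v p = a \<cdot>\<^sub>v v \<and> Y *\<^sub>v v = b \<cdot>\<^sub>v p"
    and closed: "\<And>k X X' S T a. ok (Suc k) X \<Longrightarrow> psd_mat (Suc k) X \<Longrightarrow> S \<in> carrier_mat (Suc k) (Suc k) \<Longrightarrow>
      T \<in> carrier_mat (Suc k) (Suc k) \<Longrightarrow> S * T = 1\<^sub>m (Suc k) \<Longrightarrow> X' \<in> carrier_mat k k \<Longrightarrow>
      S * X * S\<^sup>T = bordered a X' \<Longrightarrow> ok k X'"
    and X: "psd_mat n X" and Y: "psd_mat n Y" and ok: "ok n X"
  shows "\<exists>S T a b. S \<in> carrier_mat n n \<and> T \<in> carrier_mat n n \<and> S * T = 1\<^sub>m n \<and> T * S = 1\<^sub>m n \<and>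
    S * X * S\<^sup>T = diag_of n a \<and> T\<^sup>T * Y * T = diag_of n b \<and> (\<forall>i<n. 0 \<le> a i \<and> 0 \<le> b i)"
  using X Y ok
proof (induction n arbitrary: X Y)
  case 0
  thus ?case
    by (intro exI[of _ "1\<^sub>m 0"] exI[of _ "\<lambda>_. 0"]) (auto simp: psd_mat_def diag_of_def intro!: eq_matI)
next
  case (Suc k)
  let ?n = "Suc k" and ?e = "unit_vec (Suc k) 0 :: real vec"
  note X = Suc.prems(1) and Y = Suc.prems(2)
  from step[OF _ X Y Suc.prems(3)] obtain v p a b where v: "v \<in> carrier_vec ?n" and p: "p \<in> carrier_vec ?n"
    and pv: "p \<bullet> v = 1" and Xp: "X *\<^sub>v p = a \<cdot>\<^sub>v v" and Yv: "Y *\<^sub>v v = b \<cdot>\<^sub>v p" by blast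
  from obtain_dual_frame[OF v p pv] obtain A Ai where
    A: "A \<in> carrier_mat ?n ?n" and Ai: "Ai \<in> carrier_mat ?n ?n" and AAi: "A * Ai = 1\<^sub>m ?n" "Ai * A = 1\<^sub>m ?n"
    and Ae: "A *\<^sub>v ?e = v" "Ai\<^sup>T *\<^sub>v ?e = p" by blast
  note [simp] = carrier_matD[OF A] carrier_matD[OF Ai] carrier_vecD[OF v] carrier_vecD[OF p]
    carrier_matD[OF psd_matD(1)[OF X]] carrier_matD[OF psd_matD(1)[OF Y]]
  let ?X = "Ai * X * Ai\<^sup>T" and ?Y = "A\<^sup>T * Y * A"
  have pX: "psd_mat ?n ?X" by (rule psd_congruence[OF X Ai])
  have pY: "psd_mat ?n ?Y" using psd_congruence[OF Y, of "A\<^sup>T" ?n] A by simp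
  have "?X *\<^sub>v ?e = a \<cdot>\<^sub>v (Ai *\<^sub>v (A *\<^sub>v ?e))" by (simp add: dim_mat_vec Ae Xp)
  also have "Ai *\<^sub>v (A *\<^sub>v ?e) = ?e" using mat_inverse_vec[OF Ai A AAi(2) unit_vec_carrier] .
  finally have Xe: "?X *\<^sub>v ?e = a \<cdot>\<^sub>v ?e" .
  have "?Y *\<^sub>v ?e = b \<cdot>\<^sub>v (A\<^sup>T *\<^sub>v (Ai\<^sup>T *\<^sub>v ?e))" by (simp add: dim_mat_vec Ae Yv)
  also have "A\<^sup>T *\<^sub>v (Ai\<^sup>T *\<^sub>v ?e) = (Ai * A)\<^sup>T *\<^sub>v ?e" by (simp add: dim_mat_vec dim_mat_ring)
  finally have Ye: "?Y *\<^sub>v ?e = b \<cdot>\<^sub>v ?e" by (simp add: AAi dim_mat_vec)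
  from obtain_bordered[OF psd_matD(1)[OF pX] Xe] Xe psd_matD(2)[OF pX] obtain X' where
    X': "X' \<in> carrier_mat k k" "?X = bordered a X'" by metis
  from obtain_bordered[OF psd_matD(1)[OF pY] Ye] Ye psd_matD(2)[OF pY] obtain Y' where
    Y': "Y' \<in> carrier_mat k k" "?Y = bordered b Y'" by metis
  note pX' = psd_bordered[OF pX[unfolded X'(2)] X'(1)] and pY' = psd_bordered[OF pY[unfolded Y'(2)] Y'(1)]
  have "ok k X'" by (rule closed[OF Suc.prems(3) X Ai A AAi(2) X'])
  from Suc.IH[OF pX'(1) pY'(1) this] obtain S T a' b' where
    S: "S \<in> carrier_mat k k" and T: "T \<in> carrier_mat k k" and ST: "S * T = 1\<^sub>m k" "T * S = 1\<^sub>m k"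
    and SX: "S * X' * S\<^sup>T = diag_of k a'" and TY: "T\<^sup>T * Y' * T = diag_of k b'"
    and nn: "\<forall>i<k. 0 \<le> a' i \<and> 0 \<le> b' i" by blast
  note [simp] = carrier_matD[OF S] carrier_matD[OF T] carrier_matD[OF X'(1)] carrier_matD[OF Y'(1)]
  define S1 where "S1 = bordered 1 S * Ai"
  define T1 where "T1 = A * bordered 1 T"
  have "S1 * T1 = bordered 1 S * ((Ai * A) * bordered 1 T)" by (simp add: S1_def T1_def dim_mat_ring)
  hence i1: "S1 * T1 = 1\<^sub>m ?n" by (simp add: AAi dim_mat_ring bordered_mult ST bordered_one)
  have "T1 * S1 = A * ((bordered 1 T * bordered 1 S) * Ai)" by (simp add: S1_def T1_def dim_mat_ring)
  hence i2: "T1 * S1 = 1\<^sub>m ?n" by (simp add: AAi dim_mat_ring bordered_mult ST bordered_one)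
  have "S1 * X * S1\<^sup>T = bordered 1 S * ?X * (bordered 1 S)\<^sup>T" by (simp add: S1_def dim_mat_ring)
  also have "\<dots> = bordered a (S * X' * S\<^sup>T)" unfolding X'(2) by (simp add: bordered_transpose bordered_mult)
  finally have e1: "S1 * X * S1\<^sup>T = diag_of ?n (case_nat a a')" unfolding SX bordered_diag_of .
  have "T1\<^sup>T * Y * T1 = (bordered 1 T)\<^sup>T * ?Y * bordered 1 T" by (simp add: T1_def dim_mat_ring)
  also have "\<dots> = bordered b (T\<^sup>T * Y' * T)" unfolding Y'(2) by (simp add: bordered_transpose bordered_mult)
  finally have e2: "T1\<^sup>T * Y * T1 = diag_of ?n (case_nat b b')" unfolding TY bordered_diag_of .
  have "S1 \<in> carrier_mat ?n ?n" "T1 \<in> carrier_mat ?n ?n"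
    unfolding S1_def T1_def by (rule carrier_matI; simp)+
  moreover have "\<forall>i<?n. 0 \<le> case_nat a a' i \<and> 0 \<le> case_nat b b' i"
    using nn pX'(2) pY'(2) by (auto split: nat.splits)
  ultimately show ?case using i1 i2 e1 e2 by blast
qed

lemma det_inverse_nonzero:
  fixes S T :: "'a::field mat"
  assumes "S \<in> carrier_mat n n" "T \<in> carrier_mat n n" "S * T = 1\<^sub>m n"
  shows "det S \<noteq> 0" "det T \<noteq> 0"
  using arg_cong[OF assms(3), of det] det_mult[OF assms(1,2)] by auto

lemma psd_inverse:
  assumes X: "psd_mat n X" and Xi: "Xi \<in> carrier_mat n n" "X * Xi = 1\<^sub>m n" "Xi * X = 1\<^sub>m n"
  shows "psd_mat n Xi"
proof -
  note [simp] = carrier_matD[OF psd_matD(1)[OF X]] carrier_matD[OF Xi(1)]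
  have XiT: "X * Xi\<^sup>T = 1\<^sub>m n"
    using arg_cong[OF Xi(3), of transpose_mat] psd_matD(2)[OF X] by (simp add: dim_mat_ring)
  have "Xi = Xi * (X * Xi\<^sup>T)" unfolding XiT by (simp add: dim_mat_ring)
  also have "\<dots> = Xi * X * Xi\<^sup>T" by (simp add: dim_mat_ring)
  finally show ?thesis using psd_congruence[OF X Xi(1)] by metis
qed

text \<open>\<open>X * Y\<close> is self-adjoint for the inner product of the inverse
  \<open>G\<close> of \<open>X\<close>, so it has a real eigenvector \<open>u\<close>. The dual
  vector is \<open>G *\<^sub>v u\<close>, scaled by
  \<open>u \<bullet> (G *\<^sub>v u)\<close>.\<close>

lemma contragredient_pair_nonsingular:
  assumes n: "0 < n" and X: "psd_mat n X" and Y: "psd_mat n Y" and d: "det X \<noteq> 0"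
  shows "\<exists>v p a b. v \<in> carrier_vec n \<and> p \<in> carrier_vec n \<and> p \<bullet> v = 1 \<and> X *\<^sub>v p = a \<cdot>\<^sub>v v \<and> Y *\<^sub>v v = b \<cdot>\<^sub>v p"
proof -
  note Xc = psd_matD(1)[OF X] and Yc = psd_matD(1)[OF Y]
  from inverse_mat_obtain[OF Xc d] obtain G where G: "G \<in> carrier_mat n n" "X * G = 1\<^sub>m n" "G * X = 1\<^sub>m n" by blast
  have pG: "psd_mat n G" by (rule psd_inverse[OF X G])
  note [simp] = carrier_matD[OF Xc] carrier_matD[OF Yc] carrier_matD[OF G(1)]
  have Gpos: "0 < u \<bullet> (G *\<^sub>v u)" if u: "u \<in> carrier_vec n" "u \<noteq> 0\<^sub>v n" for u
  proof (rule ccontr)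
    assume "\<not> 0 < u \<bullet> (G *\<^sub>v u)"
    hence "u \<bullet> (G *\<^sub>v u) = 0" using psd_matD(3)[OF pG u(1)] by simp
    from psd_null[OF pG u(1) this] have "u = X *\<^sub>v 0\<^sub>v n" using mat_inverse_vec[OF Xc G(1,2) u(1)] by simp
    with u(2) show False by (simp add: dim_mat_vec)
  qed
  define A where "A = X * Y"
  have A: "A \<in> carrier_mat n n" unfolding A_def by (rule carrier_matI) simp_all
  note [simp] = carrier_matD[OF A]
  have cA: "cmat A \<in> carrier_mat n n" using A by simp
  from spectrum_non_empty[OF cA n] obtain z where "eigenvalue (cmat A) z" by (auto simp: spectrum_def)
  then obtain c where c: "c \<in> carrier_vec n" "c \<noteq> 0\<^sub>v n" "cmat A *\<^sub>v c = z \<cdot>\<^sub>v c"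
    by (auto simp: eigenvalue_def eigenvector_def)
  note [simp] = carrier_vecD[OF c(1)]
  have "(z \<cdot>\<^sub>m cmat (1\<^sub>m n) - cmat A) *\<^sub>v c = 0\<^sub>v n"
    using c by (simp add: dim_mat_vec cmat_one)
  moreover have zA: "z \<cdot>\<^sub>m cmat (1\<^sub>m n) - cmat A \<in> carrier_mat n n" by (rule carrier_matI) simp_all
  ultimately have "det (z \<cdot>\<^sub>m cmat (1\<^sub>m n) - cmat A) = 0"
    using det_0_iff_vec_prod_zero_field[OF zA] c by blast
  from pencil_singular_obtain_eigenpair[OF one_carrier_mat A this] obtain x y where
    ev: "pencil_eigenpair n (1\<^sub>m n) A (Re z) (Im z) x y" and xy: "\<not> (x = 0\<^sub>v n \<and> y = 0\<^sub>v n)" by blast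
  define \<alpha> where "\<alpha> = Re z"
  define \<beta> where "\<beta> = Im z"
  from ev have x: "x \<in> carrier_vec n" and y: "y \<in> carrier_vec n" by (auto simp: pencil_eigenpair_def)
  note [simp] = carrier_vecD[OF x] carrier_vecD[OF y]
  have Ax: "A *\<^sub>v x = \<alpha> \<cdot>\<^sub>v x - \<beta> \<cdot>\<^sub>v y" and Ay: "A *\<^sub>v y = \<beta> \<cdot>\<^sub>v x + \<alpha> \<cdot>\<^sub>v y"
    using ev by (simp_all add: pencil_eigenpair_def \<alpha>_def \<beta>_def dim_mat_vec)
  have GA: "Y *\<^sub>v u = G *\<^sub>v (A *\<^sub>v u)" if u: "u \<in> carrier_vec n" for u
  proof -
    note [simp] = carrier_vecD[OF u]
    have "G *\<^sub>v (A *\<^sub>v u) = (G * X) *\<^sub>v (Y *\<^sub>v u)" by (simp add: A_def dim_mat_vec)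
    thus ?thesis unfolding G(3) by (simp add: dim_mat_vec)
  qed
  have Yx: "Y *\<^sub>v x = \<alpha> \<cdot>\<^sub>v (G *\<^sub>v x) - \<beta> \<cdot>\<^sub>v (G *\<^sub>v y)" unfolding GA[OF x] Ax by (simp add: dim_mat_vec)
  have Yy: "Y *\<^sub>v y = \<beta> \<cdot>\<^sub>v (G *\<^sub>v x) + \<alpha> \<cdot>\<^sub>v (G *\<^sub>v y)" unfolding GA[OF y] Ay by (simp add: dim_mat_vec)
  \<comment> \<open>Inserting \<open>Yx\<close> and \<open>Yy\<close> into this symmetry cancels the
    terms with \<open>\<alpha>\<close> and leaves \<open>\<beta>\<close> times a positive
    number.\<close>
  have "x \<bullet> (Y *\<^sub>v y) = y \<bullet> (Y *\<^sub>v x)" by (rule scalar_sym_mat[OF psd_matD(1,2)[OF Y] x y])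
  hence "\<beta> * (x \<bullet> (G *\<^sub>v x)) + \<beta> * (y \<bullet> (G *\<^sub>v y)) = 0"
    unfolding Yx Yy using scalar_sym_mat[OF psd_matD(1,2)[OF pG] x y] by (simp add: dim_scalar_prod)
  hence "\<beta> * (x \<bullet> (G *\<^sub>v x) + y \<bullet> (G *\<^sub>v y)) = 0" by (simp add: algebra_simps)
  moreover have "x \<bullet> (G *\<^sub>v x) + y \<bullet> (G *\<^sub>v y) > 0"
    using xy Gpos[OF x] Gpos[OF y] psd_matD(3)[OF pG x] psd_matD(3)[OF pG y] by fastforce
  ultimately have b0: "\<beta> = 0" by simp
  have Yu: "Y *\<^sub>v x = \<alpha> \<cdot>\<^sub>v (G *\<^sub>v x)" "Y *\<^sub>v y = \<alpha> \<cdot>\<^sub>v (G *\<^sub>v y)"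
    unfolding Yx Yy b0 by (auto intro!: eq_vecI)
  obtain u where u: "u \<in> carrier_vec n" "u \<noteq> 0\<^sub>v n" "Y *\<^sub>v u = \<alpha> \<cdot>\<^sub>v (G *\<^sub>v u)"
    using xy Yu x y by blast
  note [simp] = carrier_vecD[OF u(1)]
  define s where "s = u \<bullet> (G *\<^sub>v u)"
  have s: "0 < s" unfolding s_def by (rule Gpos[OF u(1,2)])
  define p where "p = (1 / s) \<cdot>\<^sub>v (G *\<^sub>v u)"
  have Gu: "G *\<^sub>v u \<in> carrier_vec n" by (rule carrier_vecI) simp
  have p: "p \<in> carrier_vec n" unfolding p_def by (rule carrier_vecI) simp
  have "p \<bullet> u = 1" using s comm_scalar_prod[OF Gu u(1)] by (simp add: p_def s_def)
  moreover have "X *\<^sub>v p = (1 / s) \<cdot>\<^sub>v u"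
    using mat_inverse_vec[OF Xc G(1,2) u(1)] by (simp add: p_def dim_mat_vec)
  moreover have "Y *\<^sub>v u = (\<alpha> * s) \<cdot>\<^sub>v p" using s by (simp add: u(3) p_def smult_smult_assoc)
  ultimately show ?thesis using u(1) p by blast
qed

text \<open>The contragredient diagonalization of the pair of the identity and \<open>X\<close>. The
  invariant survives a step because the determinant of a bordered matrix is the corner times that of
  the block.\<close>

lemma psd_congruence_diagonal:
  assumes X: "psd_mat n X"
  obtains S T d where "S \<in> carrier_mat n n" "T \<in> carrier_mat n n" "S * T = 1\<^sub>m n" "T * S = 1\<^sub>m n"
    "T\<^sup>T * X * T = diag_of n d"
proof -
  have closed: "det X' \<noteq> 0" if d: "det Z \<noteq> 0" and Z: "psd_mat (Suc k) Z" and S: "S \<in> carrier_mat (Suc k) (Suc k)"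
    and T: "T \<in> carrier_mat (Suc k) (Suc k)" and ST: "S * T = 1\<^sub>m (Suc k)" and X': "X' \<in> carrier_mat k k"
    and eq: "S * Z * S\<^sup>T = bordered a X'" for k Z X' S T and a :: real
  proof -
    note Zc = psd_matD(1)[OF Z]
    have "det (S * Z * S\<^sup>T) = det S * det Z * det S"
      using det_mult[OF mult_carrier_mat[OF S Zc], of "S\<^sup>T"] det_mult[OF S Zc] det_transpose[OF S] S by simp
    hence "det (bordered a X') \<noteq> 0" using d det_inverse_nonzero[OF S T ST] eq by simp
    moreover have "det (bordered a X') = a * det X'"
      unfolding bordered_def carrier_matD[OF X']
      by (subst det_four_block_mat_upper_right_zero[OF smult_carrier_mat[OF one_carrier_mat] refl zero_carrier_mat X']) simp
    ultimately show ?thesis by auto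
  qed
  have "\<exists>S T a b. S \<in> carrier_mat n n \<and> T \<in> carrier_mat n n \<and> S * T = 1\<^sub>m n \<and> T * S = 1\<^sub>m n \<and>
    S * 1\<^sub>m n * S\<^sup>T = diag_of n a \<and> T\<^sup>T * X * T = diag_of n b \<and> (\<forall>i<n. 0 \<le> a i \<and> 0 \<le> b i)"
    by (rule contragredient_diagonalization_induct[where ok = "\<lambda>_ X. det X \<noteq> 0", OF contragredient_pair_nonsingular closed psd_one X])
      simp_all
  thus ?thesis using that by blast
qed

text \<open>If \<open>Y\<close> is nonsingular, the roles are exchanged. Otherwise take
  \<open>w\<close> in the kernel of \<open>Y\<close>. If \<open>w\<close> is outside the range of
  \<open>X\<close>, some \<open>p\<close> in the kernel of \<open>X\<close> pairs nontrivially with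
  it. If \<open>w = X *\<^sub>v q\<close>, then \<open>q \<bullet> w\<close> is the form of
  \<open>X\<close> at \<open>q\<close> and nonzero by \<open>psd_null\<close>, so \<open>q\<close>
  can be scaled to the dual vector.\<close>

lemma contragredient_pair:
  assumes n: "0 < n" and X: "psd_mat n X" and Y: "psd_mat n Y"
  shows "\<exists>v p a b. v \<in> carrier_vec n \<and> p \<in> carrier_vec n \<and> p \<bullet> v = 1 \<and> X *\<^sub>v p = a \<cdot>\<^sub>v v \<and> Y *\<^sub>v v = b \<cdot>\<^sub>v p"
proof (cases "det Y = 0")
  case False
  from contragredient_pair_nonsingular[OF n Y X False] obtain v p a b where
    "v \<in> carrier_vec n" "p \<in> carrier_vec n" "p \<bullet> v = 1" "Y *\<^sub>v p = a \<cdot>\<^sub>v v" "X *\<^sub>v v = b \<cdot>\<^sub>v p" by blast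
  moreover from this have "v \<bullet> p = 1" using comm_scalar_prod by metis
  ultimately show ?thesis by blast
next
  case True
  note Xc = psd_matD(1)[OF X] and Yc = psd_matD(1)[OF Y]
  from True det_0_iff_vec_prod_zero_field[OF Yc] obtain w where
    w: "w \<in> carrier_vec n" "w \<noteq> 0\<^sub>v n" "Y *\<^sub>v w = 0\<^sub>v n" by blast
  from psd_congruence_diagonal[OF X] obtain S T d where
    S: "S \<in> carrier_mat n n" and T: "T \<in> carrier_mat n n" and ST: "S * T = 1\<^sub>m n" "T * S = 1\<^sub>m n"
    and TX: "T\<^sup>T * X * T = diag_of n d" by blast
  note [simp] = carrier_matD[OF Xc] carrier_matD[OF Yc] carrier_matD[OF S] carrier_matD[OF T] carrier_vecD[OF w(1)]
  have XT: "X *\<^sub>v (T *\<^sub>v c) = S\<^sup>T *\<^sub>v (diag_of n d *\<^sub>v c)" if c: "c \<in> carrier_vec n" for c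
  proof -
    note [simp] = carrier_vecD[OF c]
    have "S\<^sup>T *\<^sub>v (diag_of n d *\<^sub>v c) = ((T * S)\<^sup>T) *\<^sub>v (X *\<^sub>v (T *\<^sub>v c))"
      unfolding TX[symmetric] by (simp add: dim_mat_vec dim_mat_ring)
    thus ?thesis unfolding ST by (simp add: dim_mat_vec)
  qed
  have dc: "diag_of n d *\<^sub>v c = vec n (\<lambda>i. d i * c $ i)" if c: "c \<in> carrier_vec n" for c
  proof (rule eq_vecI)
    fix i assume "i < dim_vec (vec n (\<lambda>i. d i * c $ i))"
    hence i: "i < n" by simp
    have "(diag_of n d *\<^sub>v c) $ i = (\<Sum>j\<in>{0..<n}. (if i = j then d i else 0) * c $ j)"
      using i carrier_vecD[OF c] by (simp add: diag_of_def scalar_prod_def)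
    also have "\<dots> = (\<Sum>j\<in>{0..<n}. if j = i then d i * c $ i else 0)" by (intro sum.cong) auto
    also have "\<dots> = d i * c $ i" using i by simp
    finally show "(diag_of n d *\<^sub>v c) $ i = vec n (\<lambda>i. d i * c $ i) $ i" using i by simp
  qed simp
  \<comment> \<open>As \<open>w = S\<^sup>T *\<^sub>v u\<close> and \<open>X\<close> sends
    \<open>T *\<^sub>v c\<close> to \<open>S\<^sup>T *\<^sub>v (diag_of n d *\<^sub>v c)\<close>,
    \<open>w\<close> lies in the range of \<open>X\<close> exactly if \<open>u\<close> vanishes
    wherever \<open>d\<close> does.\<close>
  define u where "u = T\<^sup>T *\<^sub>v w"
  have u: "u \<in> carrier_vec n" unfolding u_def by (rule carrier_vecI) simp
  have Su: "S\<^sup>T *\<^sub>v u = w"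
  proof -
    have "S\<^sup>T *\<^sub>v u = (T * S)\<^sup>T *\<^sub>v w" by (simp add: u_def dim_mat_vec dim_mat_ring)
    thus ?thesis unfolding ST by (simp add: dim_mat_vec)
  qed
  show ?thesis
  proof (cases "\<exists>i<n. d i = 0 \<and> u $ i \<noteq> 0")
    case True
    then obtain i where i: "i < n" "d i = 0" "u $ i \<noteq> 0" by blast
    define p where "p = T *\<^sub>v unit_vec n i"
    have p: "p \<in> carrier_vec n" unfolding p_def by (rule carrier_vecI) simp
    note [simp] = carrier_vecD[OF p]
    have "X *\<^sub>v p = S\<^sup>T *\<^sub>v 0\<^sub>v n"
      unfolding p_def XT[OF unit_vec_carrier] dc[OF unit_vec_carrier] using i(1,2)
      by (intro arg_cong[of _ _ "\<lambda>v. S\<^sup>T *\<^sub>v v"] eq_vecI) (auto simp: index_unit_vec(1))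
    hence Xp: "X *\<^sub>v p = 0\<^sub>v n" by (simp add: dim_mat_vec)
    have "p \<bullet> w = w \<bullet> p" by (rule comm_scalar_prod[OF p w(1)])
    also have "\<dots> = u \<bullet> unit_vec n i"
      unfolding p_def u_def by (rule scalar_mat_transpose[OF T w(1) unit_vec_carrier])
    also have "\<dots> = u $ i" using i(1) u by simp
    finally have pw: "p \<bullet> w = u $ i" .
    define v where "v = (1 / u $ i) \<cdot>\<^sub>v w"
    have "v \<in> carrier_vec n" unfolding v_def by (rule carrier_vecI) simp
    moreover have "p \<bullet> v = 1" using i(3) pw by (simp add: v_def)
    moreover have "X *\<^sub>v p = 0 \<cdot>\<^sub>v v" unfolding Xp v_def by (auto intro!: eq_vecI)
    moreover have "Y *\<^sub>v v = 0 \<cdot>\<^sub>v p" unfolding v_def by (simp add: dim_mat_vec w(3)) (auto intro!: eq_vecI)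
    ultimately show ?thesis using p by blast
  next
    case False
    \<comment> \<open>Where \<open>d i = 0\<close> also \<open>u $ i = 0\<close>, so
      \<open>d i * c $ i = u $ i\<close> holds there whatever the quotient is.\<close>
    define c where "c = vec n (\<lambda>i. u $ i / d i)"
    have c: "c \<in> carrier_vec n" by (simp add: c_def)
    define q where "q = T *\<^sub>v c"
    have q: "q \<in> carrier_vec n" unfolding q_def by (rule carrier_vecI) simp
    note [simp] = carrier_vecD[OF q]
    have "diag_of n d *\<^sub>v c = u"
      unfolding dc[OF c] using False u by (auto simp: c_def intro!: eq_vecI)
    hence Xq: "X *\<^sub>v q = w" unfolding q_def XT[OF c] by (simp add: Su)
    have qw: "q \<bullet> w \<noteq> 0"
    proof
      assume "q \<bullet> w = 0"
      hence "X *\<^sub>v q = 0\<^sub>v n" using Xq by (intro psd_null[OF X q]) simp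
      with Xq w(2) show False by simp
    qed
    define p where "p = (1 / (q \<bullet> w)) \<cdot>\<^sub>v q"
    have p: "p \<in> carrier_vec n" unfolding p_def by (rule carrier_vecI) simp
    have "p \<bullet> w = 1" using qw by (simp add: p_def)
    moreover have "X *\<^sub>v p = (1 / (q \<bullet> w)) \<cdot>\<^sub>v w" by (simp add: p_def dim_mat_vec Xq)
    moreover have "Y *\<^sub>v w = 0 \<cdot>\<^sub>v p" unfolding w(3) using p by (auto intro!: eq_vecI)
    ultimately show ?thesis using w(1) p by blast
  qed
qed

lemma contragredient_diagonalization:
  assumes X: "psd_mat n X" and Y: "psd_mat n Y"
  obtains S T a b where "S \<in> carrier_mat n n" "T \<in> carrier_mat n n" "S * T = 1\<^sub>m n" "T * S = 1\<^sub>m n"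
    "S * X * S\<^sup>T = diag_of n a" "T\<^sup>T * Y * T = diag_of n b" "\<And>i. i < n \<Longrightarrow> 0 \<le> a i" "\<And>i. i < n \<Longrightarrow> 0 \<le> b i"
proof -
  have "\<exists>S T a b. S \<in> carrier_mat n n \<and> T \<in> carrier_mat n n \<and> S * T = 1\<^sub>m n \<and> T * S = 1\<^sub>m n \<and>
    S * X * S\<^sup>T = diag_of n a \<and> T\<^sup>T * Y * T = diag_of n b \<and> (\<forall>i<n. 0 \<le> a i \<and> 0 \<le> b i)"
    by (rule contragredient_diagonalization_induct[where ok = "\<lambda>_ _. True", OF contragredient_pair _ X Y]) simp_all
  thus ?thesis using that by blast
qed

section \<open>Sorting and rescaling\<close>

definition permute_scale_rows :: "(nat \<Rightarrow> 'a) \<Rightarrow> (nat \<Rightarrow> nat) \<Rightarrow> 'a::times mat \<Rightarrow> 'a mat" where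
  "permute_scale_rows c \<pi> S = mat (dim_row S) (dim_col S) (\<lambda>(i,j). c i * S $$ (\<pi> i, j))"

lemma permute_scale_rows_dim [simp]:
  "dim_row (permute_scale_rows c \<pi> S) = dim_row S" "dim_col (permute_scale_rows c \<pi> S) = dim_col S"
  by (simp_all add: permute_scale_rows_def)

lemma permute_scale_rows_mult:
  fixes S K :: "'a::comm_semiring_0 mat"
  assumes "i < dim_row S" "\<pi> i < dim_row S" "j < dim_col K" "dim_col S = dim_row K"
  shows "(permute_scale_rows c \<pi> S * K) $$ (i,j) = c i * (S * K) $$ (\<pi> i, j)"
  using assms by (simp add: permute_scale_rows_def scalar_prod_def sum_distrib_left mult.assoc)

text \<open>Allowing two matrices and two scalings lets one formula cover the product of the
  transformation with its inverse as well as both congruences.\<close>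

lemma permute_scale_rows_congruence:
  fixes S K L :: "'a::comm_semiring_0 mat"
  assumes S: "S \<in> carrier_mat n n" and K: "K \<in> carrier_mat n n" and L: "L \<in> carrier_mat n n"
    and i: "i < n" "\<pi> i < n" and j: "j < n" "\<pi> j < n"
  shows "(permute_scale_rows c \<pi> S * K * (permute_scale_rows e \<pi> L)\<^sup>T) $$ (i,j) =
    c i * e j * (S * K * L\<^sup>T) $$ (\<pi> i, \<pi> j)"
proof -
  note [simp] = carrier_matD[OF S] carrier_matD[OF K] carrier_matD[OF L]
  let ?P = "permute_scale_rows c \<pi> S" and ?R = "permute_scale_rows e \<pi> L"
  have "(?P * K * ?R\<^sup>T) $$ (i,j) = c i * (S * (K * ?R\<^sup>T)) $$ (\<pi> i, j)"
    using i j by (simp add: dim_assoc_mult_mat permute_scale_rows_mult del: index_mult_mat(1))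
  also have "(S * (K * ?R\<^sup>T)) $$ (\<pi> i, j) = (S * (K * ?R\<^sup>T))\<^sup>T $$ (j, \<pi> i)"
    using i j by (simp del: index_mult_mat(1))
  also have "(S * (K * ?R\<^sup>T))\<^sup>T = ?R * (K\<^sup>T * S\<^sup>T)" by (simp add: dim_mat_ring)
  also have "\<dots> $$ (j, \<pi> i) = e j * (L * (K\<^sup>T * S\<^sup>T)) $$ (\<pi> j, \<pi> i)"
    using i j by (simp add: permute_scale_rows_mult del: index_mult_mat(1))
  also have "L * (K\<^sup>T * S\<^sup>T) = (S * K * L\<^sup>T)\<^sup>T" by (simp add: dim_mat_ring)
  also have "\<dots> $$ (\<pi> j, \<pi> i) = (S * K * L\<^sup>T) $$ (\<pi> i, \<pi> j)"
    using i j by (simp del: index_mult_mat(1))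
  finally show ?thesis by (simp add: mult.assoc)
qed

text \<open>The four groups are the sign patterns of the pairs \<open>(a i, b i)\<close>; they
  become the first four diagonal blocks of the balanced form.\<close>

lemma balanced_permutation:
  fixes a b :: "nat \<Rightarrow> real"
  assumes nn: "\<And>i. i < n \<Longrightarrow> 0 \<le> a i" "\<And>i. i < n \<Longrightarrow> 0 \<le> b i"
  obtains \<pi> k k2 k3 k4 where "k + k2 + k3 + k4 = n" "\<And>i. i < n \<Longrightarrow> \<pi> i < n" "inj_on \<pi> {..<n}"
    "\<And>i. i < k \<Longrightarrow> 0 < a (\<pi> i) \<and> 0 < b (\<pi> i)"
    "\<And>i j. i \<le> j \<Longrightarrow> j < k \<Longrightarrow> a (\<pi> j) * b (\<pi> j) \<le> a (\<pi> i) * b (\<pi> i)"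
    "\<And>i. k \<le> i \<Longrightarrow> i < k + k2 \<Longrightarrow> 0 < a (\<pi> i) \<and> b (\<pi> i) = 0"
    "\<And>i. k + k2 \<le> i \<Longrightarrow> i < k + k2 + k3 \<Longrightarrow> a (\<pi> i) = 0 \<and> 0 < b (\<pi> i)"
    "\<And>i. k + k2 + k3 \<le> i \<Longrightarrow> i < n \<Longrightarrow> a (\<pi> i) = 0 \<and> b (\<pi> i) = 0"
proof -
  \<comment> \<open>The product \<open>a i * b i\<close> is the square of the later
    \<open>\<sigma>\<close>, so the order can be fixed before scaling. The minus sign makes it
    decreasing.\<close>
  define A where "A = sort_key (\<lambda>i. - (a i * b i)) (filter (\<lambda>i. 0 < a i \<and> 0 < b i) [0..<n])"
  define B where "B = filter (\<lambda>i. 0 < a i \<and> b i = 0) [0..<n]"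
  define C where "C = filter (\<lambda>i. a i = 0 \<and> 0 < b i) [0..<n]"
  define D where "D = filter (\<lambda>i. a i = 0 \<and> b i = 0) [0..<n]"
  define xs where "xs = A @ B @ C @ D"
  have setA: "set A = {i. i < n \<and> 0 < a i \<and> 0 < b i}" by (auto simp: A_def)
  have setB: "set B = {i. i < n \<and> 0 < a i \<and> b i = 0}" by (auto simp: B_def)
  have setC: "set C = {i. i < n \<and> a i = 0 \<and> 0 < b i}" by (auto simp: C_def)
  have setD: "set D = {i. i < n \<and> a i = 0 \<and> b i = 0}" by (auto simp: D_def)
  have dist: "distinct xs"
    unfolding xs_def distinct_append set_append setA setB setC setD
    by (auto simp: A_def B_def C_def D_def)
  have "set xs = {..<n}"
    unfolding xs_def set_append setA setB setC setD using nn by (force simp: order.order_iff_strict)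
  hence len: "length xs = n" using distinct_card[OF dist] by simp
  define k where "k = length A"
  define k2 where "k2 = length B"
  define k3 where "k3 = length C"
  define k4 where "k4 = length D"
  define \<pi> where "\<pi> i = xs ! i" for i
  show ?thesis
  proof (rule that[of k k2 k3 k4 \<pi>])
    show sum: "k + k2 + k3 + k4 = n" using len by (simp add: xs_def k_def k2_def k3_def k4_def)
    show "\<pi> i < n" if "i < n" for i
      using that len \<open>set xs = {..<n}\<close> nth_mem[of i xs] by (auto simp: \<pi>_def)
    show "inj_on \<pi> {..<n}"
      using dist len by (auto simp: \<pi>_def inj_on_def nth_eq_iff_index_eq)
    have piA: "\<pi> i = A ! i" if "i < k" for i using that by (simp add: \<pi>_def xs_def k_def nth_append)
    show "0 < a (\<pi> i) \<and> 0 < b (\<pi> i)" if "i < k" for i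
      using that nth_mem[of i A] setA by (simp add: piA k_def)
    show "a (\<pi> j) * b (\<pi> j) \<le> a (\<pi> i) * b (\<pi> i)" if "i \<le> j" "j < k" for i j
    proof -
      have "sorted (map (\<lambda>i. - (a i * b i)) A)" by (simp add: A_def)
      from sorted_nth_mono[OF this that(1)] that show ?thesis by (simp add: piA k_def)
    qed
    show "0 < a (\<pi> i) \<and> b (\<pi> i) = 0" if "k \<le> i" "i < k + k2" for i
    proof -
      have "\<pi> i = B ! (i - k)" using that by (auto simp: \<pi>_def xs_def k_def k2_def nth_append)
      moreover have "i - k < length B" using that by (simp add: k2_def)
      ultimately show ?thesis using nth_mem[of "i - k" B] setB by simp
    qed
    show "a (\<pi> i) = 0 \<and> 0 < b (\<pi> i)" if "k + k2 \<le> i" "i < k + k2 + k3" for i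
    proof -
      have "\<pi> i = C ! (i - k - k2)" using that by (auto simp: \<pi>_def xs_def k_def k2_def k3_def nth_append)
      moreover have "i - k - k2 < length C" using that by (simp add: k3_def)
      ultimately show ?thesis using nth_mem[of "i - k - k2" C] setC by simp
    qed
    show "a (\<pi> i) = 0 \<and> b (\<pi> i) = 0" if "k + k2 + k3 \<le> i" "i < n" for i
    proof -
      have "\<pi> i = D ! (i - k - k2 - k3)" using that by (auto simp: \<pi>_def xs_def k_def k2_def k3_def nth_append)
      moreover have "i - k - k2 - k3 < length D" using that sum by (simp add: k4_def)
      ultimately show ?thesis using nth_mem[of "i - k - k2 - k3" D] setD by simp
    qed
  qed
qed

lemma balanced_contragredient_diagonalization:
  assumes X: "psd_mat n X" and Y: "psd_mat n Y"
  obtains S T k k2 k3 k4 \<sigma> s2 s3 where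
    "S \<in> carrier_mat n n" "T \<in> carrier_mat n n" "S * T = 1\<^sub>m n" "T * S = 1\<^sub>m n"
    "k + k2 + k3 + k4 = n" "\<And>i j. i \<le> j \<Longrightarrow> j < k \<Longrightarrow> \<sigma> j \<le> \<sigma> i" "\<And>i. i < k \<Longrightarrow> 0 < (\<sigma> i :: real)"
    "\<And>i. i < k2 \<Longrightarrow> 0 < (s2 i :: real)" "\<And>i. i < k3 \<Longrightarrow> 0 < (s3 i :: real)"
    "S * X * S\<^sup>T = diag_of n (\<lambda>i. if i < k then \<sigma> i else if i < k + k2 then s2 (i - k) else 0)"
    "T\<^sup>T * Y * T = diag_of n (\<lambda>i. if i < k then \<sigma> i else if i < k + k2 then 0
        else if i < k + k2 + k3 then s3 (i - k - k2) else 0)"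
proof -
  from contragredient_diagonalization[OF X Y] obtain S T a b where
    S: "S \<in> carrier_mat n n" and T: "T \<in> carrier_mat n n" and ST: "S * T = 1\<^sub>m n" "T * S = 1\<^sub>m n"
    and SX: "S * X * S\<^sup>T = diag_of n a" and TY: "T\<^sup>T * Y * T = diag_of n b"
    and nn: "\<And>i. i < n \<Longrightarrow> 0 \<le> a i" "\<And>i. i < n \<Longrightarrow> 0 \<le> b i" by blast
  obtain \<pi> k k2 k3 k4 where
    ks: "k + k2 + k3 + k4 = n" and \<pi>: "\<And>i. i < n \<Longrightarrow> \<pi> i < n" and inj: "inj_on \<pi> {..<n}"
    and p1: "\<And>i. i < k \<Longrightarrow> 0 < a (\<pi> i) \<and> 0 < b (\<pi> i)"
    and dec: "\<And>i j. i \<le> j \<Longrightarrow> j < k \<Longrightarrow> a (\<pi> j) * b (\<pi> j) \<le> a (\<pi> i) * b (\<pi> i)"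
    and p2: "\<And>i. k \<le> i \<Longrightarrow> i < k + k2 \<Longrightarrow> 0 < a (\<pi> i) \<and> b (\<pi> i) = 0"
    and p3: "\<And>i. k + k2 \<le> i \<Longrightarrow> i < k + k2 + k3 \<Longrightarrow> a (\<pi> i) = 0 \<and> 0 < b (\<pi> i)"
    and p4: "\<And>i. k + k2 + k3 \<le> i \<Longrightarrow> i < n \<Longrightarrow> a (\<pi> i) = 0 \<and> b (\<pi> i) = 0"
    by (rule balanced_permutation[where a = a and b = b and n = n, OF nn]) (assumption | rule that)+
  note [simp] = carrier_matD[OF S] carrier_matD[OF T] carrier_matD[OF psd_matD(1)[OF X]] carrier_matD[OF psd_matD(1)[OF Y]]
  \<comment> \<open>The fourth root of \<open>b / a\<close> balances the two values:
    \<open>c * c * a\<close> and \<open>b / (c * c)\<close> both become the square root of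
    \<open>a * b\<close>. Outside the common block one value is zero and no scaling is
    applied.\<close>
  define c where "c i = (if i < k then sqrt (sqrt (b (\<pi> i) / a (\<pi> i))) else 1)" for i
  define \<sigma> where "\<sigma> i = sqrt (a (\<pi> i) * b (\<pi> i))" for i
  define s2 where "s2 i = a (\<pi> (k + i))" for i
  define s3 where "s3 i = b (\<pi> (k + k2 + i))" for i
  have c0: "c i > 0" for i using p1[of i] by (simp add: c_def)
  have cc: "c i * c i = sqrt (b (\<pi> i) / a (\<pi> i))" if "i < k" for i
    using that p1[of i] by (simp add: c_def)
  have ca: "c i * c i * a (\<pi> i) = \<sigma> i" if "i < k" for i
  proof -
    have "sqrt (b (\<pi> i) / a (\<pi> i)) * a (\<pi> i) = sqrt (b (\<pi> i)) / sqrt (a (\<pi> i)) * (sqrt (a (\<pi> i)) * sqrt (a (\<pi> i)))"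
      using p1[OF that] by (simp add: real_sqrt_divide)
    also have "\<dots> = sqrt (a (\<pi> i)) * sqrt (b (\<pi> i))" using p1[OF that] by (simp add: field_simps)
    finally show ?thesis by (simp add: cc[OF that] \<sigma>_def real_sqrt_mult)
  qed
  have cb: "1 / c i * (1 / c i) * b (\<pi> i) = \<sigma> i" if "i < k" for i
  proof -
    have "1 / c i * (1 / c i) * b (\<pi> i) = b (\<pi> i) / sqrt (b (\<pi> i) / a (\<pi> i))"
      by (simp add: cc[OF that, symmetric])
    also have "\<dots> = (sqrt (b (\<pi> i)) * sqrt (b (\<pi> i))) / (sqrt (b (\<pi> i)) / sqrt (a (\<pi> i)))"
      using p1[OF that] by (simp add: real_sqrt_divide)
    also have "\<dots> = sqrt (a (\<pi> i)) * sqrt (b (\<pi> i))" using p1[OF that] by (simp add: field_simps)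
    finally show ?thesis by (simp add: \<sigma>_def real_sqrt_mult)
  qed
  have pieq: "\<pi> i = \<pi> j \<longleftrightarrow> i = j" if "i < n" "j < n" for i j
    using inj that by (auto simp: inj_on_def)
  define S1 where "S1 = permute_scale_rows c \<pi> S"
  define T1 where "T1 = (permute_scale_rows (\<lambda>i. 1 / c i) \<pi> T\<^sup>T)\<^sup>T"
  have Tt: "T\<^sup>T \<in> carrier_mat n n" using T by simp
  have S1: "S1 \<in> carrier_mat n n" unfolding S1_def by (rule carrier_matI) simp_all
  have T1: "T1 \<in> carrier_mat n n" unfolding T1_def by (rule carrier_matI) simp_all
  note [simp] = carrier_matD[OF S1] carrier_matD[OF T1]
  have i1: "S1 * T1 = 1\<^sub>m n"
  proof (rule eq_matI)
    fix i j assume "i < dim_row (1\<^sub>m n :: real mat)" "j < dim_col (1\<^sub>m n :: real mat)"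
    hence ij: "i < n" "j < n" by simp_all
    have "(S1 * 1\<^sub>m n * T1) $$ (i,j) = c i * (1 / c j) * (S * 1\<^sub>m n * (T\<^sup>T)\<^sup>T) $$ (\<pi> i, \<pi> j)"
      unfolding S1_def T1_def by (rule permute_scale_rows_congruence[OF S one_carrier_mat Tt ij(1) \<pi>[OF ij(1)] ij(2) \<pi>[OF ij(2)]])
    also have "\<dots> = 1\<^sub>m n $$ (i,j)"
      using ij \<pi>[OF ij(1)] \<pi>[OF ij(2)] c0[of i] c0[of j] pieq[OF ij] by (simp add: dim_mat_ring ST)
    finally show "(S1 * T1) $$ (i,j) = 1\<^sub>m n $$ (i,j)" by (simp add: dim_mat_ring del: index_mult_mat(1))
  qed simp_all
  have i2: "T1 * S1 = 1\<^sub>m n" by (rule mat_mult_left_right_inverse[OF S1 T1 i1])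
  have e1: "S1 * X * S1\<^sup>T = diag_of n (\<lambda>i. if i < k then \<sigma> i else if i < k + k2 then s2 (i - k) else 0)"
  proof (rule eq_matI)
    let ?f = "\<lambda>i. if i < k then \<sigma> i else if i < k + k2 then s2 (i - k) else 0"
    fix i j assume "i < dim_row (diag_of n ?f)" "j < dim_col (diag_of n ?f)"
    hence ij: "i < n" "j < n" by simp_all
    have "(S1 * X * S1\<^sup>T) $$ (i,j) = c i * c j * (S * X * S\<^sup>T) $$ (\<pi> i, \<pi> j)"
      unfolding S1_def by (rule permute_scale_rows_congruence[OF S psd_matD(1)[OF X] S ij(1) \<pi>[OF ij(1)] ij(2) \<pi>[OF ij(2)]])
    also have "\<dots> = (if i = j then c i * c i * a (\<pi> i) else 0)"
      unfolding SX using \<pi>[OF ij(1)] \<pi>[OF ij(2)] pieq[OF ij] by (simp add: diag_of_def)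
    also have "c i * c i * a (\<pi> i) = ?f i"
      using ca[of i] p2[of i] p3[of i] p4[of i] ij
      by (cases "i < k + k2 + k3") (auto simp: c_def s2_def not_less)
    finally show "(S1 * X * S1\<^sup>T) $$ (i,j) = diag_of n ?f $$ (i,j)" using ij by (simp add: diag_of_def)
  qed simp_all
  have e2: "T1\<^sup>T * Y * T1 = diag_of n (\<lambda>i. if i < k then \<sigma> i else if i < k + k2 then 0
        else if i < k + k2 + k3 then s3 (i - k - k2) else 0)"
  proof (rule eq_matI)
    let ?f = "\<lambda>i. if i < k then \<sigma> i else if i < k + k2 then 0 else if i < k + k2 + k3 then s3 (i - k - k2) else 0"
    fix i j assume "i < dim_row (diag_of n ?f)" "j < dim_col (diag_of n ?f)"
    hence ij: "i < n" "j < n" by simp_all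
    have "(T1\<^sup>T * Y * (T1\<^sup>T)\<^sup>T) $$ (i,j) = 1 / c i * (1 / c j) * (T\<^sup>T * Y * (T\<^sup>T)\<^sup>T) $$ (\<pi> i, \<pi> j)"
      unfolding T1_def transpose_transpose
      by (rule permute_scale_rows_congruence[OF Tt psd_matD(1)[OF Y] Tt ij(1) \<pi>[OF ij(1)] ij(2) \<pi>[OF ij(2)], unfolded transpose_transpose])
    also have "\<dots> = (if i = j then 1 / c i * (1 / c i) * b (\<pi> i) else 0)"
      unfolding transpose_transpose TY using \<pi>[OF ij(1)] \<pi>[OF ij(2)] pieq[OF ij] by (simp add: diag_of_def)
    also have "1 / c i * (1 / c i) * b (\<pi> i) = ?f i"
    proof (cases "i < k")
      case True
      thus ?thesis using cb[of i] by simp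
    next
      case False
      thus ?thesis using p2[of i] p3[of i] p4[of i] ij
        by (cases "i < k + k2 + k3") (auto simp: c_def s3_def not_less)
    qed
    finally show "(T1\<^sup>T * Y * T1) $$ (i,j) = diag_of n ?f $$ (i,j)" using ij by (simp add: diag_of_def)
  qed simp_all
  show ?thesis
  proof (rule that[OF S1 T1 i1 i2 ks _ _ _ _ e1 e2])
    show "\<sigma> j \<le> \<sigma> i" if "i \<le> j" "j < k" for i j using dec[OF that] by (simp add: \<sigma>_def)
    show "0 < \<sigma> i" if "i < k" for i using p1[OF that] by (simp add: \<sigma>_def)
    show "0 < s2 i" if "i < k2" for i using p2[of "k + i"] that by (simp add: s2_def)
    show "0 < s3 i" if "i < k3" for i using p3[of "k + k2 + i"] that by (simp add: s3_def)
  qed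
qed

section \<open>Equivalence transformations\<close>

lemma invertible_mat_mult:
  fixes A B :: "'a::field mat"
  assumes A: "A \<in> carrier_mat n n" "invertible_mat A" and B: "B \<in> carrier_mat n n" "invertible_mat B"
  shows "invertible_mat (A * B)"
proof -
  from invertible_mat_obtain[OF A(2,1)] obtain Ai where Ai: "Ai \<in> carrier_mat n n" "A * Ai = 1\<^sub>m n" by blast
  from invertible_mat_obtain[OF B(2,1)] obtain Bi where Bi: "Bi \<in> carrier_mat n n" "B * Bi = 1\<^sub>m n" by blast
  have "det (A * B) \<noteq> 0"
    using det_mult[OF A(1) B(1)] det_inverse_nonzero[OF A(1) Ai] det_inverse_nonzero[OF B(1) Bi] by simp
  thus ?thesis by (rule det_nonzero_imp_invertible_mat[OF mult_carrier_mat[OF A(1) B(1)]])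
qed

lemma invertible_mat_transpose:
  fixes A :: "'a::field mat"
  assumes A: "A \<in> carrier_mat n n" "invertible_mat A"
  shows "invertible_mat A\<^sup>T"
proof -
  from invertible_mat_obtain[OF A(2,1)] obtain Ai where Ai: "Ai \<in> carrier_mat n n" "A * Ai = 1\<^sub>m n" by blast
  have "det A\<^sup>T \<noteq> 0" using det_transpose[OF A(1)] det_inverse_nonzero[OF A(1) Ai] by simp
  thus ?thesis using A(1) by (intro det_nonzero_imp_invertible_mat[of _ n]) simp_all
qed

lemma stable_pencil_transpose:
  assumes E: "E \<in> carrier_mat n n" and A: "A \<in> carrier_mat n n" and st: "stable_pencil n E A"
  shows "stable_pencil n E\<^sup>T A\<^sup>T"
proof -
  note [simp] = carrier_matD[OF E] carrier_matD[OF A]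
  have d: "det (z \<cdot>\<^sub>m cmat E\<^sup>T - cmat A\<^sup>T) = det (z \<cdot>\<^sub>m cmat E - cmat A)" for z
  proof -
    have "z \<cdot>\<^sub>m cmat E - cmat A \<in> carrier_mat n n" by (rule carrier_matI) simp_all
    moreover have "z \<cdot>\<^sub>m cmat E\<^sup>T - cmat A\<^sup>T = (z \<cdot>\<^sub>m cmat E - cmat A)\<^sup>T"
      by (simp add: cmat_transpose dim_mat_ring)
    ultimately show ?thesis using det_transpose by metis
  qed
  from st obtain U V F q where U: "U \<in> carrier_mat n n" "invertible_mat U" and
    V: "V \<in> carrier_mat n n" "invertible_mat V" and q: "q \<le> n" and F: "F \<in> carrier_mat q q" and
    UEV: "U * E * V = four_block_mat (1\<^sub>m q) (0\<^sub>m q (n - q)) (0\<^sub>m (n - q) q) (0\<^sub>m (n - q) (n - q))" and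
    UAV: "U * A * V = four_block_mat F (0\<^sub>m q (n - q)) (0\<^sub>m (n - q) q) (1\<^sub>m (n - q))"
    unfolding stable_pencil_def impulse_free_def by blast
  note [simp] = carrier_matD[OF U(1)] carrier_matD[OF V(1)]
  have "V\<^sup>T * E\<^sup>T * U\<^sup>T = (U * E * V)\<^sup>T" by (simp add: dim_mat_ring)
  also have "\<dots> = four_block_mat (1\<^sub>m q) (0\<^sub>m q (n - q)) (0\<^sub>m (n - q) q) (0\<^sub>m (n - q) (n - q))"
    unfolding UEV by (subst transpose_four_block_mat[OF one_carrier_mat zero_carrier_mat zero_carrier_mat zero_carrier_mat]) simp
  finally have e1: "V\<^sup>T * E\<^sup>T * U\<^sup>T = four_block_mat (1\<^sub>m q) (0\<^sub>m q (n - q)) (0\<^sub>m (n - q) q) (0\<^sub>m (n - q) (n - q))" .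
  have "V\<^sup>T * A\<^sup>T * U\<^sup>T = (U * A * V)\<^sup>T" by (simp add: dim_mat_ring)
  also have "\<dots> = four_block_mat F\<^sup>T (0\<^sub>m q (n - q)) (0\<^sub>m (n - q) q) (1\<^sub>m (n - q))"
    unfolding UAV by (subst transpose_four_block_mat[OF F zero_carrier_mat zero_carrier_mat one_carrier_mat]) simp
  finally have e2: "V\<^sup>T * A\<^sup>T * U\<^sup>T = four_block_mat F\<^sup>T (0\<^sub>m q (n - q)) (0\<^sub>m (n - q) q) (1\<^sub>m (n - q))" .
  have "impulse_free n E\<^sup>T A\<^sup>T" unfolding impulse_free_def
    using U V F q e1 e2 invertible_mat_transpose[OF U] invertible_mat_transpose[OF V]
    by (intro exI[of _ "V\<^sup>T"] exI[of _ "U\<^sup>T"] exI[of _ "F\<^sup>T"] exI[of _ q]) simp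
  thus ?thesis using st unfolding stable_pencil_def regular_pencil_def finite_eigenvalue_def d by blast
qed

text \<open>The determinant changes by a nonzero factor and the Weierstrass transformations compose.
  The direction is from the transformed pencil to the original one because solutions will be pulled
  back.\<close>

lemma stable_pencil_equivalence:
  assumes E: "E \<in> carrier_mat n n" and A: "A \<in> carrier_mat n n"
    and S: "S \<in> carrier_mat n n" and Si: "Si \<in> carrier_mat n n" and T: "T \<in> carrier_mat n n" and Ti: "Ti \<in> carrier_mat n n"
    and inv: "S * Si = 1\<^sub>m n" "Si * S = 1\<^sub>m n" "T * Ti = 1\<^sub>m n" "Ti * T = 1\<^sub>m n"
    and st: "stable_pencil n (S * E * Ti) (S * A * Ti)"
  shows "stable_pencil n E A"
proof -
  note [simp] = carrier_matD[OF E] carrier_matD[OF A] carrier_matD[OF S] carrier_matD[OF Ti]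
  have d: "det (z \<cdot>\<^sub>m cmat (S * E * Ti) - cmat (S * A * Ti)) = 0 \<longleftrightarrow> det (z \<cdot>\<^sub>m cmat E - cmat A) = 0" for z
  proof -
    let ?Z = "z \<cdot>\<^sub>m cmat E - cmat A"
    have Z: "?Z \<in> carrier_mat n n" by (rule carrier_matI) simp_all
    have cS: "cmat S \<in> carrier_mat n n" and cT: "cmat Ti \<in> carrier_mat n n" using S Ti by simp_all
    have sm: "cmat S * (z \<cdot>\<^sub>m X) = z \<cdot>\<^sub>m (cmat S * X)" "(z \<cdot>\<^sub>m X) * cmat Ti = z \<cdot>\<^sub>m (X * cmat Ti)"
      if "X \<in> carrier_mat n n" for X
      using mult_smult_distrib[OF cS that] mult_smult_assoc_mat[OF that cT] by auto
    have cE: "cmat E \<in> carrier_mat n n" "cmat E * cmat Ti \<in> carrier_mat n n" by (rule carrier_matI; simp)+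
    have "z \<cdot>\<^sub>m cmat (S * E * Ti) - cmat (S * A * Ti) = cmat S * (?Z * cmat Ti)"
      by (simp add: cmat_mult dim_mat_ring sm cE E)
    hence "det (z \<cdot>\<^sub>m cmat (S * E * Ti) - cmat (S * A * Ti)) = det (cmat S) * (det ?Z * det (cmat Ti))"
      using det_mult[OF cS mult_carrier_mat[OF Z cT]] det_mult[OF Z cT] by simp
    moreover have "det (cmat S) \<noteq> 0" "det (cmat Ti) \<noteq> 0"
      using det_inverse_nonzero(1)[OF S Si inv(1)] det_inverse_nonzero(1)[OF Ti T inv(4)] by (simp_all add: det_cmat)
    ultimately show ?thesis by simp
  qed
  have iS: "invertible_mat S" and iT: "invertible_mat Ti"
    using det_nonzero_imp_invertible_mat[OF S det_inverse_nonzero(1)[OF S Si inv(1)]]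
      det_nonzero_imp_invertible_mat[OF Ti det_inverse_nonzero(1)[OF Ti T inv(4)]] by blast+
  from st obtain U V F q where U: "U \<in> carrier_mat n n" "invertible_mat U" and
    V: "V \<in> carrier_mat n n" "invertible_mat V" and q: "q \<le> n" and F: "F \<in> carrier_mat q q" and
    UEV: "U * (S * E * Ti) * V = four_block_mat (1\<^sub>m q) (0\<^sub>m q (n - q)) (0\<^sub>m (n - q) q) (0\<^sub>m (n - q) (n - q))" and
    UAV: "U * (S * A * Ti) * V = four_block_mat F (0\<^sub>m q (n - q)) (0\<^sub>m (n - q) q) (1\<^sub>m (n - q))"
    unfolding stable_pencil_def impulse_free_def by blast
  note [simp] = carrier_matD[OF U(1)] carrier_matD[OF V(1)]
  have "(U * S) * E * (Ti * V) = U * (S * E * Ti) * V" "(U * S) * A * (Ti * V) = U * (S * A * Ti) * V"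
    by (simp_all add: dim_mat_ring)
  hence "impulse_free n E A" unfolding impulse_free_def
    using UEV UAV q F mult_carrier_mat[OF U(1) S] mult_carrier_mat[OF Ti V(1)]
      invertible_mat_mult[OF U S iS] invertible_mat_mult[OF Ti iT V]
    by (intro exI[of _ "U * S"] exI[of _ "Ti * V"] exI[of _ F] exI[of _ q]) simp
  thus ?thesis using st unfolding stable_pencil_def regular_pencil_def finite_eigenvalue_def d by blast
qed

text \<open>The common form of (GF), with \<open>N = C\<^sup>T C\<close> and \<open>W = B B\<^sup>T + 2 R\<close>, and of (GC), which arises for
  the transposed pencil, \<open>N = B B\<^sup>T\<close>, \<open>W = C\<^sup>T C\<close> and the transposed unknown.\<close>

definition stabilizing_riccati :: "nat \<Rightarrow> real mat \<Rightarrow> real mat \<Rightarrow> real mat \<Rightarrow> real mat \<Rightarrow> real mat \<Rightarrow> bool" where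
  "stabilizing_riccati n E A N W P \<longleftrightarrow> P \<in> carrier_mat n n \<and>
     A * P\<^sup>T + P * A\<^sup>T - P * N * P\<^sup>T + W = 0\<^sub>m n n \<and> E * P\<^sup>T = P * E\<^sup>T \<and> stable_pencil n E (A - P * N)"

lemma stab_sol_GF_riccati:
  assumes E: "E \<in> carrier_mat n n" and A: "A \<in> carrier_mat n n" and B: "B \<in> carrier_mat n m"
    and C: "C \<in> carrier_mat m n" and R: "R \<in> carrier_mat n n"
  shows "stab_sol_GF n E A B C R P \<longleftrightarrow> stabilizing_riccati n E A (C\<^sup>T * C) (B * B\<^sup>T + 2 \<cdot>\<^sub>m R) P"
proof (cases "P \<in> carrier_mat n n")
  case True
  note [simp] = carrier_matD[OF A] carrier_matD[OF B] carrier_matD[OF C] carrier_matD[OF R] carrier_matD[OF True]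
  have "A * P\<^sup>T + P * A\<^sup>T - P * C\<^sup>T * C * P\<^sup>T + B * B\<^sup>T + 2 \<cdot>\<^sub>m R
      = A * P\<^sup>T + P * A\<^sup>T - P * (C\<^sup>T * C) * P\<^sup>T + (B * B\<^sup>T + 2 \<cdot>\<^sub>m R)"
    by (rule eq_matI) (simp_all add: dim_mat_ring del: index_mult_mat(1))
  moreover have "A - P * C\<^sup>T * C = A - P * (C\<^sup>T * C)" by (simp add: dim_mat_ring)
  ultimately show ?thesis by (simp add: stab_sol_GF_def stabilizing_riccati_def)
qed (simp add: stab_sol_GF_def stabilizing_riccati_def)

lemma stab_sol_GC_riccati:
  assumes E: "E \<in> carrier_mat n n" and A: "A \<in> carrier_mat n n" and B: "B \<in> carrier_mat n m"
    and C: "C \<in> carrier_mat m n" and sol: "stab_sol_GC n E A B C P"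
  shows "stabilizing_riccati n E\<^sup>T A\<^sup>T (B * B\<^sup>T) (C\<^sup>T * C) P\<^sup>T"
proof -
  from sol have P: "P \<in> carrier_mat n n"
    and eq: "A\<^sup>T * P + P\<^sup>T * A - P\<^sup>T * B * B\<^sup>T * P + C\<^sup>T * C = 0\<^sub>m n n"
    and sym: "E\<^sup>T * P = P\<^sup>T * E" and st: "stable_pencil n E (A - B * B\<^sup>T * P)"
    by (auto simp: stab_sol_GC_def)
  note [simp] = carrier_matD[OF E] carrier_matD[OF A] carrier_matD[OF B] carrier_matD[OF C] carrier_matD[OF P]
  have "A - B * B\<^sup>T * P \<in> carrier_mat n n" by (rule carrier_matI) simp_all
  from stable_pencil_transpose[OF E this st] have "stable_pencil n E\<^sup>T (A\<^sup>T - P\<^sup>T * (B * B\<^sup>T))"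
    by (simp add: dim_mat_ring)
  moreover have "A\<^sup>T * P + P\<^sup>T * A - P\<^sup>T * (B * B\<^sup>T) * P + C\<^sup>T * C = 0\<^sub>m n n"
    using eq by (simp add: dim_mat_ring)
  ultimately show ?thesis using P sym by (simp add: stabilizing_riccati_def)
qed

text \<open>Solutions are pulled back to the original system, where uniqueness is applied. The
  product with \<open>E\<^sup>T\<close> then returns through a congruence by \<open>S\<close> in
  which \<open>T\<close> no longer occurs.\<close>

lemma stabilizing_riccati_transform:
  assumes E: "E \<in> carrier_mat n n" and A: "A \<in> carrier_mat n n" and N: "N \<in> carrier_mat n n" and W: "W \<in> carrier_mat n n"
    and S: "S \<in> carrier_mat n n" and Si: "Si \<in> carrier_mat n n" and T: "T \<in> carrier_mat n n" and Ti: "Ti \<in> carrier_mat n n"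
    and inv: "S * Si = 1\<^sub>m n" "Si * S = 1\<^sub>m n" "T * Ti = 1\<^sub>m n" "Ti * T = 1\<^sub>m n"
    and sol: "stabilizing_riccati n (S * E * Ti) (S * A * Ti) (Ti\<^sup>T * N * Ti) (S * W * S\<^sup>T) P"
  shows "stabilizing_riccati n E A N W (Si * P * Ti\<^sup>T)"
    and "P * (S * E * Ti)\<^sup>T = S * ((Si * P * Ti\<^sup>T) * E\<^sup>T) * S\<^sup>T"
proof -
  from sol have P: "P \<in> carrier_mat n n"
    and eq: "S * A * Ti * P\<^sup>T + P * (S * A * Ti)\<^sup>T - P * (Ti\<^sup>T * N * Ti) * P\<^sup>T + S * W * S\<^sup>T = 0\<^sub>m n n"
    and sym: "S * E * Ti * P\<^sup>T = P * (S * E * Ti)\<^sup>T" and st: "stable_pencil n (S * E * Ti) (S * A * Ti - P * (Ti\<^sup>T * N * Ti))"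
    unfolding stabilizing_riccati_def by blast+
  note [simp] = carrier_matD[OF E] carrier_matD[OF A] carrier_matD[OF N] carrier_matD[OF W]
    carrier_matD[OF S] carrier_matD[OF Si] carrier_matD[OF T] carrier_matD[OF Ti] carrier_matD[OF P]
  have c1: "Si * (S * X) = X" if "dim_row X = n" for X by (rule mat_inverse_cancel[OF Si S inv(2) that])
  have c2: "S * (Si * X) = X" if "dim_row X = n" for X by (rule mat_inverse_cancel[OF S Si inv(1) that])
  have SSt: "S\<^sup>T * Si\<^sup>T = 1\<^sub>m n" using arg_cong[OF inv(2), of transpose_mat] by (simp add: dim_mat_ring)
  define P' where "P' = Si * P * Ti\<^sup>T"
  have P': "P' \<in> carrier_mat n n" unfolding P'_def by (rule carrier_matI) simp_all
  have [simp]: "dim_row P' = n" "dim_col P' = n" by (simp_all add: P'_def)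
  have "A * P'\<^sup>T + P' * A\<^sup>T - P' * N * P'\<^sup>T + W
     = Si * (S * A * Ti * P\<^sup>T + P * (S * A * Ti)\<^sup>T - P * (Ti\<^sup>T * N * Ti) * P\<^sup>T + S * W * S\<^sup>T) * Si\<^sup>T"
    by (simp add: P'_def dim_mat_ring c1 SSt)
  also have "\<dots> = 0\<^sub>m n n" unfolding eq by (simp add: dim_mult_zero_mat dim_zero_mult_mat)
  finally have 1: "A * P'\<^sup>T + P' * A\<^sup>T - P' * N * P'\<^sup>T + W = 0\<^sub>m n n" .
  have "E * P'\<^sup>T = Si * (S * E * Ti * P\<^sup>T) * Si\<^sup>T" by (simp add: P'_def dim_mat_ring c1)
  also have "\<dots> = P' * E\<^sup>T" unfolding sym by (simp add: P'_def dim_mat_ring SSt)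
  finally have 2: "E * P'\<^sup>T = P' * E\<^sup>T" .
  have "S * A * Ti - P * (Ti\<^sup>T * N * Ti) = S * (A - P' * N) * Ti"
    by (simp add: P'_def dim_mat_ring c2)
  with st have st': "stable_pencil n (S * E * Ti) (S * (A - P' * N) * Ti)" by simp
  have "A - P' * N \<in> carrier_mat n n" by (rule carrier_matI) simp_all
  from stable_pencil_equivalence[OF E this S Si T Ti inv st'] have 3: "stable_pencil n E (A - P' * N)" .
  show "stabilizing_riccati n E A N W (Si * P * Ti\<^sup>T)"
    unfolding stabilizing_riccati_def P'_def[symmetric] using P' 1 2 3 by blast
  show "P * (S * E * Ti)\<^sup>T = S * ((Si * P * Ti\<^sup>T) * E\<^sup>T) * S\<^sup>T" by (simp add: dim_mat_ring c2)
qed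

lemma pH_system_transform:
  assumes pH: "pH_system n m E J R Q B"
    and S: "S \<in> carrier_mat n n" and Si: "Si \<in> carrier_mat n n" and T: "T \<in> carrier_mat n n" and Ti: "Ti \<in> carrier_mat n n"
    and inv: "S * Si = 1\<^sub>m n" "Si * S = 1\<^sub>m n" "T * Ti = 1\<^sub>m n" "Ti * T = 1\<^sub>m n"
  shows "pH_system n m (S * E * Ti) (S * J * S\<^sup>T) (S * R * S\<^sup>T) (Si\<^sup>T * Q * Ti) (S * B)"
    and "(S * J * S\<^sup>T - S * R * S\<^sup>T) * (Si\<^sup>T * Q * Ti) = S * ((J - R) * Q) * Ti"
    and "(S * B)\<^sup>T * (Si\<^sup>T * Q * Ti) = B\<^sup>T * Q * Ti"
proof -
  from pH have E: "E \<in> carrier_mat n n" and J: "J \<in> carrier_mat n n" "J\<^sup>T = - J" and R: "psd_mat n R"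
    and Q: "Q \<in> carrier_mat n n" and B: "B \<in> carrier_mat n m" and EQ: "E\<^sup>T * Q = Q\<^sup>T * E" "psd_mat n (E\<^sup>T * Q)"
    by (auto simp: pH_system_def)
  note [simp] = carrier_matD[OF E] carrier_matD[OF J(1)] carrier_matD[OF psd_matD(1)[OF R]] carrier_matD[OF Q] carrier_matD[OF B]
    carrier_matD[OF S] carrier_matD[OF Si] carrier_matD[OF T] carrier_matD[OF Ti]
  have SSt: "S\<^sup>T * Si\<^sup>T = 1\<^sub>m n" using arg_cong[OF inv(2), of transpose_mat] by (simp add: dim_mat_ring)
  have c1: "S\<^sup>T * (Si\<^sup>T * X) = X" if "dim_row X = n" for X
    by (rule mat_inverse_cancel[OF _ _ SSt that]) (use S Si in simp_all)
  have c2: "Si * (S * X) = X" if "dim_row X = n" for X by (rule mat_inverse_cancel[OF Si S inv(2) that])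
  show "(S * J * S\<^sup>T - S * R * S\<^sup>T) * (Si\<^sup>T * Q * Ti) = S * ((J - R) * Q) * Ti"
    by (simp add: dim_mat_ring c1)
  show "(S * B)\<^sup>T * (Si\<^sup>T * Q * Ti) = B\<^sup>T * Q * Ti" by (simp add: dim_mat_ring c1)
  have e1: "(S * E * Ti)\<^sup>T * (Si\<^sup>T * Q * Ti) = Ti\<^sup>T * (E\<^sup>T * Q) * (Ti\<^sup>T)\<^sup>T" by (simp add: dim_mat_ring c1)
  have e2: "(Si\<^sup>T * Q * Ti)\<^sup>T * (S * E * Ti) = Ti\<^sup>T * (Q\<^sup>T * E) * (Ti\<^sup>T)\<^sup>T" by (simp add: dim_mat_ring c2)
  have "psd_mat n (Ti\<^sup>T * (E\<^sup>T * Q) * (Ti\<^sup>T)\<^sup>T)" by (rule psd_congruence[OF EQ(2)]) (use Ti in simp)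
  moreover have "psd_mat n (S * R * S\<^sup>T)" by (rule psd_congruence[OF R S])
  moreover have "(S * J * S\<^sup>T)\<^sup>T = - (S * J * S\<^sup>T)"
  proof -
    have "(S * J * S\<^sup>T)\<^sup>T = S * (- J * S\<^sup>T)" by (simp add: dim_mat_ring J(2))
    also have "- J * S\<^sup>T = - (J * S\<^sup>T)" by (simp add: dim_uminus_mult_mat)
    also have "S * - (J * S\<^sup>T) = - (S * (J * S\<^sup>T))" by (rule eq_matI) (auto simp: scalar_prod_def sum_negf)
    finally show ?thesis by (simp add: dim_mat_ring)
  qed
  moreover have "S * E * Ti \<in> carrier_mat n n" "S * J * S\<^sup>T \<in> carrier_mat n n" "S * R * S\<^sup>T \<in> carrier_mat n n"
    "Si\<^sup>T * Q * Ti \<in> carrier_mat n n" "S * B \<in> carrier_mat n m" by (rule carrier_matI; simp)+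
  ultimately show "pH_system n m (S * E * Ti) (S * J * S\<^sup>T) (S * R * S\<^sup>T) (Si\<^sup>T * Q * Ti) (S * B)"
    unfolding pH_system_def e1 e2 EQ(1) by simp
qed

lemma output_kernel_trivial_transform:
  assumes E: "E \<in> carrier_mat n n" and A: "A \<in> carrier_mat n n" and C: "C \<in> carrier_mat m n"
    and S: "S \<in> carrier_mat n n" and Si: "Si \<in> carrier_mat n n" and T: "T \<in> carrier_mat n n" and Ti: "Ti \<in> carrier_mat n n"
    and inv: "S * Si = 1\<^sub>m n" "Si * S = 1\<^sub>m n" "T * Ti = 1\<^sub>m n" "Ti * T = 1\<^sub>m n"
    and ok: "output_kernel_trivial n E A C"
  shows "output_kernel_trivial n (S * E * Ti) (S * A * Ti) (C * Ti)"
proof -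
  note [simp] = carrier_matD[OF E] carrier_matD[OF A] carrier_matD[OF C]
    carrier_matD[OF S] carrier_matD[OF Si] carrier_matD[OF T] carrier_matD[OF Ti]
  have Sinj: "x = y" if "S *\<^sub>v x = S *\<^sub>v y" "x \<in> carrier_vec n" "y \<in> carrier_vec n" for x y
    using that mat_inverse_vec[OF Si S inv(2)] by metis
  have Tz: "x = 0\<^sub>v n" if "Ti *\<^sub>v x = 0\<^sub>v n" "x \<in> carrier_vec n" for x
  proof -
    have "x = T *\<^sub>v (Ti *\<^sub>v x)" using mat_inverse_vec[OF T Ti inv(3)] that(2) by simp
    thus ?thesis unfolding that(1) by (simp add: dim_mat_vec)
  qed
  have part1: "x = 0\<^sub>v n \<and> y = 0\<^sub>v n"
    if a: "0 \<le> a" and ev: "pencil_eigenpair n (S * E * Ti) (S * A * Ti) a b x y"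
      and Cx: "C * Ti *\<^sub>v x = 0\<^sub>v m" and Cy: "C * Ti *\<^sub>v y = 0\<^sub>v m" for a b x y
  proof -
    from ev have x: "x \<in> carrier_vec n" and y: "y \<in> carrier_vec n" by (auto simp: pencil_eigenpair_def)
    note [simp] = carrier_vecD[OF x] carrier_vecD[OF y]
    define x' where "x' = Ti *\<^sub>v x"
    define y' where "y' = Ti *\<^sub>v y"
    have [simp]: "dim_vec x' = n" "dim_vec y' = n" by (simp_all add: x'_def y'_def)
    have "S *\<^sub>v (A *\<^sub>v x') = S *\<^sub>v (a \<cdot>\<^sub>v (E *\<^sub>v x') - b \<cdot>\<^sub>v (E *\<^sub>v y'))"
      using ev by (simp add: pencil_eigenpair_def dim_mat_vec x'_def y'_def)
    hence 1: "A *\<^sub>v x' = a \<cdot>\<^sub>v (E *\<^sub>v x') - b \<cdot>\<^sub>v (E *\<^sub>v y')" by (rule Sinj) (rule carrier_vecI, simp)+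
    have "S *\<^sub>v (A *\<^sub>v y') = S *\<^sub>v (b \<cdot>\<^sub>v (E *\<^sub>v x') + a \<cdot>\<^sub>v (E *\<^sub>v y'))"
      using ev by (simp add: pencil_eigenpair_def dim_mat_vec x'_def y'_def)
    hence 2: "A *\<^sub>v y' = b \<cdot>\<^sub>v (E *\<^sub>v x') + a \<cdot>\<^sub>v (E *\<^sub>v y')" by (rule Sinj) (rule carrier_vecI, simp)+
    have "pencil_eigenpair n E A a b x' y'"
      unfolding pencil_eigenpair_def using 1 2 by (auto intro!: carrier_vecI)
    moreover have "C *\<^sub>v x' = 0\<^sub>v m" "C *\<^sub>v y' = 0\<^sub>v m" using Cx Cy by (simp_all add: dim_mat_vec x'_def y'_def)
    ultimately have "x' = 0\<^sub>v n \<and> y' = 0\<^sub>v n" using output_kernel_trivialD(1)[OF ok carrier_matD(1)[OF C] a] by blast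
    thus ?thesis using Tz x y unfolding x'_def y'_def by blast
  qed
  have part2: "v = 0\<^sub>v n"
    if v: "v \<in> carrier_vec n" and w: "w \<in> carrier_vec n" and Ev: "S * E * Ti *\<^sub>v v = 0\<^sub>v n"
      and Av: "S * A * Ti *\<^sub>v v = S * E * Ti *\<^sub>v w" and Cv: "C * Ti *\<^sub>v v = 0\<^sub>v m" for v w
  proof -
    note [simp] = carrier_vecD[OF v] carrier_vecD[OF w]
    define v' where "v' = Ti *\<^sub>v v"
    define w' where "w' = Ti *\<^sub>v w"
    have v': "v' \<in> carrier_vec n" and w': "w' \<in> carrier_vec n" unfolding v'_def w'_def by (rule carrier_vecI, simp)+
    note [simp] = carrier_vecD[OF v'] carrier_vecD[OF w']
    have "S *\<^sub>v (E *\<^sub>v v') = S *\<^sub>v 0\<^sub>v n" using Ev by (simp add: dim_mat_vec v'_def)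
    hence 1: "E *\<^sub>v v' = 0\<^sub>v n" by (rule Sinj) (rule carrier_vecI, simp)+
    have "S *\<^sub>v (A *\<^sub>v v') = S *\<^sub>v (E *\<^sub>v w')" using Av by (simp add: dim_mat_vec v'_def w'_def)
    hence 2: "A *\<^sub>v v' = E *\<^sub>v w'" by (rule Sinj) (rule carrier_vecI, simp)+
    have "C *\<^sub>v v' = 0\<^sub>v m" using Cv by (simp add: dim_mat_vec v'_def)
    from output_kernel_trivialD(2)[OF ok carrier_matD(1)[OF C] v' w' 1 2 this] show ?thesis using Tz[OF _ v] by (simp add: v'_def)
  qed
  have "dim_row (C * Ti) = m" by simp
  thus ?thesis unfolding output_kernel_trivial_def using part1 part2 by metis
qed

section \<open>Balancing\<close>

definition semi_explicit :: "nat \<Rightarrow> nat \<Rightarrow> real mat" where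
  "semi_explicit n r = four_block_mat (1\<^sub>m r) (0\<^sub>m r (n - r)) (0\<^sub>m (n - r) r) (0\<^sub>m (n - r) (n - r))"

text \<open>The clause on the solutions in the final theorem with \<open>r\<close> as an argument.
  The products \<open>Pf * E\<^sup>T\<close> and \<open>E\<^sup>T * Pc\<close> take the place of the
  two Gramians of a balanced realization.\<close>

definition balanced_gramians :: "nat \<Rightarrow> nat \<Rightarrow> real mat \<Rightarrow> real mat \<Rightarrow> real mat \<Rightarrow> real mat \<Rightarrow> real mat \<Rightarrow> bool" where
  "balanced_gramians n r E A B C R \<longleftrightarrow>
     (\<exists>k k2 k3 k4 (\<sigma>::nat \<Rightarrow> real) (s2::nat \<Rightarrow> real) (s3::nat \<Rightarrow> real).
           k + k2 + k3 + k4 = r \<and>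
           (\<forall>i j. i \<le> j \<longrightarrow> j < k \<longrightarrow> \<sigma> j \<le> \<sigma> i) \<and> (\<forall>i < k. 0 < \<sigma> i) \<and>
           (\<forall>i < k2. 0 < s2 i) \<and> (\<forall>i < k3. 0 < s3 i) \<and>
           (\<forall>Pc Pf. stab_sol_GC n E A B C Pc \<longrightarrow> stab_sol_GF n E A B C R Pf \<longrightarrow>
              Pf * E\<^sup>T = diag_of n (\<lambda>i. if i < k then \<sigma> i
                                       else if i < k + k2 then s2 (i - k) else 0) \<and>
              E\<^sup>T * Pc = diag_of n (\<lambda>i. if i < k then \<sigma> i
                                       else if i < k + k2 then 0
                                       else if i < k + k2 + k3 then s3 (i - k - k2) else 0)))"

lemma semi_explicit_incl: "r \<le> n \<Longrightarrow> semi_explicit n r = incl n r * (incl n r)\<^sup>T"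
  unfolding semi_explicit_def
  by (subst incl_conj_four_block[OF one_carrier_mat, symmetric]) (simp_all add: dim_mat_ring)

lemma incl_diag_of:
  assumes "r \<le> n" "\<And>i. r \<le> i \<Longrightarrow> i < n \<Longrightarrow> f i = 0"
  shows "incl n r * diag_of r f * (incl n r)\<^sup>T = (diag_of n f :: real mat)"
  using assms
  by (intro eq_matI) (auto simp: mult_incl_transpose_index incl_mult_index diag_of_def simp del: index_mult_mat(1))

lemma stabilizing_riccatiD:
  assumes "stabilizing_riccati n E A N W P"
  shows "P \<in> carrier_mat n n" "A * P\<^sup>T + P * A\<^sup>T - P * N * P\<^sup>T + W = 0\<^sub>m n n" "E * P\<^sup>T = P * E\<^sup>T"
    "stable_pencil n E (A - P * N)"
  using assms unfolding stabilizing_riccati_def by blast+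

text \<open>At the inverse transpose of \<open>Q\<close> the linear terms of (GF) give
  \<open>J - R\<close> and \<open>- J - R\<close>, and the quadratic term is
  \<open>B * B\<^sup>T\<close>; the constant term \<open>B * B\<^sup>T + 2 \<cdot>\<^sub>m R\<close>
  cancels the rest. The closed loop is \<open>(J - R - B * B\<^sup>T) * Q\<close>, the dissipative
  output feedback, whose stability is \<open>semi_explicit_stable_pencil\<close>.\<close>

lemma pH_inverse_transpose_riccati:
  assumes pH: "pH_system n m E J R Q B" and r: "r \<le> n" and E: "E = semi_explicit n r"
    and ok: "output_kernel_trivial n E ((J - R) * Q) (B\<^sup>T * Q)"
    and Qi: "Qi \<in> carrier_mat n n" "Q * Qi = 1\<^sub>m n" "Qi * Q = 1\<^sub>m n"
  shows "stabilizing_riccati n E ((J - R) * Q) ((B\<^sup>T * Q)\<^sup>T * (B\<^sup>T * Q)) (B * B\<^sup>T + 2 \<cdot>\<^sub>m R) Qi\<^sup>T"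
proof -
  from pH have Ec: "E \<in> carrier_mat n n" and J: "J \<in> carrier_mat n n" "J\<^sup>T = - J" and R: "psd_mat n R"
    and Q: "Q \<in> carrier_mat n n" and B: "B \<in> carrier_mat n m" and EQ: "E\<^sup>T * Q = Q\<^sup>T * E"
    by (auto simp: pH_system_def)
  note [simp] = carrier_matD[OF Ec] carrier_matD[OF J(1)] carrier_matD[OF psd_matD(1)[OF R]] carrier_matD[OF Q]
    carrier_matD[OF B] carrier_matD[OF Qi(1)]
  have QQt: "Q\<^sup>T * Qi\<^sup>T = 1\<^sub>m n" "Qi\<^sup>T * Q\<^sup>T = 1\<^sub>m n"
    using arg_cong[OF Qi(2), of transpose_mat] arg_cong[OF Qi(3), of transpose_mat] by (simp_all add: dim_mat_ring)
  have c1: "Q * (Qi * X) = X" if "dim_row X = n" for X by (rule mat_inverse_cancel[OF Q Qi(1,2) that])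
  have c2: "Qi\<^sup>T * (Q\<^sup>T * X) = X" if "dim_row X = n" for X
    by (rule mat_inverse_cancel[OF _ _ QQt(2) that]) (use Q Qi in simp_all)
  have "(J - R) * Q * (Qi\<^sup>T)\<^sup>T + Qi\<^sup>T * ((J - R) * Q)\<^sup>T
      - Qi\<^sup>T * ((B\<^sup>T * Q)\<^sup>T * (B\<^sup>T * Q)) * (Qi\<^sup>T)\<^sup>T + (B * B\<^sup>T + 2 \<cdot>\<^sub>m R) = 0\<^sub>m n n"
    by (rule eq_matI) (simp_all add: dim_mat_ring Qi(2) c1 c2 J(2) psd_matD(2)[OF R] del: index_mult_mat(1))
  moreover have "E * (Qi\<^sup>T)\<^sup>T = Qi\<^sup>T * E\<^sup>T"
  proof -
    have "E * (Qi\<^sup>T)\<^sup>T = Qi\<^sup>T * (Q\<^sup>T * E) * Qi" by (simp add: dim_mat_ring c2)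
    also have "\<dots> = Qi\<^sup>T * E\<^sup>T" unfolding EQ[symmetric] by (simp add: dim_mat_ring Qi(2))
    finally show ?thesis .
  qed
  moreover have "stable_pencil n E ((J - R) * Q - Qi\<^sup>T * ((B\<^sup>T * Q)\<^sup>T * (B\<^sup>T * Q)))"
  proof -
    have "(J - R) * Q - Qi\<^sup>T * ((B\<^sup>T * Q)\<^sup>T * (B\<^sup>T * Q)) = (J - R - B * B\<^sup>T) * Q"
      by (simp add: dim_mat_ring c2)
    moreover have "(J - R - B * B\<^sup>T) * Q \<in> carrier_mat n n" by (rule carrier_matI) simp_all
    hence "stable_pencil n E ((J - R - B * B\<^sup>T) * Q)"
      by (rule semi_explicit_stable_pencil[OF _ r E[unfolded semi_explicit_def] pH_output_feedback_kernel[OF pH ok]])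
    ultimately show ?thesis by metis
  qed
  ultimately show ?thesis using Qi(1) by (simp add: stabilizing_riccati_def)
qed

lemma semi_explicit_compress:
  assumes r: "r \<le> n" and X: "psd_mat n X" and E: "E = semi_explicit n r" and XE: "X * E = X"
  shows "X = incl n r * ((incl n r)\<^sup>T * X * incl n r) * (incl n r)\<^sup>T"
proof -
  note [simp] = carrier_matD[OF psd_matD(1)[OF X]]
  have E': "E = incl n r * (incl n r)\<^sup>T" using semi_explicit_incl[OF r] E by simp
  have "E * X = X" using arg_cong[OF XE, of transpose_mat] psd_matD(2)[OF X] by (simp add: E' dim_mat_ring)
  hence "X = E * (X * E)" using XE by simp
  thus ?thesis unfolding E' by (simp add: dim_mat_ring)
qed

text \<open>\<open>S\<close> comes from matrices \<open>X\<close>, \<open>Y\<close> that depend on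
  the data alone: by uniqueness every pair of solutions has these products. The similarity acts on
  both sides with one block diagonal matrix, which keeps \<open>E\<close>.\<close>

lemma balance_semi_explicit_system:
  assumes pH: "pH_system n m E J R Q B" and r: "r \<le> n" and E: "E = semi_explicit n r"
    and ok: "output_kernel_trivial n E ((J - R) * Q) (B\<^sup>T * Q)"
  obtains S Si where "S \<in> carrier_mat n n" "Si \<in> carrier_mat n n" "S * Si = 1\<^sub>m n" "Si * S = 1\<^sub>m n"
    "S * E * Si = E" "balanced_gramians n r E (S * ((J - R) * Q) * Si) (S * B) (B\<^sup>T * Q * Si) (S * R * S\<^sup>T)"
    "\<And>i j. invertible_mat Q \<Longrightarrow> i < r \<Longrightarrow> j < r \<Longrightarrow> i \<noteq> j \<Longrightarrow> (Si\<^sup>T * Q * Si) $$ (i,j) = 0"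
proof -
  from pH have Ec: "E \<in> carrier_mat n n" and J: "J \<in> carrier_mat n n" "J\<^sup>T = - J" and R: "psd_mat n R"
    and Q: "Q \<in> carrier_mat n n" and B: "B \<in> carrier_mat n m" and EQ: "E\<^sup>T * Q = Q\<^sup>T * E" "psd_mat n (E\<^sup>T * Q)"
    by (auto simp: pH_system_def)
  note Rc = psd_matD(1)[OF R]
  note [simp] = carrier_matD[OF Ec] carrier_matD[OF J(1)] carrier_matD[OF Rc] carrier_matD[OF Q] carrier_matD[OF B]
  define A where "A = (J - R) * Q"
  define C where "C = B\<^sup>T * Q"
  have A: "A \<in> carrier_mat n n" unfolding A_def by (rule carrier_matI) simp_all
  have C: "C \<in> carrier_mat m n" unfolding C_def by (rule carrier_matI) simp_all
  note [simp] = carrier_matD[OF A] carrier_matD[OF C]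
  have pN: "psd_mat n (C\<^sup>T * C)" using psd_gram[of "C\<^sup>T" n m] C by simp
  have pB: "psd_mat n (B * B\<^sup>T)" by (rule psd_gram[OF B])
  have pW: "psd_mat n (B * B\<^sup>T + 2 \<cdot>\<^sub>m R)" by (intro psd_add pB psd_smult R) simp
  define f where "f P \<longleftrightarrow> stabilizing_riccati n E A (C\<^sup>T * C) (B * B\<^sup>T + 2 \<cdot>\<^sub>m R) P" for P
  define g where "g P \<longleftrightarrow> stabilizing_riccati n E\<^sup>T A\<^sup>T (B * B\<^sup>T) (C\<^sup>T * C) P" for P
  have Et: "E\<^sup>T \<in> carrier_mat n n" and At: "A\<^sup>T \<in> carrier_mat n n" using Ec A by simp_all
  let ?P = "incl n r :: real mat"
  have PP: "?P\<^sup>T * ?P = 1\<^sub>m r" by (rule incl_transpose_incl[OF r])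
  have E': "E = ?P * ?P\<^sup>T" using semi_explicit_incl[OF r] E by simp
  have EE: "E * E = E" "E\<^sup>T = E"
  proof -
    have "E * E = ?P * (?P\<^sup>T * ?P) * ?P\<^sup>T" unfolding E' by (simp add: dim_mat_ring)
    thus "E * E = E" unfolding PP by (simp add: E' dim_mat_ring)
    show "E\<^sup>T = E" unfolding E' by (simp add: dim_mat_ring)
  qed
  \<comment> \<open>If a pair of solutions exists, \<open>X\<close> and \<open>Y\<close> are its
    products with \<open>E\<close>. If none exists, the claim on solutions is void, and
    \<open>Y = E\<^sup>T * Q\<close> is taken so that diagonalizing \<open>Y\<close> settles the
    block of \<open>Q\<close>; \<open>X = 0\<close> fills the vacant place.\<close>
  have "\<exists>X Y. psd_mat n X \<and> psd_mat n Y \<and> X * E = X \<and> Y * E = Y \<and>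
     (\<forall>Pf Pg. f Pf \<longrightarrow> g Pg \<longrightarrow> Pf * E = X \<and> Pg * E = Y) \<and>
     ((\<exists>Pf Pg. f Pf \<and> g Pg) \<or> Y = E\<^sup>T * Q)"
  proof (cases "\<exists>Pf Pg. f Pf \<and> g Pg")
    case True
    then obtain Pf Pg where P: "f Pf" "g Pg" by blast
    note Pf = stabilizing_riccatiD[OF P(1)[unfolded f_def]] and Pg = stabilizing_riccatiD[OF P(2)[unfolded g_def]]
    note [simp] = carrier_matD[OF Pf(1)] carrier_matD[OF Pg(1)]
    have 1: "psd_mat n (Pf * E)"
      using riccati_stabilizing_psd[OF Ec A pN pW Pf] EE(2) by simp
    have 2: "psd_mat n (Pg * E)"
      using riccati_stabilizing_psd[OF Et At pB pN Pg] EE(2) by simp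
    have 3: "Pf' * E = Pf * E" if "f Pf'" for Pf'
    proof -
      note Pf' = stabilizing_riccatiD[OF that[unfolded f_def]]
      show ?thesis
        using riccati_stabilizing_unique[OF Ec A pN psd_matD(1)[OF pW] Pf'(1) Pf(1) Pf'(2,3) Pf(2,3) Pf'(4) Pf(4)] EE(2) by simp
    qed
    have 4: "Pg' * E = Pg * E" if "g Pg'" for Pg'
    proof -
      note Pg' = stabilizing_riccatiD[OF that[unfolded g_def]]
      show ?thesis
        using riccati_stabilizing_unique[OF Et At pB psd_matD(1)[OF pN] Pg'(1) Pg(1) Pg'(2,3) Pg(2,3) Pg'(4) Pg(4)] EE(2) by simp
    qed
    have 5: "Pf * E * E = Pf * E" "Pg * E * E = Pg * E" by (simp_all add: dim_mat_ring EE)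
    have 6: "\<forall>Pf' Pg'. f Pf' \<longrightarrow> g Pg' \<longrightarrow> Pf' * E = Pf * E \<and> Pg' * E = Pg * E" using 3 4 by blast
    have 7: "(\<exists>Pf Pg. f Pf \<and> g Pg) \<or> Pg * E = E\<^sup>T * Q" using P by blast
    show ?thesis
      by (intro exI[of _ "Pf * E"] exI[of _ "Pg * E"] conjI) (rule 1 2 5 6 7)+
  next
    case False
    have "psd_mat n (0\<^sub>m n n)" by (auto simp: psd_mat_def dim_zero_mult_mat_vec)
    moreover have "E\<^sup>T * Q * E = E\<^sup>T * Q"
    proof -
      have "E\<^sup>T * Q * E = Q\<^sup>T * (E * E)" unfolding EQ(1) by (simp add: dim_mat_ring)
      thus ?thesis unfolding EE EQ(1)[unfolded EE] .
    qed
    moreover have "0\<^sub>m n n * E = 0\<^sub>m n n" by (simp add: dim_zero_mult_mat)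
    ultimately show ?thesis using False EQ(2) by blast
  qed
  then obtain X Y where X: "psd_mat n X" "X * E = X" and Y: "psd_mat n Y" "Y * E = Y"
    and fg: "\<And>Pf Pg. f Pf \<Longrightarrow> g Pg \<Longrightarrow> Pf * E = X \<and> Pg * E = Y"
    and alt: "(\<exists>Pf Pg. f Pf \<and> g Pg) \<or> Y = E\<^sup>T * Q" by blast
  define X1 where "X1 = ?P\<^sup>T * X * ?P"
  define Y1 where "Y1 = ?P\<^sup>T * Y * ?P"
  have Pt: "?P\<^sup>T \<in> carrier_mat r n" by (rule carrier_matI) simp_all
  have pX1: "psd_mat r X1" using psd_congruence[OF X(1) Pt] by (simp add: X1_def)
  have pY1: "psd_mat r Y1" using psd_congruence[OF Y(1) Pt] by (simp add: Y1_def)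
  have XX: "X = ?P * X1 * ?P\<^sup>T" unfolding X1_def by (rule semi_explicit_compress[OF r X(1) E X(2)])
  have YY: "Y = ?P * Y1 * ?P\<^sup>T" unfolding Y1_def by (rule semi_explicit_compress[OF r Y(1) E Y(2)])
  obtain S1 T1 k k2 k3 k4 \<sigma> s2 s3 where
    S1: "S1 \<in> carrier_mat r r" and T1: "T1 \<in> carrier_mat r r" and ST: "S1 * T1 = 1\<^sub>m r" "T1 * S1 = 1\<^sub>m r"
    and ks: "k + k2 + k3 + k4 = r" and dec: "\<And>i j. i \<le> j \<Longrightarrow> j < k \<Longrightarrow> \<sigma> j \<le> \<sigma> i"
    and pos: "\<And>i. i < k \<Longrightarrow> 0 < (\<sigma> i :: real)" "\<And>i. i < k2 \<Longrightarrow> 0 < (s2 i :: real)" "\<And>i. i < k3 \<Longrightarrow> 0 < (s3 i :: real)"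
    and SX: "S1 * X1 * S1\<^sup>T = diag_of r (\<lambda>i. if i < k then \<sigma> i else if i < k + k2 then s2 (i - k) else 0)"
    and TY: "T1\<^sup>T * Y1 * T1 = diag_of r (\<lambda>i. if i < k then \<sigma> i else if i < k + k2 then 0
        else if i < k + k2 + k3 then s3 (i - k - k2) else 0)"
    by (rule balanced_contragredient_diagonalization[OF pX1 pY1]) (rule that)
  let ?f = "\<lambda>i. if i < k then \<sigma> i else if i < k + k2 then s2 (i - k) else 0"
  let ?g = "\<lambda>i. if i < k then \<sigma> i else if i < k + k2 then 0 else if i < k + k2 + k3 then s3 (i - k - k2) else 0"
  note [simp] = carrier_matD[OF S1] carrier_matD[OF T1] carrier_matD[OF psd_matD(1)[OF pX1]] carrier_matD[OF psd_matD(1)[OF pY1]]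
    carrier_matD[OF psd_matD(1)[OF X(1)]] carrier_matD[OF psd_matD(1)[OF Y(1)]]
  \<comment> \<open>The projection complementary to \<open>E\<close>. With it, \<open>S\<close> and
    \<open>Si\<close> are \<open>diag(S1, 1)\<close> and \<open>diag(T1, 1)\<close> without block
    matrices.\<close>
  define K where "K = 1\<^sub>m n - E"
  have [simp]: "dim_row K = n" "dim_col K = n" by (simp_all add: K_def)
  have PPX: "?P\<^sup>T * (?P * Z) = Z" if "dim_row Z = r" for Z
  proof -
    have "?P\<^sup>T * (?P * Z) = ?P\<^sup>T * ?P * Z" using that by (simp add: dim_mat_ring)
    thus ?thesis unfolding PP using that by (simp add: dim_mat_ring)
  qed
  have KP: "K * ?P = 0\<^sub>m n r"
    by (rule eq_matI) (simp_all add: K_def E' dim_mat_ring PP del: index_mult_mat(1))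
  have PK: "?P\<^sup>T * K = 0\<^sub>m r n"
    by (rule eq_matI) (simp_all add: K_def E' dim_mat_ring PPX del: index_mult_mat(1))
  have KK: "K * K = K"
    by (rule eq_matI) (simp_all add: K_def dim_mat_ring EE del: index_mult_mat(1))
  define S where "S = ?P * S1 * ?P\<^sup>T + K"
  define Si where "Si = ?P * T1 * ?P\<^sup>T + K"
  have S: "S \<in> carrier_mat n n" and Si: "Si \<in> carrier_mat n n"
    unfolding S_def Si_def by (rule carrier_matI; simp)+
  note [simp] = carrier_matD[OF S] carrier_matD[OF Si]
  have SP: "S * ?P = ?P * S1" "Si * ?P = ?P * T1"
    unfolding S_def Si_def
    by (rule eq_matI; simp add: dim_mat_ring PP KP del: index_mult_mat(1))+
  have PS: "?P\<^sup>T * S = S1 * ?P\<^sup>T" "?P\<^sup>T * Si = T1 * ?P\<^sup>T"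
    unfolding S_def Si_def
    by (rule eq_matI; simp add: dim_mat_ring PPX PK del: index_mult_mat(1))+
  have KS: "K * S = K" "K * Si = K"
  proof -
    have z: "K * (?P * Z) = 0\<^sub>m n (dim_col Z)" if "dim_row Z = r" for Z
    proof -
      have "K * (?P * Z) = K * ?P * Z" using that by (simp add: dim_mat_ring)
      thus ?thesis unfolding KP using that by (simp add: dim_zero_mult_mat)
    qed
    show "K * S = K" "K * Si = K" unfolding S_def Si_def
      by (rule eq_matI; simp add: dim_mat_ring z KK del: index_mult_mat(1))+
  qed
  have i1: "S * Si = 1\<^sub>m n"
  proof -
    have "S * Si = ?P * (S1 * (?P\<^sup>T * Si)) + K * Si" by (simp add: S_def dim_mat_ring)
    also have "\<dots> = ?P * ((S1 * T1) * ?P\<^sup>T) + K" unfolding PS KS by (simp add: dim_mat_ring)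
    also have "\<dots> = 1\<^sub>m n" unfolding ST by (rule eq_matI) (simp_all add: dim_mat_ring K_def E' del: index_mult_mat(1))
    finally show ?thesis .
  qed
  have i2: "Si * S = 1\<^sub>m n" by (rule mat_mult_left_right_inverse[OF S Si i1])
  have SE: "S * E * Si = E"
  proof -
    have "S * E * Si = (S * ?P) * (?P\<^sup>T * Si)" unfolding E' by (simp add: dim_mat_ring)
    also have "\<dots> = ?P * ((S1 * T1) * ?P\<^sup>T)" unfolding SP PS by (simp add: dim_mat_ring)
    finally show ?thesis unfolding ST by (simp add: E' dim_mat_ring)
  qed
  have PSt: "?P\<^sup>T * S\<^sup>T = S1\<^sup>T * ?P\<^sup>T" using arg_cong[OF SP(1), of transpose_mat] by (simp add: dim_mat_ring)
  have SiPt: "Si\<^sup>T * ?P = ?P * T1\<^sup>T" using arg_cong[OF PS(2), of transpose_mat] by (simp add: dim_mat_ring)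
  have dX: "S * X * S\<^sup>T = diag_of n ?f"
  proof -
    have "S * X * S\<^sup>T = (S * ?P) * X1 * (?P\<^sup>T * S\<^sup>T)" unfolding XX by (simp add: dim_mat_ring)
    also have "\<dots> = ?P * (S1 * X1 * S1\<^sup>T) * ?P\<^sup>T" unfolding SP PSt by (simp add: dim_mat_ring)
    also have "\<dots> = diag_of n ?f" unfolding SX by (rule incl_diag_of[OF r]) (use ks in auto)
    finally show ?thesis .
  qed
  have dY: "Si\<^sup>T * Y * Si = diag_of n ?g"
  proof -
    have "Si\<^sup>T * Y * Si = (Si\<^sup>T * ?P) * Y1 * (?P\<^sup>T * Si)" unfolding YY by (simp add: dim_mat_ring)
    also have "\<dots> = ?P * (T1\<^sup>T * Y1 * T1) * ?P\<^sup>T" unfolding SiPt PS by (simp add: dim_mat_ring)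
    also have "\<dots> = diag_of n ?g" unfolding TY by (rule incl_diag_of[OF r]) (use ks in auto)
    finally show ?thesis .
  qed
  \<comment> \<open>Solutions of the transformed equations are pulled back, their products are the
    fixed \<open>X\<close> and \<open>Y\<close>, and these are diagonalized by \<open>S\<close> and
    \<open>Si\<close>. The second equation is treated with the transposed data, hence with
    \<open>Si\<^sup>T\<close> in the role of \<open>S\<close>.\<close>
  have sol: "Pf * E\<^sup>T = diag_of n ?f \<and> E\<^sup>T * Pc = diag_of n ?g"
    if c: "stab_sol_GC n E (S * A * Si) (S * B) (C * Si) Pc"
      and fl: "stab_sol_GF n E (S * A * Si) (S * B) (C * Si) (S * R * S\<^sup>T) Pf" for Pc Pf
  proof -
    have SA: "S * A * Si \<in> carrier_mat n n" and SB: "S * B \<in> carrier_mat n m" and CS: "C * Si \<in> carrier_mat m n"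
      and SR: "S * R * S\<^sup>T \<in> carrier_mat n n" by (rule carrier_matI; simp)+
    have N_eq: "(C * Si)\<^sup>T * (C * Si) = Si\<^sup>T * (C\<^sup>T * C) * Si" by (simp add: dim_mat_ring)
    have W_eq: "S * B * (S * B)\<^sup>T + 2 \<cdot>\<^sub>m (S * R * S\<^sup>T) = S * (B * B\<^sup>T + 2 \<cdot>\<^sub>m R) * S\<^sup>T"
    proof -
      have "2 \<cdot>\<^sub>m (S * R * S\<^sup>T) = S * (2 \<cdot>\<^sub>m R) * S\<^sup>T"
        using mult_smult_distrib[OF S Rc, of 2] mult_smult_assoc_mat[OF mult_carrier_mat[OF S Rc], of "S\<^sup>T" n 2] S by simp
      thus ?thesis by (simp add: dim_mat_ring)
    qed
    have "stabilizing_riccati n (S * E * Si) (S * A * Si) (Si\<^sup>T * (C\<^sup>T * C) * Si) (S * (B * B\<^sup>T + 2 \<cdot>\<^sub>m R) * S\<^sup>T) Pf"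
      using fl stab_sol_GF_riccati[OF Ec SA SB CS SR, of Pf] unfolding SE N_eq W_eq by blast
    note tf = stabilizing_riccati_transform[OF Ec A psd_matD(1)[OF pN] psd_matD(1)[OF pW] S Si S Si i1 i2 i1 i2 this]
    from c have Pc: "Pc \<in> carrier_mat n n" and symc: "E\<^sup>T * Pc = Pc\<^sup>T * E" by (auto simp: stab_sol_GC_def)
    have St: "S\<^sup>T \<in> carrier_mat n n" and Sit: "Si\<^sup>T \<in> carrier_mat n n" using S Si by simp_all
    have i3: "Si\<^sup>T * S\<^sup>T = 1\<^sub>m n" "S\<^sup>T * Si\<^sup>T = 1\<^sub>m n"
      using arg_cong[OF i1, of transpose_mat] arg_cong[OF i2, of transpose_mat] by (simp_all add: dim_mat_ring)
    have "E\<^sup>T = Si\<^sup>T * E\<^sup>T * S\<^sup>T" using arg_cong[OF SE, of transpose_mat] by (simp add: dim_mat_ring)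
    moreover have "(S * A * Si)\<^sup>T = Si\<^sup>T * A\<^sup>T * S\<^sup>T" by (simp add: dim_mat_ring)
    moreover have "S * B * (S * B)\<^sup>T = (S\<^sup>T)\<^sup>T * (B * B\<^sup>T) * S\<^sup>T" by (simp add: dim_mat_ring)
    moreover have "(C * Si)\<^sup>T * (C * Si) = Si\<^sup>T * (C\<^sup>T * C) * (Si\<^sup>T)\<^sup>T" by (simp add: dim_mat_ring)
    ultimately have "stabilizing_riccati n (Si\<^sup>T * E\<^sup>T * S\<^sup>T) (Si\<^sup>T * A\<^sup>T * S\<^sup>T) ((S\<^sup>T)\<^sup>T * (B * B\<^sup>T) * S\<^sup>T)
        (Si\<^sup>T * (C\<^sup>T * C) * (Si\<^sup>T)\<^sup>T) Pc\<^sup>T"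
      using stab_sol_GC_riccati[OF Ec SA SB CS c] by metis
    note tg = stabilizing_riccati_transform[OF Et At psd_matD(1)[OF pB] psd_matD(1)[OF pN] Sit St Sit St i3 i3 this]
    have X_eq: "(Si * Pf * Si\<^sup>T) * E = X" and Y_eq: "(S\<^sup>T * Pc\<^sup>T * (S\<^sup>T)\<^sup>T) * E = Y"
      using fg tf(1) tg(1) unfolding f_def g_def by blast+
    have "Pf * E\<^sup>T = diag_of n ?f"
      using tf(2) unfolding SE EE(2) X_eq dX .
    moreover have "E\<^sup>T * Pc = diag_of n ?g"
    proof -
      have "Si\<^sup>T * E\<^sup>T * S\<^sup>T = E\<^sup>T" using arg_cong[OF SE, of transpose_mat] by (simp add: dim_mat_ring)
      hence "Pc\<^sup>T * E = Si\<^sup>T * Y * Si"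
        using tg(2) unfolding transpose_transpose by (simp add: Y_eq[unfolded transpose_transpose])
      thus ?thesis unfolding symc dY .
    qed
    ultimately show ?thesis ..
  qed
  show ?thesis
  proof (rule that[OF S Si i1 i2 SE])
    show "balanced_gramians n r E (S * ((J - R) * Q) * Si) (S * B) (B\<^sup>T * Q * Si) (S * R * S\<^sup>T)"
    proof -
      have 1: "\<forall>i j. i \<le> j \<longrightarrow> j < k \<longrightarrow> \<sigma> j \<le> \<sigma> i" using dec by blast
      have 2: "\<forall>i<k. 0 < \<sigma> i" "\<forall>i<k2. 0 < s2 i" "\<forall>i<k3. 0 < s3 i" using pos by blast+
      have 3: "\<forall>Pc Pf. stab_sol_GC n E (S * A * Si) (S * B) (C * Si) Pc \<longrightarrow>
          stab_sol_GF n E (S * A * Si) (S * B) (C * Si) (S * R * S\<^sup>T) Pf \<longrightarrow>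
          Pf * E\<^sup>T = diag_of n ?f \<and> E\<^sup>T * Pc = diag_of n ?g"
        using sol by blast
      show ?thesis unfolding A_def[symmetric] C_def[symmetric] balanced_gramians_def
        by (rule exI[of _ k], rule exI[of _ k2], rule exI[of _ k3], rule exI[of _ k4],
            rule exI[of _ \<sigma>], rule exI[of _ s2], rule exI[of _ s3], intro conjI) (rule ks 1 2 3)+
    qed
    fix i j assume Qinv: "invertible_mat Q" and ij: "i < r" "j < r" "i \<noteq> j"
    have ijn: "i < n" "j < n" using ij r by simp_all
    show "(Si\<^sup>T * Q * Si) $$ (i,j) = 0"
    proof (cases "\<exists>Pf Pg. f Pf \<and> g Pg")
      case True
      then obtain Pf Pg where P: "f Pf" "g Pg" by blast
      from invertible_mat_obtain[OF Qinv Q] obtain Qi where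
        Qi: "Qi \<in> carrier_mat n n" "Q * Qi = 1\<^sub>m n" "Qi * Q = 1\<^sub>m n" by blast
      note [simp] = carrier_matD[OF Qi(1)]
      have fQ: "f Qi\<^sup>T" unfolding f_def A_def C_def by (rule pH_inverse_transpose_riccati[OF pH r E ok Qi])
      \<comment> \<open>By uniqueness \<open>X\<close> is also the product belonging to the solution
        \<open>Qi\<^sup>T\<close>, so \<open>X * Q = E\<close>. In the new coordinates this says
        that the diagonal matrix of \<open>X\<close> times the transformed \<open>Q\<close> is
        \<open>E\<close>, to be read row by row.\<close>
      hence "X = Qi\<^sup>T * E\<^sup>T" using fg P(2) EE(2) by metis
      hence "X = E * Qi" using stabilizing_riccatiD(3)[OF fQ[unfolded f_def]] by simp
      hence XQ: "X * Q = E" using Qi(3) by (simp add: dim_mat_ring)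
      have "diag_of n ?f * (Si\<^sup>T * Q * Si) = S * ((X * ((Si * S)\<^sup>T * Q)) * Si)"
        unfolding dX[symmetric] by (simp add: dim_mat_ring)
      also have "\<dots> = E" unfolding i2 using XQ SE by (simp add: dim_mat_ring)
      finally have "incl n r * diag_of r ?f * ?P\<^sup>T * (Si\<^sup>T * Q * Si) = E"
        using incl_diag_of[OF r, of ?f] ks by simp
      hence "?P\<^sup>T * (incl n r * diag_of r ?f * ?P\<^sup>T * (Si\<^sup>T * Q * Si)) = ?P\<^sup>T * E" by simp
      hence "diag_of r ?f * (?P\<^sup>T * (Si\<^sup>T * Q * Si)) = ?P\<^sup>T"
        unfolding E' by (simp add: dim_mat_ring PPX)
      hence D: "(diag_of r ?f * (?P\<^sup>T * (Si\<^sup>T * Q * Si))) $$ (i,l) = ?P\<^sup>T $$ (i,l)" for l by simp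
      have e: "?f i * (Si\<^sup>T * Q * Si) $$ (i,l) = (if i = l then 1 else 0)" if "l < n" for l
      proof -
        let ?M = "?P\<^sup>T * (Si\<^sup>T * Q * Si)"
        have "(diag_of r ?f * ?M) $$ (i,l) = (\<Sum>h\<in>{0..<r}. (if i = h then ?f i else 0) * ?M $$ (h,l))"
          using ij that by (simp add: diag_of_def scalar_prod_def del: index_mult_mat(1)) (simp add: scalar_prod_def)
        also have "\<dots> = (\<Sum>h\<in>{0..<r}. if h = i then ?f i * ?M $$ (i,l) else 0)" by (intro sum.cong) auto
        also have "\<dots> = ?f i * ?M $$ (i,l)" using ij by simp
        also have "?M $$ (i,l) = (Si\<^sup>T * Q * Si) $$ (i,l)"
          using ij that r by (intro incl_transpose_mult_index) simp_all
        finally show ?thesis using D[of l] that ij ijn by (auto simp: incl_def simp del: index_mult_mat(1))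
      qed
      \<comment> \<open>In column \<open>i\<close> the left-hand side of \<open>e\<close> is 1, so
        the diagonal value cannot vanish; off the diagonal the entry of the transformed
        \<open>Q\<close> must.\<close>
      have ne: "?f i \<noteq> 0"
      proof
        assume z: "?f i = 0"
        from e[OF ijn(1)] show False unfolding z by simp
      qed
      have "?f i * (Si\<^sup>T * Q * Si) $$ (i,j) = 0" using e[OF ijn(2)] by (simp only: ij(3) if_False)
      with ne show ?thesis by (simp only: mult_eq_0_iff simp_thms)
    next
      case False
      hence YQ: "Y = E\<^sup>T * Q" using alt by blast
      \<comment> \<open>\<open>Si\<close> commutes with \<open>E\<close>, so transforming
        \<open>Y = E\<^sup>T * Q\<close> gives \<open>E\<close> times the transformed
        \<open>Q\<close>, whose first \<open>r\<close> rows are those of the latter. They are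
        diagonal by \<open>dY\<close>.\<close>
      have "?P * (?P\<^sup>T * (Si\<^sup>T * Q * Si)) = diag_of n ?g"
      proof -
        have "Si\<^sup>T * E\<^sup>T = E\<^sup>T * Si\<^sup>T"
        proof -
          have "E * Si = Si * E"
          proof -
            have "E * Si = ?P * T1 * ?P\<^sup>T" unfolding E' using PS(2) by (simp add: dim_mat_ring)
            also have "\<dots> = Si * E" unfolding E' using SP(2) by (simp add: dim_mat_ring flip: dim_assoc_mult_mat)
            finally show ?thesis .
          qed
          from arg_cong[OF this, of transpose_mat] show ?thesis by (simp add: dim_mat_ring)
        qed
        hence "diag_of n ?g = E\<^sup>T * Si\<^sup>T * Q * Si" unfolding dY[symmetric] YQ
          by (simp add: dim_mat_ring flip: dim_assoc_mult_mat)
        thus ?thesis unfolding EE(2) unfolding E' by (simp add: dim_mat_ring)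
      qed
      from arg_cong[OF this, of "\<lambda>M. M $$ (i,j)"] ij ijn r show ?thesis
        by (simp add: incl_mult_index incl_transpose_mult_index diag_of_def del: index_mult_mat(1))
    qed
  qed
qed

theorem mainTheorem6:
  fixes n m :: nat and E J R Q B :: "real mat"
  assumes pH: "pH_system n m E J R Q B"
    and reg: "regular_pencil E ((J - R) * Q)"
    and stab: "strongly_stabilizable n E ((J - R) * Q) B"
    and det: "strongly_detectable n E ((J - R) * Q) (B\<^sup>T * Q)"
  shows "\<exists>S Si T Ti. S \<in> carrier_mat n n \<and> Si \<in> carrier_mat n n \<and>
           T \<in> carrier_mat n n \<and> Ti \<in> carrier_mat n n \<and>
           S * Si = 1\<^sub>m n \<and> Si * S = 1\<^sub>m n \<and> T * Ti = 1\<^sub>m n \<and> Ti * T = 1\<^sub>m n \<and>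
    (let r = mrank E;
         Et = S * E * Ti; Jt = S * J * S\<^sup>T; Rt = S * R * S\<^sup>T;
         Qt = Si\<^sup>T * Q * Ti; Bt = S * B;
         At = (Jt - Rt) * Qt; Ct = Bt\<^sup>T * Qt
     in Et = four_block_mat (1\<^sub>m r) (0\<^sub>m r (n - r)) (0\<^sub>m (n - r) r) (0\<^sub>m (n - r) (n - r)) \<and>
        (\<exists>k k2 k3 k4 (\<sigma>::nat \<Rightarrow> real) (s2::nat \<Rightarrow> real) (s3::nat \<Rightarrow> real).
           k + k2 + k3 + k4 = r \<and>
           (\<forall>i j. i \<le> j \<longrightarrow> j < k \<longrightarrow> \<sigma> j \<le> \<sigma> i) \<and> (\<forall>i < k. 0 < \<sigma> i) \<and>
           (\<forall>i < k2. 0 < s2 i) \<and> (\<forall>i < k3. 0 < s3 i) \<and>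
           (\<forall>Pc Pf. stab_sol_GC n Et At Bt Ct Pc \<longrightarrow> stab_sol_GF n Et At Bt Ct Rt Pf \<longrightarrow>
              Pf * Et\<^sup>T = diag_of n (\<lambda>i. if i < k then \<sigma> i
                                       else if i < k + k2 then s2 (i - k) else 0) \<and>
              Et\<^sup>T * Pc = diag_of n (\<lambda>i. if i < k then \<sigma> i
                                       else if i < k + k2 then 0
                                       else if i < k + k2 + k3 then s3 (i - k - k2) else 0))) \<and>
        (invertible_mat Q \<longrightarrow>
           (\<forall>i j. i < r \<longrightarrow> r \<le> j \<longrightarrow> j < n \<longrightarrow> Qt $$ (i, j) = 0) \<and>
           (\<forall>i j. i < r \<longrightarrow> j < r \<longrightarrow> i \<noteq> j \<longrightarrow> Qt $$ (i, j) = 0)))"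
proof -
  from pH have E: "E \<in> carrier_mat n n" and J: "J \<in> carrier_mat n n" and R: "psd_mat n R"
    and Q: "Q \<in> carrier_mat n n" and B: "B \<in> carrier_mat n m"
    by (auto simp: pH_system_def)
  note [simp] = carrier_matD[OF E] carrier_matD[OF J] carrier_matD[OF psd_matD(1)[OF R]] carrier_matD[OF Q] carrier_matD[OF B]
  have A: "(J - R) * Q \<in> carrier_mat n n" and C: "B\<^sup>T * Q \<in> carrier_mat m n" by (rule carrier_matI; simp)+
  have ok: "output_kernel_trivial n E ((J - R) * Q) (B\<^sup>T * Q)"
    by (rule strongly_detectable_imp_output_kernel_trivial[OF E A C det])
  from rank_normal_form[OF E] obtain S0 Si0 T0 Ti0 r where
    S0: "S0 \<in> carrier_mat n n" and Si0: "Si0 \<in> carrier_mat n n" and T0: "T0 \<in> carrier_mat n n" and Ti0: "Ti0 \<in> carrier_mat n n"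
    and inv0: "S0 * Si0 = 1\<^sub>m n" "Si0 * S0 = 1\<^sub>m n" "T0 * Ti0 = 1\<^sub>m n" "Ti0 * T0 = 1\<^sub>m n" and r: "r \<le> n"
    and eq0: "S0 * E * Ti0 = diag_of n (\<lambda>i. if i < r then 1 else 0)" by blast
  have E0: "S0 * E * Ti0 = semi_explicit n r"
    unfolding eq0 semi_explicit_def using r by (intro eq_matI) (auto simp: diag_of_def)
  \<comment> \<open>The theorem speaks of the rank of \<open>E\<close>, while the construction
    counts pivots.\<close>
  have rk: "mrank E = r"
    by (rule mrank_rank_normal_form[OF E S0 Si0 T0 Ti0 inv0 r]) (simp add: E0 semi_explicit_incl[OF r])
  note [simp] = carrier_matD[OF S0] carrier_matD[OF Si0] carrier_matD[OF T0] carrier_matD[OF Ti0]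
  note tr = pH_system_transform[OF pH S0 Si0 T0 Ti0 inv0]
  have ok0: "output_kernel_trivial n (S0 * E * Ti0) ((S0 * J * S0\<^sup>T - S0 * R * S0\<^sup>T) * (Si0\<^sup>T * Q * Ti0))
      ((S0 * B)\<^sup>T * (Si0\<^sup>T * Q * Ti0))"
    unfolding tr(2,3) by (rule output_kernel_trivial_transform[OF E A C S0 Si0 T0 Ti0 inv0 ok])
  obtain S1 Si1 where S1: "S1 \<in> carrier_mat n n" and Si1: "Si1 \<in> carrier_mat n n"
    and inv1: "S1 * Si1 = 1\<^sub>m n" "Si1 * S1 = 1\<^sub>m n"
    and SE: "S1 * (S0 * E * Ti0) * Si1 = S0 * E * Ti0"
    and bal: "balanced_gramians n r (S0 * E * Ti0)
        (S1 * ((S0 * J * S0\<^sup>T - S0 * R * S0\<^sup>T) * (Si0\<^sup>T * Q * Ti0)) * Si1) (S1 * (S0 * B))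
        ((S0 * B)\<^sup>T * (Si0\<^sup>T * Q * Ti0) * Si1) (S1 * (S0 * R * S0\<^sup>T) * S1\<^sup>T)"
    and Qd: "\<And>i j. invertible_mat (Si0\<^sup>T * Q * Ti0) \<Longrightarrow> i < r \<Longrightarrow> j < r \<Longrightarrow> i \<noteq> j \<Longrightarrow>
        (Si1\<^sup>T * (Si0\<^sup>T * Q * Ti0) * Si1) $$ (i,j) = 0"
    by (rule balance_semi_explicit_system[OF tr(1) r E0 ok0]) (rule that)
  note [simp] = carrier_matD[OF S1] carrier_matD[OF Si1]
  \<comment> \<open>The balancing step multiplies by \<open>S1\<close> on the left and by its
    inverse on the right, so \<open>S1\<close> enters both \<open>S\<close> and
    \<open>T\<close>.\<close>
  define S where "S = S1 * S0"
  define Si where "Si = Si0 * Si1"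
  define T where "T = S1 * T0"
  define Ti where "Ti = Ti0 * Si1"
  have c: "S \<in> carrier_mat n n" "Si \<in> carrier_mat n n" "T \<in> carrier_mat n n" "Ti \<in> carrier_mat n n"
    unfolding S_def Si_def T_def Ti_def by (rule carrier_matI; simp)+
  note [simp] = c[THEN carrier_matD(1)] c[THEN carrier_matD(2)]
  have inv: "S * Si = 1\<^sub>m n" "Si * S = 1\<^sub>m n" "T * Ti = 1\<^sub>m n" "Ti * T = 1\<^sub>m n"
    using mat_inverse_cancel[OF S0 Si0 inv0(1), of Si1] mat_inverse_cancel[OF Si1 S1 inv1(2), of S0]
      mat_inverse_cancel[OF T0 Ti0 inv0(3), of Si1] mat_inverse_cancel[OF Si1 S1 inv1(2), of T0] inv0 inv1
    unfolding S_def Si_def T_def Ti_def by (simp_all add: dim_mat_ring)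
  note tr' = pH_system_transform[OF pH c inv]
  have Et: "S * E * Ti = semi_explicit n r"
    using SE unfolding E0[symmetric] by (simp add: S_def Ti_def dim_mat_ring)
  have Qt: "Si\<^sup>T * Q * Ti = Si1\<^sup>T * (Si0\<^sup>T * Q * Ti0) * Si1" by (simp add: Si_def Ti_def dim_mat_ring)
  have gram: "balanced_gramians n r (S * E * Ti) ((S * J * S\<^sup>T - S * R * S\<^sup>T) * (Si\<^sup>T * Q * Ti)) (S * B)
      ((S * B)\<^sup>T * (Si\<^sup>T * Q * Ti)) (S * R * S\<^sup>T)"
  proof -
    have 1: "S1 * ((S0 * J * S0\<^sup>T - S0 * R * S0\<^sup>T) * (Si0\<^sup>T * Q * Ti0)) * Si1
        = (S * J * S\<^sup>T - S * R * S\<^sup>T) * (Si\<^sup>T * Q * Ti)"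
      unfolding tr(2) tr'(2) by (simp add: S_def Ti_def dim_mat_ring)
    have 2: "S1 * (S0 * B) = S * B" by (simp add: S_def dim_mat_ring)
    have 3: "(S0 * B)\<^sup>T * (Si0\<^sup>T * Q * Ti0) * Si1 = (S * B)\<^sup>T * (Si\<^sup>T * Q * Ti)"
      unfolding tr(3) tr'(3) by (simp add: Ti_def dim_mat_ring)
    have 4: "S1 * (S0 * R * S0\<^sup>T) * S1\<^sup>T = S * R * S\<^sup>T" by (simp add: S_def dim_mat_ring)
    show ?thesis using bal unfolding 1 2 3 4 E0 Et .
  qed
  \<comment> \<open>In semi-explicit coordinates \<open>E\<^sup>T * Q\<close> consists of the first
    \<open>r\<close> rows of the transformed \<open>Q\<close>, and \<open>Q\<^sup>T * E\<close> has
    no columns beyond the first \<open>r\<close>. Their equality makes the upper right block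
    vanish.\<close>
  have Q12: "(Si\<^sup>T * Q * Ti) $$ (i,j) = 0" if "i < r" "r \<le> j" "j < n" for i j
  proof -
    let ?Q = "Si\<^sup>T * Q * Ti" and ?P = "incl n r :: real mat"
    have "(?P * ?P\<^sup>T)\<^sup>T * ?Q = ?Q\<^sup>T * (?P * ?P\<^sup>T)"
      using tr'(1) unfolding pH_system_def Et semi_explicit_incl[OF r] by blast
    hence "?P * (?P\<^sup>T * ?Q) = ?Q\<^sup>T * ?P * ?P\<^sup>T" by (simp add: dim_mat_ring)
    from arg_cong[OF this, of "\<lambda>M. M $$ (i,j)"] that r show ?thesis
      by (simp add: incl_mult_index incl_transpose_mult_index mult_incl_transpose_index del: index_mult_mat(1))
  qed
  have Q11: "(Si\<^sup>T * Q * Ti) $$ (i,j) = 0" if "invertible_mat Q" "i < r" "j < r" "i \<noteq> j" for i j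
  proof -
    have "invertible_mat Si0" "invertible_mat Ti0"
      using det_nonzero_imp_invertible_mat[OF Si0 det_inverse_nonzero(1)[OF Si0 S0 inv0(2)]]
        det_nonzero_imp_invertible_mat[OF Ti0 det_inverse_nonzero(1)[OF Ti0 T0 inv0(4)]] by blast+
    hence "invertible_mat (Si0\<^sup>T * Q * Ti0)"
      using that(1) Si0 Q Ti0 invertible_mat_transpose[OF Si0]
      by (intro invertible_mat_mult[of _ n]) (simp_all add: mult_carrier_mat[of _ n n _ n])
    thus ?thesis unfolding Qt using Qd that by blast
  qed
  note gram' = gram[unfolded balanced_gramians_def]
  have "invertible_mat Q \<longrightarrow>
      (\<forall>i j. i < r \<longrightarrow> r \<le> j \<longrightarrow> j < n \<longrightarrow> (Si\<^sup>T * Q * Ti) $$ (i, j) = 0) \<and>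
      (\<forall>i j. i < r \<longrightarrow> j < r \<longrightarrow> i \<noteq> j \<longrightarrow> (Si\<^sup>T * Q * Ti) $$ (i, j) = 0)"
    using Q12 Q11 by blast
  thus ?thesis unfolding Let_def rk
    by (intro exI[of _ S] exI[of _ Si] exI[of _ T] exI[of _ Ti] conjI)
      (rule c inv gram' Et[unfolded semi_explicit_def] | assumption)+
qed

end
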